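(* Let $\vec s=(s_1,\dots,s_k)\subset[n]$ be an activation sequence of length $k$. Then the exchange polynomials of the seed $\tau_n^{\vec s}=\mu_{s_k}\mu_{s_{k-1}}\cdots\mu_{s_1}(\tau_n)$ are $\boldsymbol{\mathcal{E}}^{\vec s}=\{\mathcal{E}^{\vec s}_\ell: \ell\in[n]\}$ (with $\mathcal{E}^{\vec s}_\ell$ the exchange polynomial attached to the cluster variable $Y^{\vec s}_\ell$, exchange polynomials being defined up to units of $R$).
   Context: Setting. $[n]=\{1,\dots,n\}$; $R=\mathbb{Z}[A_1,\dots,A_n]$ with $A_1,\dots,A_n$ independent indeterminates; $\mathcal{F}$ is the field of rational functions in $X_1,\dots,X_n$ over $\mathrm{Frac}(R)$. Empty products (including those with lower limit greater than upper limit) equal $1$. Seeds. A seed of rank $n$ in $\mathcal{F}$ is a pair $(\mathbf{X},\mathbf{F})$ with $\mathbf{X}=\{X_1,\dots,X_n\}$ a transcendence basis of $\mathcal{F}$ over $\mathrm{Frac}(R)$ generating $\mathcal F$ (the cluster) and $\mathbf{F}=\{F_1,\dots,F_n\}\subset R[X_1,\dots,X_n]$ (exchange polynomials, $F_i$ attached to $X_i$) such that each $F_i$ is irreducible in $R[X_1,\dots,X_n]$, is not divisible by any $X_j$, and does not involve $X_i$. For a seed, $\hat F_i$ denotes the unique Laurent polynomial $\hat F_i=\big(\prod_{j\ne i}X_j^{a_j}\big)F_i$ with integers $a_j\le 0$ such that for every $j\neq i$ the Laurent polynomial $\hat F_i|_{X_j\leftarrow F_j/X}$ lies in $R[X_1^{\pm1},\dots,X_{j-1}^{\pm1},X^{\pm1},X_{j+1}^{\pm1},\dots,X_n^{\pm1}]$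 and is not divisible by $F_j$ in that ring. Mutation. The mutation $\mu_i$ of $(\mathbf{X},\mathbf{F})$ at $i$ is the seed $(\mathbf{X}',\mathbf{F}')$ with $X'_j=X_j$ for $j\ne i$, $X'_i=\hat F_i/X_i$, and: $F'_j=F_j$ if $F_j$ does not depend on $X_i$; otherwise put $G_j=F_j|_{X_i\leftarrow (\hat F_i|_{X_j\leftarrow 0})/X'_i}$, let $H_j$ be $G_j$ with all common factors in $R[X_1,\dots,\widehat{X_i},\dots,\widehat{X_j},\dots,X_n]$ (hats mean omission) with $\hat F_i|_{X_j\leftarrow 0}$ divided out (until none remain), and $F'_j=MH_j$, where $M$ is the Laurent monomial in the new cluster variables other than $X_j'$ making $F'_j$ a polynomial not divisible by any cluster variable. This defines $F'_j$ up to a unit of $R$. The seed $\tau_n$ has cluster variables $X_1,\dots,X_n$ and exchange polynomials $F_i=A_i+\prod_{j\ne i}X_j$, $i\in[n]$. Activation sequences. An activation sequence $\vec s=(s_1,\dots,s_k)\subset[n]$ of length $k$ is an ordered subset of $[n]$ (distinct elements); $\vec s(r)=(s_1,\dots,s_r)$ for $0\le r\le k$. Put $\tau_n^{\vec s}=\mu_{s_k}\cdots\mu_{s_1}(\tau_n)$, with cluster variables denoted $Y^{\vec s}_\ell$, $\ell\in[n]$. For $k\ge1$ let $Y_{\vec s}=Y^{\vec s}_{s_k}$ be the new cluster variable created by the last mutation, at $s_k$; then $Y^{\vec s}_{s_r}=Y_{\vec s(r)}$ for $1\le r\le k$ and $Y^{\vec s}_\rho=X_\rho$ for $\rho\notin\vec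 s$. Convention: $Y_{\vec s(0)}=1$. Polynomials $\mathcal{E}^{\vec s}_\ell$. For $\sigma\notin\vec s$, $$\mathcal{E}^{\vec s}_{\sigma}=\Big(\prod_{r=1}^{k}A_{s_r}\Big)\Big(\prod_{\rho\notin \vec s,\ \rho\neq\sigma}X_\rho\Big)+A_\sigma Y_{\vec s}.$$ For $1\le i\le k$ put $C^{\vec s}_{s_i}=\prod_{r=i+2}^{k}Y_{\vec s(r)}^{2^{r-i-1}}$. Put $$P^{\vec s}_{s_k}=\mathcal{E}^{\vec s}_{s_k}=\Big(\prod_{r=1}^{k-1}A_{s_r}\Big)\Big(\prod_{\rho\notin\vec s}X_\rho\Big)+A_{s_k}Y_{\vec s(k-1)},$$ and, recursively for $i=k-1,k-2,\dots,1$, $$P^{\vec s}_{s_i}=\Big(\prod_{r=1}^{i-1}A_{s_r}\Big)\Big(\prod_{\rho\notin\vec s}X_\rho\Big)\Big(\prod_{r=i+1}^{k} P^{\vec s}_{s_r}\Big)+A_{s_i}Y_{\vec s(i-1)}Y_{\vec s(i+1)}C^{\vec s}_{s_i},$$ $$\mathcal{E}^{\vec s}_{s_i}=\Big(\prod_{r=1}^{i-1}A_{s_r}\Big)^2\Big(\prod_{\rho\notin\vec s}X_\rho\Big)^2\Big(\prod_{r=i+2}^{k} P^{\vec s}_{s_r}\Big)^2+Y_{\vec s(i-1)}Y_{\vec s(i+1)}C^{\vec s}_{s_i}.$$ *)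

theory Defs
  imports "HOL-Library.Poly_Mapping" "HOL-Computational_Algebra.Computational_Algebra"
begin

text \<open>
  The index set \<open>[n]\<close> is a finite type \<open>'n\<close> with \<open>n = CARD('n)\<close>; its linear order is only needed
  for the integral domain instance of polynomials.  A multivariate polynomial is a finitely supported
  map from monomials \<open>'n \<Rightarrow>\<^sub>0 nat\<close> to coefficients.  \<open>'n coef\<close> is the ring \<open>R\<close> of integer polynomials
  in the \<open>A\<^sub>i\<close>, \<open>'n pol\<close> is \<open>R[X\<^sub>1,\<dots>,X\<^sub>n]\<close>, and the ambient field \<open>\<F>\<close> is its fraction field
  \<open>'n ratfun\<close>.
\<close>

type_synonym 'n coef = "('n \<Rightarrow>\<^sub>0 nat) \<Rightarrow>\<^sub>0 int"
type_synonym 'n pol = "('n \<Rightarrow>\<^sub>0 nat) \<Rightarrow>\<^sub>0 'n coef"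
type_synonym 'n ratfun = "'n pol fract"

definition mvar :: "'n \<Rightarrow> (('n \<Rightarrow>\<^sub>0 nat) \<Rightarrow>\<^sub>0 'c::comm_semiring_1)"
  where "mvar i = Poly_Mapping.single (Poly_Mapping.single i 1) 1"

definition pconst :: "'n coef \<Rightarrow> 'n pol"
  where "pconst a = Poly_Mapping.single 0 a"

abbreviation polA :: "'n \<Rightarrow> 'n pol"
  where "polA i \<equiv> pconst (mvar i)"

abbreviation polX :: "'n \<Rightarrow> 'n pol"
  where "polX i \<equiv> mvar i"

definition involves :: "(('n \<Rightarrow>\<^sub>0 nat) \<Rightarrow>\<^sub>0 'c::zero) \<Rightarrow> 'n \<Rightarrow> bool"
  where "involves p i \<longleftrightarrow> (\<exists>m \<in> Poly_Mapping.keys p. Poly_Mapping.lookup m i \<noteq> 0)"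

text \<open>The value at \<open>z\<close> of the polynomial obtained from \<open>p\<close> by applying \<open>h\<close> to its coefficients.\<close>

definition insertion ::
    "('c \<Rightarrow> 'k) \<Rightarrow> ('n::finite \<Rightarrow> 'k) \<Rightarrow> (('n \<Rightarrow>\<^sub>0 nat) \<Rightarrow>\<^sub>0 'c::zero) \<Rightarrow> 'k::comm_semiring_1"
  where "insertion h z p =
    (\<Sum>m \<in> Poly_Mapping.keys p.
       h (Poly_Mapping.lookup p m) * (\<Prod>i\<in>UNIV. z i ^ Poly_Mapping.lookup m i))"

definition emb :: "'n::linorder pol \<Rightarrow> 'n ratfun"
  where "emb p = Fract p 1"

abbreviation embc :: "'n::linorder coef \<Rightarrow> 'n ratfun"
  where "embc a \<equiv> emb (pconst a)"

abbreviation ratX :: "'n::linorder \<Rightarrow> 'n ratfun"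
  where "ratX i \<equiv> emb (polX i)"

abbreviation ev :: "('n::{finite,linorder} \<Rightarrow> 'n ratfun) \<Rightarrow> 'n pol \<Rightarrow> 'n ratfun"
  where "ev z p \<equiv> insertion embc z p"


section \<open>Seeds\<close>

definition frac_coefs :: "'n::linorder ratfun set"
  where "frac_coefs = {embc a / embc b | a b. b \<noteq> 0}"

definition polys_over_frac_coefs :: "(('n \<Rightarrow>\<^sub>0 nat) \<Rightarrow>\<^sub>0 'n::linorder ratfun) set"
  where "polys_over_frac_coefs = {p. \<forall>m. Poly_Mapping.lookup p m \<in> frac_coefs}"

text \<open>Algebraically independent over \<open>Frac(R)\<close>, and generating \<open>\<F>\<close> as a field over \<open>Frac(R)\<close>.\<close>

definition generating_transcendence_basis :: "('n::{finite,linorder} \<Rightarrow> 'n ratfun) \<Rightarrow> bool"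
  where "generating_transcendence_basis z \<longleftrightarrow>
    (\<forall>p \<in> polys_over_frac_coefs. insertion id z p = 0 \<longrightarrow> p = 0) \<and>
    (\<forall>y. \<exists>p \<in> polys_over_frac_coefs. \<exists>q \<in> polys_over_frac_coefs.
       insertion id z q \<noteq> 0 \<and> y = insertion id z p / insertion id z q)"

text \<open>
  A seed consists of its cluster and its exchange polynomials.  An exchange polynomial is
  stored as a formal polynomial whose variable \<open>polX i\<close> stands for the cluster variable with index
  \<open>i\<close> of that same seed; as an element of \<open>\<F>\<close> it is the value \<open>ev (cluster S) (exch S j)\<close>.
\<close>

type_synonym 'n seed = "('n \<Rightarrow> 'n ratfun) \<times> ('n \<Rightarrow> 'n pol)"

abbreviation cluster :: "'n::linorder seed \<Rightarrow> 'n \<Rightarrow> 'n ratfun"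
  where "cluster S \<equiv> fst S"

abbreviation exch :: "'n::linorder seed \<Rightarrow> 'n \<Rightarrow> 'n pol"
  where "exch S \<equiv> snd S"

definition is_seed :: "'n::{finite,linorder} seed \<Rightarrow> bool"
  where "is_seed S \<longleftrightarrow>
    generating_transcendence_basis (cluster S) \<and>
    (\<forall>i. irreducible (exch S i) \<and> (\<forall>j. \<not> polX j dvd exch S i) \<and> \<not> involves (exch S i) i)"


section \<open>Mutation\<close>

text \<open>
  All computations with exchange polynomials take place in the field of rational functions in the
  formal variables \<open>ratX i\<close>, which contains the Laurent polynomial ring.
\<close>

definition lmonom :: "('n::{finite,linorder} \<Rightarrow> int) \<Rightarrow> 'n ratfun"
  where "lmonom e = (\<Prod>j\<in>UNIV. ratX j powi e j)"

definition laurent :: "'n::{finite,linorder} ratfun set"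
  where "laurent = {lmonom e * emb p | e p. True}"

definition laurent_dvd :: "'n::{finite,linorder} ratfun \<Rightarrow> 'n ratfun \<Rightarrow> bool"
  where "laurent_dvd f g \<longleftrightarrow> (\<exists>c \<in> laurent. g = f * c)"

text \<open>
  With \<open>a\<close> the exponents of \<open>\<hat>F\<^sub>i\<close>, \<open>hat_at F i a z\<close> is the value of \<open>\<hat>F\<^sub>i\<close> at \<open>z\<close>, that is, the
  result of substituting \<open>z j\<close> for \<open>X\<^sub>j\<close> simultaneously for all \<open>j\<close>.
\<close>

definition hat_at ::
    "('n::{finite,linorder} \<Rightarrow> 'n pol) \<Rightarrow> 'n \<Rightarrow> ('n \<Rightarrow> int) \<Rightarrow> ('n \<Rightarrow> 'n ratfun) \<Rightarrow> 'n ratfun"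
  where "hat_at F i a z = (\<Prod>j\<in>UNIV - {i}. z j powi a j) * ev z (F i)"

text \<open>
  The conditions determining the exponents of \<open>\<hat>F\<^sub>i\<close>.  The new variable \<open>X\<close> of the substitution
  \<open>X\<^sub>j \<leftarrow> F\<^sub>j/X\<close> takes the place of \<open>X\<^sub>j\<close> and is again written \<open>ratX j\<close>; the \<open>i\<close>-th exponent is not
  used and fixed to \<open>0\<close>.
\<close>

definition hat_exponents ::
    "('n::{finite,linorder} \<Rightarrow> 'n pol) \<Rightarrow> 'n \<Rightarrow> ('n \<Rightarrow> int) \<Rightarrow> bool"
  where "hat_exponents F i a \<longleftrightarrow> a i = 0 \<and>
    (\<forall>j. j \<noteq> i \<longrightarrow> a j \<le> 0 \<and>
       (let f = hat_at F i a (ratX(j := emb (F j) / ratX j))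
        in f \<in> laurent \<and> \<not> laurent_dvd (emb (F j)) f))"

text \<open>
  The common factors are elements of \<open>R[X\<^sub>1,\<dots>,X\<^sub>n]\<close> free of \<open>X\<^sub>i\<close> and \<open>X\<^sub>j\<close>.  Factors of Laurent polynomials
  only make sense up to Laurent monomials, so the units of the Laurent polynomial ring are
  excluded; the monomial \<open>M\<close> in the definition of the mutation accounts for them.
\<close>

definition common_factor ::
    "'n::{finite,linorder} \<Rightarrow> 'n \<Rightarrow> 'n ratfun \<Rightarrow> 'n ratfun \<Rightarrow> 'n pol \<Rightarrow> bool"
  where "common_factor i j g h p \<longleftrightarrow>
    \<not> involves p i \<and> \<not> involves p j \<and> \<not> laurent_dvd (emb p) 1 \<and>
    laurent_dvd (emb p) g \<and> laurent_dvd (emb p) h"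

definition factors_divided_out ::
    "'n::{finite,linorder} \<Rightarrow> 'n \<Rightarrow> 'n ratfun \<Rightarrow> 'n ratfun \<Rightarrow> 'n ratfun \<Rightarrow> bool"
  where "factors_divided_out i j g G H \<longleftrightarrow>
    (\<lambda>h h'. \<exists>p. common_factor i j g h p \<and> h' = h / emb p)\<^sup>*\<^sup>* G H \<and>
    (\<nexists>p. common_factor i j g H p)"

text \<open>
  The new exchange polynomial at \<open>j\<close> when \<open>F\<^sub>j\<close> involves \<open>X\<^sub>i\<close>; in \<open>G\<close>, \<open>H\<close> and the result the formal
  variable \<open>ratX i\<close> stands for \<open>X'\<^sub>i\<close>.  In this situation \<open>a j = 0\<close>, so that the substitution
  \<open>X\<^sub>j \<leftarrow> 0\<close> in \<open>\<hat>F\<^sub>i\<close> is meaningful.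
\<close>

definition new_exchange ::
    "('n::{finite,linorder} \<Rightarrow> 'n pol) \<Rightarrow> 'n \<Rightarrow> ('n \<Rightarrow> int) \<Rightarrow> 'n \<Rightarrow> 'n pol \<Rightarrow> bool"
  where "new_exchange F i a j P \<longleftrightarrow>
    (let g = hat_at F i a (ratX(j := 0));
         G = ev (ratX(i := g / ratX i)) (F j)
     in \<exists>H e u. factors_divided_out i j g G H \<and> e j = 0 \<and> u dvd 1 \<and>
          emb P = embc u * lmonom e * H \<and> (\<forall>l. \<not> polX l dvd P))"

text \<open>
  Mutation is a relation, since exchange polynomials are only determined up to units of \<open>R\<close>.
\<close>

definition mutation :: "'n::{finite,linorder} \<Rightarrow> 'n seed \<Rightarrow> 'n seed \<Rightarrow> bool"
  where "mutation i S S' \<longleftrightarrow> is_seed S \<and> is_seed S' \<and>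
    (\<exists>a. hat_exponents (exch S) i a \<and>
       cluster S' = (cluster S)(i := hat_at (exch S) i a (cluster S) / cluster S i) \<and>
       (\<forall>j. if involves (exch S j) i then new_exchange (exch S) i a j (exch S' j)
             else exch S' j = exch S j))"

fun mutations :: "'n::{finite,linorder} list \<Rightarrow> 'n seed \<Rightarrow> 'n seed \<Rightarrow> bool"
  where
    "mutations [] S T \<longleftrightarrow> T = S"
  | "mutations (i # s) S T \<longleftrightarrow> (\<exists>S'. mutation i S S' \<and> mutations s S' T)"

text \<open>
  Equality of seeds up to units of \<open>R\<close>.  Rescaling an exchange polynomial by a unit rescales the
  cluster variable of the mutation at its index, so units appear in both components; the exchange polynomials
  are compared as elements of \<open>\<F>\<close>.
\<close>

definition seed_equiv :: "'n::{finite,linorder} seed \<Rightarrow> 'n seed \<Rightarrow> bool"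
  where "seed_equiv S S' \<longleftrightarrow>
    (\<forall>i. (\<exists>u. u dvd 1 \<and> cluster S' i = embc u * cluster S i) \<and>
         (\<exists>u. u dvd 1 \<and> ev (cluster S') (exch S' i) = embc u * ev (cluster S) (exch S i)))"

definition tau :: "'n::{finite,linorder} seed"
  where "tau = (ratX, \<lambda>i. polA i + (\<Prod>j\<in>UNIV - {i}. polX j))"


section \<open>The polynomials attached to an activation sequence\<close>

text \<open>
  An activation sequence is a distinct list \<open>s\<close>, with \<open>entry s r\<close> its \<open>r\<close>-th entry for
  \<open>1 \<le> r \<le> length s\<close>.  The polynomials below are formal polynomials in the cluster
  variables of the seed obtained by mutating along \<open>s\<close>.  The variable of that seed with index \<open>entry s r\<close> is the
  one created by the \<open>r\<close>-th mutation, since later mutations leave it unchanged; hence \<open>Ypol s r\<close>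
  is \<open>Y\<close> of the initial segment of \<open>s\<close> of length \<open>r\<close>.  For \<open>\<rho>\<close> not in \<open>s\<close> the cluster variable is still the
  initial one, and it is written \<open>polX \<rho>\<close>.
\<close>

abbreviation entry :: "'n list \<Rightarrow> nat \<Rightarrow> 'n"
  where "entry s r \<equiv> s ! (r - 1)"

definition Ypol :: "'n::linorder list \<Rightarrow> nat \<Rightarrow> 'n pol"
  where "Ypol s r = (if r = 0 then 1 else polX (entry s r))"

definition Cpol :: "'n::linorder list \<Rightarrow> nat \<Rightarrow> 'n pol"
  where "Cpol s i = (\<Prod>r = i + 2..length s. Ypol s r ^ (2 ^ (r - i - 1)))"

text \<open>\<open>Ppol s i\<close> and \<open>Epol_in s i\<close> are \<open>P\<close> and \<open>\<E>\<close> with lower index \<open>s\<^sub>i\<close>, for \<open>1 \<le> i \<le> length s\<close>.\<close>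

function Ppol :: "'n::{finite,linorder} list \<Rightarrow> nat \<Rightarrow> 'n pol"
  where "Ppol s i =
    (if i \<ge> length s
     then (\<Prod>r = 1..i - 1. polA (entry s r)) * (\<Prod>\<rho>\<in>- set s. polX \<rho>) + polA (entry s i) * Ypol s (i - 1)
     else (\<Prod>r = 1..i - 1. polA (entry s r)) * (\<Prod>\<rho>\<in>- set s. polX \<rho>) * (\<Prod>r = i + 1..length s. Ppol s r)
          + polA (entry s i) * Ypol s (i - 1) * Ypol s (i + 1) * Cpol s i)"
  by pat_completeness auto
termination by (relation "measure (\<lambda>(s, i). length s - i)") auto

declare Ppol.simps [simp del]

definition Epol_in :: "'n::{finite,linorder} list \<Rightarrow> nat \<Rightarrow> 'n pol"
  where "Epol_in s i =
    (if i = length s then Ppol s i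
     else (\<Prod>r = 1..i - 1. polA (entry s r))\<^sup>2 * (\<Prod>\<rho>\<in>- set s. polX \<rho>)\<^sup>2 * (\<Prod>r = i + 2..length s. Ppol s r)\<^sup>2
          + Ypol s (i - 1) * Ypol s (i + 1) * Cpol s i)"

definition Epol :: "'n::{finite,linorder} list \<Rightarrow> 'n \<Rightarrow> 'n pol"
  where "Epol s l =
    (if l \<in> set s then Epol_in s (THE i. i \<in> {1..length s} \<and> entry s i = l)
     else (\<Prod>r = 1..length s. polA (entry s r)) * (\<Prod>\<rho>\<in>- set s - {l}. polX \<rho>)
          + polA l * Ypol s (length s))"

lemma Epol_entry:
  assumes "distinct s" "i \<in> {1..length s}"
  shows "Epol s (entry s i) = Epol_in s i"
proof -
  have "(THE i'. i' \<in> {1..length s} \<and> entry s i' = entry s i) = i"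
    using assms by (intro the_equality) (auto simp: nth_eq_iff_index_eq)
  moreover have "entry s i \<in> set s"
    using assms(2) by (intro nth_mem) auto
  ultimately show ?thesis
    by (simp add: Epol_def)
qed

end

theory Submission
  imports Defs
begin

text \<open>
  All exponents of \<open>\<hat>F\<^sub>\<sigma>\<close> vanish along an activation sequence, so the mutation at \<open>\<sigma>\<close> acts on \<open>\<E>\<^sub>j\<close> by the
  substitution \<open>X\<^sub>\<sigma> \<leftarrow> g/X\<^sub>\<sigma>\<close> with \<open>g = \<E>\<^sub>\<sigma>|\<^bsub>X\<^sub>j = 0\<^esub>\<close>.  This \<open>g\<close> is a product of variables and known primes: \<open>A\<^sub>\<sigma> Y\<close>
  if \<open>j\<close> is not yet mutated, \<open>\<Prod>A\<^sub>r \<Prod>X\<^sub>\<rho>\<close> if \<open>j\<close> is the last mutated index, and \<open>\<E>\<^sub>\<sigma>\<close> itself for an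
  earlier one.  A direct computation carries \<open>\<E>\<^sub>j\<close> to the next \<open>\<E>\<^sub>j\<close> up to a monomial and, in the middle case,
  a factor \<open>A\<^sub>j\<close>.  Since the substitution is invertible once \<open>g\<close> and \<open>X\<^sub>\<sigma>\<close> are, primality is inherited from
  \<open>A\<^sub>l + \<Prod>X\<^sub>\<rho>\<close>, and unique factorization of \<open>R[X\<^sub>1,\<dots>,X\<^sub>n]\<close> is never needed: everything that is divided
  out is a product of the known primes.  Non-divisibility is read off at integer points.
  For uniqueness, any choice of units amounts to a rescaling of the variables and polynomials by units.
\<close>

section \<open>Evaluation of polynomials\<close>

text \<open>Let k be the length of the sequence before a mutation at \<sigma>. The powers of two in
  \<open>Cpol\<close> are degrees in X_\<sigma>: clearing the denominator of the substituted P_{s_i}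
  takes X_\<sigma>^(2^(k - i)), because the product over \<rho> contributes one factor, each P_{s_r}
  with r > i contributes 2^(k - r), and 1 + 2^0 + ... + 2^(k - i - 1) = 2^(k - i). On the other
  summand this power becomes the new factor of C. \<open>mutation\<close> demands a seed at both
  ends, so the formulas alone do not give existence: each polynomial must be irreducible and each
  cluster a transcendence basis. Uniqueness cannot be argued with one unit per polynomial: a unit
  chosen for F_\<sigma> enters the new cluster variable, and through it every polynomial in that
  variable. All outcomes are therefore described by two families of units, \<eta> on polynomials and
  w on variables. The one-step lemmas are proved for such rescaled data, and existence is the case
  of units 1.\<close>

lemma poly_mapping_sum_induct [case_names single add]:
  assumes single: "\<And>m c. P (Poly_Mapping.single m c)"
    and add: "\<And>p q. P p \<Longrightarrow> P q \<Longrightarrow> P (p + q)"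
  shows "P p"
proof (induction p rule: update_induct)
  case const
  show ?case using single[of undefined 0] by simp
next
  case (update f a b)
  have "Poly_Mapping.update a b f = f + Poly_Mapping.single a b"
    using update by (intro poly_mapping_eqI)
      (auto simp: lookup_update lookup_add lookup_single when_def in_keys_iff)
  then show ?case using add[OF update(3) single] by simp
qed

text \<open>Being a predicate, this covers \<open>of_int\<close>, \<open>emb\<close> and every
  evaluation built from them, so that evaluation can be iterated: first on the A, then on the
  X.\<close>

definition coeff_hom :: "('c::comm_ring_1 \<Rightarrow> 'k::comm_ring_1) \<Rightarrow> bool"
  where "coeff_hom h \<longleftrightarrow> h 0 = 0 \<and> h 1 = 1 \<and> (\<forall>x y. h (x + y) = h x + h y) \<and> (\<forall>x y. h (x * y) = h x * h y)"

lemma coeff_homD: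
  assumes "coeff_hom h"
  shows "h 0 = 0" "h 1 = 1" "h (x + y) = h x + h y" "h (x * y) = h x * h y"
  using assms by (auto simp: coeff_hom_def)

text \<open>Sums over the different supports of \<open>p\<close>, \<open>q\<close> and
  \<open>p + q\<close> become comparable over one index set.\<close>

lemma insertion_superset:
  assumes "finite B" "Poly_Mapping.keys p \<subseteq> B" "h 0 = 0"
  shows "insertion h z p =
    (\<Sum>m\<in>B. h (Poly_Mapping.lookup p m) * (\<Prod>i\<in>UNIV. z i ^ Poly_Mapping.lookup m i))"
  unfolding insertion_def
  by (rule sum.mono_neutral_left) (use assms in \<open>auto simp: in_keys_iff\<close>)

lemma insertion_single:
  assumes "h 0 = 0"
  shows "insertion h z (Poly_Mapping.single m c) = h c * (\<Prod>i\<in>UNIV. z i ^ Poly_Mapping.lookup m i)"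
  by (subst insertion_superset[where B = "{m}"]) (auto simp: assms)

lemma insertion_add:
  assumes "coeff_hom h"
  shows "insertion h z (p + q) = insertion h z p + insertion h z q"
proof -
  let ?B = "Poly_Mapping.keys p \<union> Poly_Mapping.keys q"
  note h = coeff_homD[OF assms]
  show ?thesis
    using Poly_Mapping.keys_add[of p q]
    by (simp add: insertion_superset[where B = ?B] h lookup_add sum.distrib distrib_right)
qed

lemma insertion_mult:
  assumes "coeff_hom h"
  shows "insertion h z (p * q) = insertion h z p * insertion h z q"
proof (induction p rule: poly_mapping_sum_induct)
  case (single m c)
  show ?case
  proof (induction q rule: poly_mapping_sum_induct)
    case (single m' c')
    then show ?case
      by (simp add: mult_single insertion_single coeff_homD[OF assms] lookup_add power_add prod.distrib
          mult_ac)
  next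
    case (add q r)
    then show ?case by (simp add: insertion_add[OF assms] distrib_left)
  qed
next
  case (add p r)
  then show ?case by (simp add: insertion_add[OF assms] distrib_right)
qed

lemma insertion_one:
  assumes "coeff_hom h"
  shows "insertion h z 1 = 1"
  unfolding single_one[symmetric] by (simp add: insertion_single coeff_homD[OF assms] del: single_one)

lemma coeff_hom_insertion:
  assumes "coeff_hom h"
  shows "coeff_hom (insertion h z)"
  using assms by (auto simp: coeff_hom_def insertion_one[OF assms] insertion_add[OF assms]
      insertion_mult[OF assms]) (simp add: insertion_def)

lemma coeff_hom_of_int: "coeff_hom (of_int :: int \<Rightarrow> 'k::comm_ring_1)"
  by (auto simp: coeff_hom_def)

lemma insertion_mvar:
  assumes "coeff_hom h"
  shows "insertion h z (mvar i) = z i"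
proof -
  have "(\<Prod>j\<in>UNIV. z j ^ (1 when i = j)) = (\<Prod>j\<in>UNIV. if j = i then z i else 1)"
    by (intro prod.cong) (auto simp: when_def)
  then show ?thesis
    by (simp add: mvar_def insertion_single coeff_homD[OF assms] lookup_single)
qed

lemma insertion_const:
  assumes "h 0 = 0"
  shows "insertion h z (Poly_Mapping.single 0 c) = h c"
  by (simp add: insertion_single assms)

lemma insertion_cong_involves:
  assumes "\<And>i. involves p i \<Longrightarrow> z i = z' i"
  shows "insertion h z p = insertion h z' p"
  unfolding insertion_def
proof (intro sum.cong refl arg_cong2[where f = "(*)"] prod.cong)
  fix m i assume "m \<in> Poly_Mapping.keys p"
  then show "z i ^ Poly_Mapping.lookup m i = z' i ^ Poly_Mapping.lookup m i"
    using assms[of i] by (cases "Poly_Mapping.lookup m i = 0") (fastforce simp: involves_def)+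
qed

definition coef_ev :: "('n::finite \<Rightarrow> 'k) \<Rightarrow> 'n coef \<Rightarrow> 'k::comm_ring_1"
  where "coef_ev \<alpha> = insertion of_int \<alpha>"

text \<open>Here \<alpha> gives the values of the A and \<open>z\<close> those of the X. The target
  ring varies: \<open>int\<close> for points, \<open>'n pol\<close> for endomorphisms,
  \<open>'n pol poly\<close> for degrees, \<open>'n ratfun\<close> for \<open>ev\<close>.\<close>

definition Ev :: "('n::finite \<Rightarrow> 'k) \<Rightarrow> ('n \<Rightarrow> 'k) \<Rightarrow> 'n pol \<Rightarrow> 'k::comm_ring_1"
  where "Ev \<alpha> z = insertion (coef_ev \<alpha>) z"

lemma coeff_hom_coef_ev: "coeff_hom (coef_ev \<alpha>)"
  unfolding coef_ev_def by (intro coeff_hom_insertion coeff_hom_of_int)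

lemma coeff_hom_Ev: "coeff_hom (Ev \<alpha> z)"
  unfolding Ev_def by (intro coeff_hom_insertion coeff_hom_coef_ev)

lemma Ev_simps [simp]:
  "Ev \<alpha> z 0 = 0" "Ev \<alpha> z 1 = 1"
  "Ev \<alpha> z (p + q) = Ev \<alpha> z p + Ev \<alpha> z q"
  "Ev \<alpha> z (p * q) = Ev \<alpha> z p * Ev \<alpha> z q"
  "Ev \<alpha> z (pconst c) = coef_ev \<alpha> c"
  "Ev \<alpha> z (polX i) = z i"
  using coeff_hom_Ev[of \<alpha> z]
  by (auto simp: coeff_homD) (simp_all add: Ev_def pconst_def insertion_const coeff_homD(1)[OF coeff_hom_coef_ev]
      insertion_mvar[OF coeff_hom_coef_ev])

lemma coef_ev_simps [simp]:
  "coef_ev \<alpha> 0 = 0" "coef_ev \<alpha> 1 = 1"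
  "coef_ev \<alpha> (a + b) = coef_ev \<alpha> a + coef_ev \<alpha> b"
  "coef_ev \<alpha> (a * b) = coef_ev \<alpha> a * coef_ev \<alpha> b"
  "coef_ev \<alpha> (mvar i) = \<alpha> i"
  using coeff_hom_coef_ev[of \<alpha>]
  by (auto simp: coeff_homD) (simp add: coef_ev_def insertion_mvar[OF coeff_hom_of_int])

lemma Ev_uminus [simp]: "Ev \<alpha> z (- p) = - Ev \<alpha> z p"
  using Ev_simps(3)[of \<alpha> z p "- p"] by (simp add: minus_unique)

lemma Ev_prod [simp]: "Ev \<alpha> z (prod f B) = (\<Prod>x\<in>B. Ev \<alpha> z (f x))"
  by (induction B rule: infinite_finite_induct) auto

lemma Ev_power [simp]: "Ev \<alpha> z (p ^ n) = Ev \<alpha> z p ^ n"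
  by (induction n) auto

lemma pconst_simps:
  "pconst 0 = 0" "pconst 1 = 1" "pconst (a + b) = pconst a + pconst b"
  "pconst (a * b) = pconst a * pconst b"
  by (simp_all add: pconst_def single_add mult_single)

lemma mvar_power: "mvar i ^ k = Poly_Mapping.single (Poly_Mapping.single i k) 1"
  by (induction k) (auto simp: mvar_def mult_single single_add[symmetric])

section \<open>Generators of the polynomial ring and its universal property\<close>

lemma mpoly_induct [case_names const var add mult]:
  fixes p :: "('n::finite \<Rightarrow>\<^sub>0 nat) \<Rightarrow>\<^sub>0 'c::comm_ring_1"
  assumes const: "\<And>c. P (Poly_Mapping.single 0 c)"
    and var: "\<And>i. P (mvar i)"
    and add: "\<And>p q. P p \<Longrightarrow> P q \<Longrightarrow> P (p + q)"
    and mult: "\<And>p q. P p \<Longrightarrow> P q \<Longrightarrow> P (p * q)"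
  shows "P p"
proof (induction p rule: poly_mapping_sum_induct)
  case (single m c)
  show ?case
  proof (induction m arbitrary: c rule: poly_mapping_sum_induct)
    case (single i k)
    have "P (mvar i ^ k)"
    proof (induction k)
      case 0
      show ?case using const[of 1] by simp
    qed (auto intro: var mult)
    from mult[OF const[of c] this] show ?case
      by (simp add: mvar_power mult_single)
  next
    case (add m m')
    from mult[OF add(1)[of c] add(2)[of 1]] show ?case by (simp add: mult_single)
  qed
qed (rule add)

lemma int_ring_induct [case_names one uminus add]:
  fixes k :: int
  assumes "P 1" "\<And>a. P a \<Longrightarrow> P (- a)" "\<And>a b. P a \<Longrightarrow> P b \<Longrightarrow> P (a + b)"
  shows "P k"
proof (induction k rule: int_induct[where k = 0])
  case base
  show ?case using assms(3)[OF assms(1) assms(2)[OF assms(1)]] by simp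
next
  case (step1 i)
  then show ?case using assms(1,3) by auto
next
  case (step2 i)
  then show ?case using assms(3)[OF step2(2) assms(2)[OF assms(1)]] by simp
qed

text \<open>The ring Z[A][X] is generated by 1, the A and the X; the case \<open>uminus\<close> is
  what reaches the negative integers.\<close>

lemma pol_induct [case_names one uminus A X add mult]:
  fixes p :: "'n::finite pol"
  assumes one: "P 1" and uminus: "\<And>p. P p \<Longrightarrow> P (- p)"
    and A: "\<And>i. P (polA i)" and X: "\<And>i. P (polX i)"
    and add: "\<And>p q. P p \<Longrightarrow> P q \<Longrightarrow> P (p + q)"
    and mult: "\<And>p q. P p \<Longrightarrow> P q \<Longrightarrow> P (p * q)"
  shows "P p"
proof (induction p rule: mpoly_induct)
  case (const c)
  have "P (pconst c)"
  proof (induction c rule: mpoly_induct)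
    case (const k)
    show ?case
    proof (induction k rule: int_ring_induct)
      case one
      show ?case using assms(1) by (simp add: pconst_simps)
    next
      case (uminus a)
      then show ?case using assms(2) by (fastforce simp: pconst_def single_uminus)
    next
      case (add a b)
      then show ?case using assms(5) by (simp add: single_add pconst_simps)
    qed
  qed (auto simp: pconst_simps intro: A add mult)
  then show ?case by (simp add: pconst_def)
qed (auto intro: X add mult)

text \<open>A ring homomorphism is determined on generators. All composition rules for substitutions
  come from this and not from manipulating coefficients.\<close>

lemma coeff_hom_eq_Ev:
  assumes "coeff_hom h"
  shows "h p = Ev (\<lambda>i. h (polA i)) (\<lambda>i. h (polX i)) p"
proof (induction p rule: pol_induct)
  case (uminus p)
  have "h p + h (- p) = 0" using coeff_homD(3)[OF assms, of p "- p"] coeff_homD(1)[OF assms] by simp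
  then show ?case using uminus by (simp add: minus_unique)
qed (simp_all add: coeff_homD[OF assms])

lemma Ev_Ev: "Ev \<beta> y (Ev \<alpha> z p) = Ev (\<lambda>i. Ev \<beta> y (\<alpha> i)) (\<lambda>i. Ev \<beta> y (z i)) p"
proof -
  have "coeff_hom (\<lambda>p. Ev \<beta> y (Ev \<alpha> z p))" by (simp add: coeff_hom_def)
  from coeff_hom_eq_Ev[OF this, of p] show ?thesis by simp
qed

lemma Ev_polX [simp]: "Ev polA polX p = p"
proof -
  have "coeff_hom (\<lambda>p::'n pol. p)" by (simp add: coeff_hom_def)
  from coeff_hom_eq_Ev[OF this, of p] show ?thesis by simp
qed

lemma Ev_cong_involves: "(\<And>i. involves p i \<Longrightarrow> z i = z' i) \<Longrightarrow> Ev \<alpha> z p = Ev \<alpha> z' p"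
  unfolding Ev_def by (rule insertion_cong_involves)

lemma Ev_upd: "\<not> involves p i \<Longrightarrow> Ev \<alpha> (z(i := v)) p = Ev \<alpha> z p"
  by (rule Ev_cong_involves) auto

section \<open>Variables that a polynomial involves\<close>

lemma involves_1 [simp]: "\<not> involves 1 i"
  by (simp add: involves_def)

lemma involves_0 [simp]: "\<not> involves 0 i"
  by (simp add: involves_def)

lemma involves_pconst [simp]: "\<not> involves (pconst c) i"
  by (simp add: involves_def pconst_def)

lemma involves_polX [simp]: "involves (polX j :: 'n pol) i \<longleftrightarrow> i = j"
  by (auto simp: involves_def mvar_def lookup_single when_def)

lemma involves_add: "\<not> involves p i \<Longrightarrow> \<not> involves q i \<Longrightarrow> \<not> involves (p + q) i"
  using Poly_Mapping.keys_add[of p q] by (auto simp: involves_def)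

lemma involves_mult:
  fixes p q :: "('n \<Rightarrow>\<^sub>0 nat) \<Rightarrow>\<^sub>0 'c::comm_ring_1"
  shows "\<not> involves p i \<Longrightarrow> \<not> involves q i \<Longrightarrow> \<not> involves (p * q) i"
  using Poly_Mapping.keys_mult[of p q] by (force simp: involves_def lookup_add)

lemma involves_power:
  fixes p :: "'n pol"
  shows "\<not> involves p i \<Longrightarrow> \<not> involves (p ^ k) i"
  by (induction k) (auto simp: involves_mult)

lemma involves_prod:
  fixes f :: "'b \<Rightarrow> 'n pol"
  shows "(\<And>x. x \<in> B \<Longrightarrow> \<not> involves (f x) i) \<Longrightarrow> \<not> involves (prod f B) i"
  by (induction B rule: infinite_finite_induct) (auto simp: involves_mult)

lemma involves_sum:
  fixes f :: "'b \<Rightarrow> 'n pol"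
  shows "(\<And>x. x \<in> B \<Longrightarrow> \<not> involves (f x) i) \<Longrightarrow> \<not> involves (sum f B) i"
  by (induction B rule: infinite_finite_induct) (auto simp: involves_add)

lemma involves_insertion_pconst:
  fixes p :: "'n::finite pol"
  assumes "\<And>l. involves p l \<Longrightarrow> \<not> involves (z l) i"
  shows "\<not> involves (insertion pconst z p) i"
  unfolding insertion_def
proof (intro involves_sum involves_mult involves_prod)
  fix m l assume "m \<in> Poly_Mapping.keys p"
  then show "\<not> involves (z l ^ Poly_Mapping.lookup m l) i"
    using assms[of l] by (cases "Poly_Mapping.lookup m l = 0") (fastforce simp: involves_def[of p] involves_power)+
qed simp

lemma coef_ev_polA [simp]: "coef_ev polA = (pconst :: 'n::finite coef \<Rightarrow> _)"
proof
  fix c :: "'n coef"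
  show "coef_ev polA c = pconst c"
    by (metis Ev_simps(5) Ev_polX)
qed

lemma involves_Ev:
  assumes "\<And>l. involves p l \<Longrightarrow> \<not> involves (z l) i"
  shows "\<not> involves (Ev polA z p) i"
  unfolding Ev_def coef_ev_polA by (rule involves_insertion_pconst[OF assms])

section \<open>The fraction field\<close>

lemma emb_0 [simp]: "emb 0 = 0" and emb_1 [simp]: "emb 1 = 1"
  by (simp_all add: emb_def Zero_fract_def One_fract_def)

lemma emb_add [simp]: "emb (p + q) = emb p + emb q"
  by (simp add: emb_def)

lemma emb_mult [simp]: "emb (p * q) = emb p * emb q"
  by (simp add: emb_def)

lemma emb_eq_iff [simp]: "emb p = emb q \<longleftrightarrow> p = q"
  by (simp add: emb_def eq_fract)

lemma emb_eq_0_iff [simp]: "emb p = 0 \<longleftrightarrow> p = 0"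
  using emb_eq_iff[of p 0] by (simp del: emb_eq_iff)

lemma emb_power [simp]: "emb (p ^ k) = emb p ^ k"
  by (induction k) auto

lemma emb_prod [simp]: "emb (prod f B) = (\<Prod>x\<in>B. emb (f x))"
  by (induction B rule: infinite_finite_induct) auto

lemma coeff_hom_emb: "coeff_hom (emb :: 'n::{finite,linorder} pol \<Rightarrow> _)"
  by (simp add: coeff_hom_def)

lemma embc_eq_coef_ev:
  fixes c :: "'n::{finite,linorder} coef"
  shows "embc c = coef_ev (\<lambda>i. emb (polA i)) c"
  using coeff_hom_eq_Ev[OF coeff_hom_emb, of "pconst c"] by simp

lemma ev_eq_Ev:
  fixes z :: "'n::{finite,linorder} \<Rightarrow> 'n ratfun"
  shows "ev z = Ev (\<lambda>i. emb (polA i)) z"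
  unfolding Ev_def by (rule arg_cong[where f = "\<lambda>h. insertion h z"], rule ext, rule embc_eq_coef_ev)

lemma ev_simps [simp]:
  fixes z :: "'n::{finite,linorder} \<Rightarrow> 'n ratfun"
  shows "ev z 0 = 0" "ev z 1 = 1"
  "ev z (p + q) = ev z p + ev z q"
  "ev z (p * q) = ev z p * ev z q"
  "ev z (- p) = - ev z p"
  "ev z (pconst c) = embc c"
  "ev z (polX i) = z i"
  "ev z (p ^ k) = ev z p ^ k"
  "ev z (prod f B) = (\<Prod>x\<in>B. ev z (f x))"
  by (simp_all add: ev_eq_Ev embc_eq_coef_ev[symmetric])

lemma ev_ratX [simp]:
  fixes p :: "'n::{finite,linorder} pol"
  shows "ev ratX p = emb p"
  using coeff_hom_eq_Ev[OF coeff_hom_emb, of p] by (simp add: ev_eq_Ev)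

lemma ev_Ev:
  fixes z :: "'n::{finite,linorder} \<Rightarrow> 'n ratfun"
  shows "ev z (Ev polA y p) = ev (\<lambda>i. ev z (y i)) p"
  by (simp add: ev_eq_Ev Ev_Ev embc_eq_coef_ev[symmetric])

lemma ev_upd:
  fixes z :: "'n::{finite,linorder} \<Rightarrow> 'n ratfun"
  shows "\<not> involves p i \<Longrightarrow> ev (z(i := v)) p = ev z p"
  by (simp add: ev_eq_Ev Ev_upd)

lemma polX_neq_0 [simp]: "polX i \<noteq> (0 :: 'n pol)"
proof
  assume "polX i = (0 :: 'n pol)"
  then have "\<not> involves (polX i :: 'n pol) i" by simp
  then show False by simp
qed

lemma pconst_eq_0_iff [simp]: "pconst c = 0 \<longleftrightarrow> c = 0"
  by (metis lookup_single_eq lookup_zero pconst_def single_zero)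

lemma pconst_dvd_1: "u dvd 1 \<Longrightarrow> pconst u dvd 1"
  by (metis dvd_def pconst_simps(2,4))

text \<open>The point \<open>z\<close> is arbitrary so that the identity can be used a second time at the image of \<open>z\<close>, which
  the substitution takes back to \<open>z\<close>.\<close>

lemma clear_denominator:
  fixes p g :: "'n::{finite,linorder} pol"
  shows "\<exists>N p'. \<forall>z. z i \<noteq> 0 \<longrightarrow> ev z p' = z i ^ N * ev (z(i := ev z g / z i)) p"
proof (induction p rule: pol_induct)
  case one
  show ?case by (intro exI[of _ 0] exI[of _ 1]) simp
next
  case (uminus p)
  then obtain N p' where "\<forall>z. z i \<noteq> 0 \<longrightarrow> ev z p' = z i ^ N * ev (z(i := ev z g / z i)) p" by blast
  then show ?case by (intro exI[of _ N] exI[of _ "- p'"]) (simp add: fun_upd_def)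
next
  case (A j)
  show ?case by (intro exI[of _ 0] exI[of _ "polA j"]) simp
next
  case (X j)
  show ?case
  proof (cases "j = i")
    case True
    show ?thesis by (intro exI[of _ 1] exI[of _ g]) (simp add: True)
  next
    case False
    then show ?thesis by (intro exI[of _ 0] exI[of _ "polX j"]) simp
  qed
next
  case (add p q)
  then obtain N p' M q' where
    "\<forall>z. z i \<noteq> 0 \<longrightarrow> ev z p' = z i ^ N * ev (z(i := ev z g / z i)) p"
    "\<forall>z. z i \<noteq> 0 \<longrightarrow> ev z q' = z i ^ M * ev (z(i := ev z g / z i)) q" by blast
  then show ?case
    by (intro exI[of _ "N + M"] exI[of _ "polX i ^ M * p' + polX i ^ N * q'"])
      (simp add: power_add algebra_simps fun_upd_def)
next
  case (mult p q)
  then obtain N p' M q' where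
    "\<forall>z. z i \<noteq> 0 \<longrightarrow> ev z p' = z i ^ N * ev (z(i := ev z g / z i)) p"
    "\<forall>z. z i \<noteq> 0 \<longrightarrow> ev z q' = z i ^ M * ev (z(i := ev z g / z i)) q" by blast
  then show ?case
    by (intro exI[of _ "N + M"] exI[of _ "p' * q'"]) (simp add: power_add algebra_simps fun_upd_def)
qed

text \<open>As g is free of X_i, its value survives the update, and g/(g/z_i) = z_i.\<close>

lemma exchange_involutive:
  fixes g :: "'n::{finite,linorder} pol"
  assumes "\<not> involves g i" "z i \<noteq> 0" "ev z g \<noteq> 0"
  defines "w \<equiv> z(i := ev z g / z i)"
  shows "w i \<noteq> 0" "w(i := ev w g / w i) = z"
  using assms by (auto simp: w_def ev_upd fun_eq_iff)

section \<open>Clusters\<close>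

text \<open>A version of \<open>generating_transcendence_basis\<close> with coefficients in R in
  place of Frac(R). It fits \<open>clear_denominator\<close>, which speaks of elements of
  \<open>'n pol\<close>.\<close>

definition poly_basis :: "('n::{finite,linorder} \<Rightarrow> 'n ratfun) \<Rightarrow> bool"
  where "poly_basis z \<longleftrightarrow> (\<forall>p. ev z p = 0 \<longrightarrow> p = 0) \<and> (\<forall>y. \<exists>p q. ev z q \<noteq> 0 \<and> y = ev z p / ev z q)"

lemma poly_basis_ratX: "poly_basis ratX"
  unfolding poly_basis_def
proof (intro conjI allI)
  fix y :: "'a ratfun"
  obtain a b where "y = Fract a b" "b \<noteq> 0" by (cases y)
  then have "ev ratX b \<noteq> 0" "y = ev ratX a / ev ratX b" by (simp, simp only: ev_ratX, simp add: emb_def)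
  then show "\<exists>p q. ev ratX q \<noteq> 0 \<and> y = ev ratX p / ev ratX q" by blast
qed simp

lemma poly_basis_nonzero: "poly_basis z \<Longrightarrow> z i \<noteq> 0"
  unfolding poly_basis_def by (metis ev_simps(7) polX_neq_0)

lemma poly_basis_exchange:
  fixes z :: "'n::{finite,linorder} \<Rightarrow> 'n ratfun"
  assumes z: "poly_basis z" and g: "\<not> involves g i" "g \<noteq> 0"
  shows "poly_basis (z(i := ev z g / z i))"
proof -
  define w where "w = z(i := ev z g / z i)"
  have zi: "z i \<noteq> 0" by (rule poly_basis_nonzero[OF z])
  have gz: "ev z g \<noteq> 0" using z g unfolding poly_basis_def by blast
  note inv = exchange_involutive[OF g(1) zi gz, folded w_def]
  show ?thesis unfolding w_def[symmetric] poly_basis_def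
  proof (intro conjI allI impI)
    fix p assume p: "ev w p = 0"
    obtain N p' where p': "\<And>z. z i \<noteq> 0 \<Longrightarrow> ev z p' = z i ^ N * ev (z(i := ev z g / z i)) p"
      using clear_denominator by blast
    have "ev z p' = 0" using p'[of z] p zi by (simp add: w_def)
    then have 0: "p' = 0" using z by (simp add: poly_basis_def)
    \<comment> \<open>Independence of \<open>z\<close> gives p' = 0 as a formal polynomial. At the
      formal point \<open>x\<close> the substitution leads back to \<open>ratX\<close>, so p' = 0
      becomes a statement about \<open>p\<close> itself.\<close>
    define x where "x = ratX(i := ev ratX g / ratX i)"
    note inv' = exchange_involutive[OF g(1), of ratX, folded x_def]
    have "0 = ev x p'" by (simp add: 0)
    also have "\<dots> = x i ^ N * emb p" using p'[of x] inv' g(2) by simp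
    finally show "p = 0" using inv' g(2) by simp
  next
    fix y
    obtain p q where q: "ev z q \<noteq> 0" and y: "y = ev z p / ev z q"
      using z unfolding poly_basis_def by blast
    obtain N p' where p': "\<And>z. z i \<noteq> 0 \<Longrightarrow> ev z p' = z i ^ N * ev (z(i := ev z g / z i)) p"
      using clear_denominator by blast
    obtain M q' where q': "\<And>z. z i \<noteq> 0 \<Longrightarrow> ev z q' = z i ^ M * ev (z(i := ev z g / z i)) q"
      using clear_denominator by blast
    \<comment> \<open>The crossed powers give numerator and denominator the same factor
      \<open>w i ^ (N + M)\<close>, which cancels.\<close>
    have "ev w (q' * polX i ^ N) \<noteq> 0" "y = ev w (p' * polX i ^ M) / ev w (q' * polX i ^ N)"
      using p'[of w] q'[of w] inv q y by (simp_all add: field_simps)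
    then show "\<exists>p q. ev w q \<noteq> 0 \<and> y = ev w p / ev w q" by blast
  qed
qed

section \<open>Passage from coefficients in R to coefficients in Frac(R)\<close>

lemma embc_hom: "embc 0 = 0" "embc 1 = 1" "embc (a + b) = embc a + embc b" "embc (a * b) = embc a * embc b"
  by (simp_all add: pconst_simps)

lemma common_denominator:
  fixes p :: "('n \<Rightarrow>\<^sub>0 nat) \<Rightarrow>\<^sub>0 'n::{finite,linorder} ratfun"
  assumes "p \<in> polys_over_frac_coefs"
  shows "\<exists>b q. b \<noteq> 0 \<and> (\<forall>m. Poly_Mapping.lookup p m * embc b = embc (Poly_Mapping.lookup q m))"
  using assms
proof (induction p rule: update_induct)
  case const
  show ?case by (intro exI[of _ 1] exI[of _ 0]) (simp add: pconst_simps)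
next
  case (update f m c)
  have upd: "Poly_Mapping.lookup (Poly_Mapping.update m c f) m' \<in> frac_coefs" for m'
    using update(4) unfolding polys_over_frac_coefs_def by blast
  have "f \<in> polys_over_frac_coefs" unfolding polys_over_frac_coefs_def
  proof (intro CollectI allI)
    fix m'
    show "Poly_Mapping.lookup f m' \<in> frac_coefs"
    proof (cases "m' = m")
      case True
      then have "Poly_Mapping.lookup f m' = embc 0 / embc 1" using update(1) by (simp add: in_keys_iff pconst_simps)
      then show ?thesis unfolding frac_coefs_def by (intro CollectI exI[of _ 0] exI[of _ 1]) simp
    next
      case False
      then show ?thesis using upd[of m'] by (simp add: lookup_update)
    qed
  qed
  then obtain b q where b: "b \<noteq> 0" "\<And>m. Poly_Mapping.lookup f m * embc b = embc (Poly_Mapping.lookup q m)"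
    using update(3) by blast
  have "c \<in> frac_coefs" using upd[of m] by (simp add: lookup_update)
  then obtain d e where c: "c = embc d / embc e" "e \<noteq> 0" unfolding frac_coefs_def by blast
  \<comment> \<open>Over the denominator \<open>e * b\<close> the new coefficient d/e has numerator
    \<open>d * b\<close>, and the old numerators pick up the factor \<open>e\<close>.\<close>
  let ?q = "Poly_Mapping.update m (d * b) (Poly_Mapping.map ((*) e) q)"
  have "Poly_Mapping.lookup (Poly_Mapping.update m c f) m' * embc (e * b) = embc (Poly_Mapping.lookup ?q m')" for m'
  proof (cases "m' = m")
    case True
    then show ?thesis using c by (simp add: lookup_update pconst_simps)
  next
    case False
    have "Poly_Mapping.lookup (Poly_Mapping.map ((*) e) q) m' = e * Poly_Mapping.lookup q m'"
      by (simp add: Poly_Mapping.map.rep_eq when_def)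
    then show ?thesis using b(2)[of m'] False by (simp add: lookup_update pconst_simps mult_ac)
  qed
  moreover have "e * b \<noteq> 0" using b c by simp
  ultimately show ?case by blast
qed

text \<open>For independence, a common denominator is multiplied in, which leaves the support
  unchanged. For generation, the quotients at hand already have coefficients in R.\<close>

lemma generating_transcendence_basis_if_poly_basis:
  fixes z :: "'n::{finite,linorder} \<Rightarrow> 'n ratfun"
  assumes z: "poly_basis z"
  shows "generating_transcendence_basis z"
  unfolding generating_transcendence_basis_def
proof (intro conjI ballI allI impI)
  fix p assume p: "p \<in> polys_over_frac_coefs" "insertion id z p = 0"
  obtain b q where b: "b \<noteq> 0" "\<And>m. Poly_Mapping.lookup p m * embc b = embc (Poly_Mapping.lookup q m)"
    using common_denominator[OF p(1)] by blast
  have keys: "Poly_Mapping.keys q = Poly_Mapping.keys p"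
  proof -
    have "Poly_Mapping.lookup q m = 0 \<longleftrightarrow> Poly_Mapping.lookup p m = 0" for m
      using arg_cong[OF b(2)[of m], of "\<lambda>x. x = 0"] b(1) by simp
    then show ?thesis by (intro set_eqI) (simp only: in_keys_iff)
  qed
  have "ev z q = embc b * insertion id z p"
    unfolding insertion_def keys sum_distrib_left b(2)[symmetric] id_apply
    by (intro sum.cong refl) (simp only: mult_ac)
  then have "q = 0" using z p(2) by (simp add: poly_basis_def)
  then have "Poly_Mapping.keys p = {}" using keys by simp
  then show "p = 0" by simp
next
  fix y
  obtain p q where pq: "ev z q \<noteq> 0" "y = ev z p / ev z q"
    using z unfolding poly_basis_def by blast
  define E where "E = (\<lambda>p :: 'n pol. Poly_Mapping.map embc p)"
  have lk: "Poly_Mapping.lookup (E r) m = embc (Poly_Mapping.lookup r m)" for r m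
    by (simp add: E_def Poly_Mapping.map.rep_eq when_def pconst_simps)
  have "E r \<in> polys_over_frac_coefs" for r
  proof -
    have "embc a \<in> frac_coefs" for a :: "'n coef"
      unfolding frac_coefs_def by (rule CollectI, rule exI[of _ a], rule exI[of _ 1]) (simp add: pconst_simps)
    then show ?thesis unfolding polys_over_frac_coefs_def by (simp add: lk)
  qed
  moreover have "insertion id z (E r) = ev z r" for r
  proof -
    have "Poly_Mapping.keys (E r) = Poly_Mapping.keys r"
      by (auto simp: in_keys_iff lk)
    then show ?thesis by (simp add: insertion_def lk)
  qed
  ultimately show "\<exists>p\<in>polys_over_frac_coefs. \<exists>q\<in>polys_over_frac_coefs.
      insertion id z q \<noteq> 0 \<and> y = insertion id z p / insertion id z q"
    using pq by (intro bexI[of _ "E p"] bexI[of _ "E q"]) simp_all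
qed

section \<open>Divisibility\<close>

text \<open>If p = x y and p divides x, cancelling p leaves an inverse of y.\<close>

lemma prime_elem_irreducible:
  fixes p :: "'a::idom"
  assumes "prime_elem p"
  shows "irreducible p"
proof (rule irreducibleI)
  fix a b assume ab: "p = a * b"
  have *: "y dvd 1" if xy: "p = x * y" and "p dvd x" for x y
  proof -
    obtain c where c: "x = p * c" using \<open>p dvd x\<close> by (auto simp: dvd_def)
    have "p * 1 = p * (c * y)" using xy c by (metis mult.assoc mult_1_right)
    then have "1 = c * y" using assms by (subst (asm) mult_left_cancel) auto
    then show ?thesis by (metis dvd_triv_right)
  qed
  have "p dvd a \<or> p dvd b" using assms ab by (metis dvd_refl prime_elem_dvd_multD)
  then show "a dvd 1 \<or> b dvd 1" using *[of a b] *[of b a] ab by (auto simp: mult.commute)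
qed (use assms in \<open>auto simp: prime_elem_def\<close>)

text \<open>Without unique factorization at hand, \<open>cop p m\<close> replaces the statement that \<open>p\<close> and \<open>m\<close> are coprime.\<close>

definition cop :: "'a::comm_semiring_1 \<Rightarrow> 'a \<Rightarrow> bool"
  where "cop p m \<longleftrightarrow> (\<forall>y. p dvd y * m \<longrightarrow> p dvd y)"

lemma copD: "cop p m \<Longrightarrow> p dvd y * m \<Longrightarrow> p dvd y"
  unfolding cop_def by blast

lemma cop_1 [simp]: "cop p 1"
  by (simp add: cop_def)

lemma cop_mult: "cop p m \<Longrightarrow> cop p m' \<Longrightarrow> cop p (m * m')"
  unfolding cop_def by (metis mult.assoc)

lemma cop_power: "cop p m \<Longrightarrow> cop p (m ^ k)"
  by (induction k) (auto intro: cop_mult)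

lemma cop_prod: "(\<And>x. x \<in> B \<Longrightarrow> cop p (f x)) \<Longrightarrow> cop p (prod f B)"
  by (induction B rule: infinite_finite_induct) (auto intro: cop_mult)

lemma cop_prod_list: "(\<And>x. x \<in> set xs \<Longrightarrow> cop p x) \<Longrightarrow> cop p (prod_list xs)"
  by (induction xs) (auto intro: cop_mult)

lemma cop_unit:
  assumes "u dvd 1"
  shows "cop p u"
proof -
  obtain v where "1 = u * v" using assms by (rule dvdE)
  then have "y = (y * u) * v" for y by (metis mult.assoc mult_1_right)
  then show ?thesis unfolding cop_def by (metis dvd_mult2)
qed

text \<open>From y q = p r the prime q must divide r, and then it cancels.\<close>

lemma cop_prime_elem:
  fixes p :: "'a::idom"
  assumes "prime_elem q" "\<not> q dvd p"
  shows "cop p q"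
  unfolding cop_def
proof (intro allI impI)
  fix y assume "p dvd y * q"
  then obtain r where r: "y * q = p * r" by (auto simp: dvd_def)
  then have "q dvd p * r" by (metis dvd_triv_right)
  then obtain r' where "r = q * r'" using assms prime_elem_dvd_multD by (fastforce simp: dvd_def)
  then have "q * y = q * (p * r')" using r by (simp add: mult_ac)
  then have "y = p * r'" using assms(1) by (subst (asm) mult_left_cancel) auto
  then show "p dvd y" by simp
qed

lemma not_unit_if_cop:
  assumes "cop p m" "p dvd m"
  shows "p dvd 1"
  using copD[OF assms(1), of 1] assms(2) by simp

text \<open>A ring endomorphism that kills \<open>p\<close> and is the identity modulo \<open>p\<close> has kernel \<open>(p)\<close>.\<close>

lemma prime_elem_if_evaluation:
  fixes p :: "'n::{finite,linorder} pol"
  assumes "p \<noteq> 0" "Ev \<alpha> z p = 0"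
    and "\<And>i. p dvd polA i - \<alpha> i" "\<And>i. p dvd polX i - z i"
  shows "prime_elem p"
proof -
  have cong: "p dvd u - Ev \<alpha> z u" for u
  proof (induction u rule: pol_induct)
    case (uminus u)
    then show ?case by (metis Ev_uminus dvd_minus_iff minus_diff_eq minus_diff_minus)
  next
    case (add u v)
    then show ?case by (metis (no_types, lifting) Ev_simps(3) add_diff_add dvd_add)
  next
    case (mult u v)
    have "u * v - Ev \<alpha> z (u * v) = u * (v - Ev \<alpha> z v) + (u - Ev \<alpha> z u) * Ev \<alpha> z v"
      by (simp add: algebra_simps)
    then show ?case using mult by (metis dvd_add dvd_mult dvd_mult2)
  qed (simp_all add: assms)
  have ker: "p dvd u" if "Ev \<alpha> z u = 0" for u
    using cong[of u] that by simp
  have ker': "Ev \<alpha> z u = 0" if "p dvd u" for u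
    using that assms(2) by (auto simp: dvd_def)
  show ?thesis
  proof (rule prime_elemI)
    show "\<not> p dvd 1" using ker'[of 1] by auto
    fix a b assume "p dvd a * b"
    then have "Ev \<alpha> z a = 0 \<or> Ev \<alpha> z b = 0" using ker'[of "a * b"] by simp
    then show "p dvd a \<or> p dvd b" using ker by blast
  qed fact
qed

lemma prime_elem_polX: "prime_elem (polX i :: 'n::{finite,linorder} pol)"
  by (rule prime_elem_if_evaluation[where \<alpha> = polA and z = "polX(i := 0)"]) auto

lemma prime_elem_polA: "prime_elem (polA i :: 'n::{finite,linorder} pol)"
proof (rule prime_elem_if_evaluation[where \<alpha> = "polA(i := 0)" and z = polX])
  show "polA i \<noteq> (0 :: 'n pol)"
  proof
    assume 0: "polA i = (0 :: 'n pol)"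
    have "Ev (\<lambda>_. 1 :: int) (\<lambda>_. 1) (polA i :: 'n pol) = 1" by simp
    then show False unfolding 0 by simp
  qed
qed auto

lemma not_dvd_if_Ev:
  fixes p q :: "'n::{finite,linorder} pol"
  assumes "Ev \<alpha> z p = 0" "Ev \<alpha> z q \<noteq> 0"
  shows "\<not> p dvd q"
  using assms by (auto simp: dvd_def)

section \<open>Units and associates in the polynomial ring\<close>

lemma Ev_unit:
  assumes "u dvd 1"
  shows "Ev \<alpha> z u dvd 1"
proof -
  obtain v where "1 = u * v" using assms by (rule dvdE)
  then have "1 = Ev \<alpha> z u * Ev \<alpha> z v" by (metis Ev_simps(2,4))
  then show ?thesis by (rule dvdI)
qed

text \<open>Substitute \<open>X\<^sub>l \<leftarrow> t X\<^sub>l\<close> and compare degrees in \<open>t\<close>.\<close>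

lemma unit_polE:
  fixes v :: "'n::{finite,linorder} pol"
  assumes "v dvd 1"
  obtains u where "u dvd 1" "v = pconst u"
proof -
  define \<psi> where "\<psi> = Ev (\<lambda>i. [:polA i:]) (\<lambda>l. [:0, polX l:] :: 'n pol poly)"
  have at: "poly (\<psi> p) t = Ev polA (\<lambda>l. t * polX l) p" for p t
  proof -
    have "coeff_hom (\<lambda>p. poly (\<psi> p) t)" by (simp add: coeff_hom_def \<psi>_def)
    from coeff_hom_eq_Ev[OF this, of p] show ?thesis by (simp add: \<psi>_def)
  qed
  have const: "v = Ev polA (\<lambda>_. 0) v" if "v dvd 1" for v :: "'n pol"
  proof -
    obtain v' where v': "1 = v * v'" using \<open>v dvd 1\<close> by (rule dvdE)
    have "\<psi> v * \<psi> v' = \<psi> (v * v')" by (simp add: \<psi>_def)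
    also have "\<dots> = 1" unfolding v'[symmetric] by (simp add: \<psi>_def)
    finally have 1: "\<psi> v * \<psi> v' = 1" .
    then have "\<psi> v \<noteq> 0" "\<psi> v' \<noteq> 0" by auto
    from degree_mult_eq[OF this] 1 have "degree (\<psi> v) = 0" by simp
    then obtain c where "\<psi> v = [:c:]" by (rule degree_eq_zeroE)
    \<comment> \<open>A polynomial constant in t agrees at t = 1, where it is \<open>v\<close>, and
      at t = 0, where it is the constant term of \<open>v\<close>.\<close>
    then show ?thesis using at[of v 1] at[of v 0] by simp
  qed
  have range: "Ev polA (\<lambda>_. 0) p \<in> range pconst" for p :: "'n pol"
  proof (induction p rule: pol_induct)
    case one
    show ?case using rangeI[of pconst "1 :: 'n coef"] by (simp add: pconst_simps)
  next
    case (uminus p)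
    then show ?case by (auto simp: pconst_def single_uminus[symmetric])
  next
    case (X i)
    show ?case using rangeI[of pconst "0 :: 'n coef"] by (simp add: pconst_simps)
  next
    case (add p q)
    then show ?case by (auto simp: pconst_simps[symmetric])
  next
    case (mult p q)
    then show ?case by (auto simp: pconst_simps[symmetric])
  qed auto
  obtain v' where v': "1 = v * v'" using assms by (rule dvdE)
  then have "v' dvd 1" by (metis dvd_triv_right)
  obtain u u' where u: "v = pconst u" "v' = pconst u'"
    using const[OF assms] const[OF \<open>v' dvd 1\<close>] range[of v] range[of v'] by auto
  have "pconst (u * u') = pconst 1" using v' u by (simp add: pconst_simps)
  then have "u * u' = 1" by (metis lookup_single_eq pconst_def)
  then have "u dvd 1" by (metis dvd_triv_left)
  then show ?thesis using that u by blast
qed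

text \<open>Cancellation makes the cofactor a unit of \<open>'n pol\<close>, and
  \<open>unit_polE\<close> places it in R, where the definition of mutation wants it.\<close>

lemma associatesE:
  fixes p q :: "'n::{finite,linorder} pol"
  assumes "p dvd q" "q dvd p" "q \<noteq> 0"
  obtains u where "u dvd 1" "p = pconst u * q"
proof -
  obtain v where v: "q = p * v" using assms(1) by (rule dvdE)
  obtain v' where v': "p = q * v'" using assms(2) by (rule dvdE)
  have "q * 1 = q * (v' * v)" using v unfolding v' by (simp add: mult.assoc)
  then have "1 = v' * v" using assms(3) by (subst (asm) mult_left_cancel) auto
  then have "v' dvd 1" by (rule dvdI)
  then obtain u where "u dvd 1" "v' = pconst u" by (rule unit_polE)
  then show ?thesis using that[of u] v' by (simp add: mult.commute)
qed

lemma embc_unit_inverse: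
  assumes "u dvd 1"
  obtains v where "v dvd 1" "embc u * embc v = 1" "u * v = 1"
proof -
  obtain v where v: "1 = u * v" using assms by (rule dvdE)
  then have "v dvd 1" by (metis dvd_triv_right)
  moreover have "embc u * embc v = 1" unfolding embc_hom(4)[symmetric] v[symmetric] by (rule embc_hom)
  ultimately show ?thesis using that v by simp
qed

section \<open>Laurent polynomials\<close>

definition xmon :: "('n::finite \<Rightarrow> nat) \<Rightarrow> 'n pol"
  where "xmon m = (\<Prod>j\<in>UNIV. polX j ^ m j)"

lemma xmon_add: "xmon m * xmon m' = xmon (\<lambda>j. m j + m' j)"
  by (simp add: xmon_def power_add prod.distrib)

lemma xmon_neq_0 [simp]: "xmon m \<noteq> (0 :: 'n::{finite,linorder} pol)"
  by (simp add: xmon_def)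

lemma cop_xmon:
  fixes p :: "'n::{finite,linorder} pol"
  shows "(\<And>l. \<not> polX l dvd p) \<Longrightarrow> cop p (xmon m)"
  unfolding xmon_def by (intro cop_prod cop_power cop_prime_elem prime_elem_polX)

lemma lmonom_eq:
  fixes e :: "'n::{finite,linorder} \<Rightarrow> int"
  shows "lmonom e = emb (xmon (\<lambda>j. nat (e j))) / emb (xmon (\<lambda>j. nat (- e j)))"
proof -
  have "ratX j powi e j = ratX j ^ nat (e j) / (ratX j :: 'n ratfun) ^ nat (- e j)" for j
    by (simp add: power_int_def field_simps)
  then show ?thesis unfolding lmonom_def xmon_def by (simp add: prod_dividef)
qed

lemma lmonom_mult: "lmonom e * lmonom e' = lmonom (\<lambda>j. e j + e' j)"
  by (simp add: lmonom_def power_int_add prod.distrib)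

lemma lmonom_0 [simp]: "lmonom (\<lambda>_. 0) = 1"
  by (simp add: lmonom_def)

lemma lmonom_minus: "lmonom e * lmonom (\<lambda>j. - e j) = 1"
  by (simp add: lmonom_mult)

lemma lmonom_of_nat: "lmonom (\<lambda>j. int (m j)) = emb (xmon m)"
  by (simp add: lmonom_eq xmon_def)

lemma laurent_lmonom_mult_emb: "lmonom e * emb p \<in> laurent"
  by (auto simp: laurent_def)

text \<open>Clearing the negative exponents of the Laurent cofactor brings the question back into
  \<open>'n pol\<close>, where primes are available.\<close>

lemma laurent_dvd_emb_iff:
  fixes p q :: "'n::{finite,linorder} pol"
  shows "laurent_dvd (emb p) (emb q) \<longleftrightarrow> (\<exists>m. p dvd q * xmon m)"
proof
  assume "laurent_dvd (emb p) (emb q)"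
  then obtain e c where "emb q = emb p * (lmonom e * emb c)"
    by (auto simp: laurent_dvd_def laurent_def)
  then have "emb (q * xmon (\<lambda>j. nat (- e j))) = emb (p * (xmon (\<lambda>j. nat (e j)) * c))"
    by (simp add: lmonom_eq field_simps)
  then have "q * xmon (\<lambda>j. nat (- e j)) = p * (xmon (\<lambda>j. nat (e j)) * c)"
    by (simp only: emb_eq_iff)
  then show "\<exists>m. p dvd q * xmon m" by (metis dvd_triv_left)
next
  assume "\<exists>m. p dvd q * xmon m"
  then obtain m c where "q * xmon m = p * c" by (auto elim: dvdE)
  then have "emb q * lmonom (\<lambda>j. int (m j)) = emb p * emb c"
    unfolding lmonom_of_nat by (metis emb_mult)
  then have "emb q * (lmonom (\<lambda>j. int (m j)) * lmonom (\<lambda>j. - int (m j))) = emb p * emb c * lmonom (\<lambda>j. - int (m j))"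
    by (simp add: mult.assoc[symmetric])
  then have "emb q = emb p * (lmonom (\<lambda>j. - int (m j)) * emb c)"
    unfolding lmonom_minus by (simp add: mult_ac)
  then show "laurent_dvd (emb p) (emb q)"
    unfolding laurent_dvd_def using laurent_lmonom_mult_emb by blast
qed

lemma laurent_dvd_lmonom:
  "laurent_dvd f (lmonom e * g) \<longleftrightarrow> laurent_dvd f g"
proof -
  have *: "laurent_dvd f (lmonom e * g)" if g: "laurent_dvd f g" for e g
  proof -
    obtain e' c where "g = f * (lmonom e' * emb c)" using g by (auto simp: laurent_dvd_def laurent_def)
    then have "lmonom e * g = f * (lmonom (\<lambda>j. e j + e' j) * emb c)"
      by (simp add: lmonom_mult[symmetric])
    then show ?thesis unfolding laurent_dvd_def using laurent_lmonom_mult_emb by blast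
  qed
  have eq: "lmonom (\<lambda>j. - e j) * (lmonom e * g) = g"
    by (simp add: mult.assoc[symmetric] lmonom_mult)
  show ?thesis using *[of g e] *[of "lmonom e * g" "\<lambda>j. - e j"] unfolding eq by blast
qed

lemma laurent_dvd_unit:
  assumes "u dvd 1"
  shows "laurent_dvd f (embc u * g) \<longleftrightarrow> laurent_dvd f g"
proof -
  have *: "laurent_dvd f (embc u * g)" if g: "laurent_dvd f g" for u g
  proof -
    obtain e' c where "g = f * (lmonom e' * emb c)" using g by (auto simp: laurent_dvd_def laurent_def)
    then have "embc u * g = f * (lmonom e' * emb (pconst u * c))" by simp
    then show ?thesis unfolding laurent_dvd_def using laurent_lmonom_mult_emb by blast
  qed
  obtain v where v: "embc u * embc v = 1" by (rule embc_unit_inverse[OF assms])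
  have eq: "embc v * (embc u * g) = g"
    unfolding mult.assoc[symmetric] mult.commute[of "embc v" "embc u"] v by simp
  show ?thesis using *[of g u] *[of "embc u * g" v] unfolding eq by blast
qed

text \<open>In X_l = F t the prime X_l would have to divide t, making F a unit.\<close>

lemma prime_elem_not_dvd_polX:
  fixes F :: "'n::{finite,linorder} pol"
  assumes "prime_elem F" "\<not> polX l dvd F"
  shows "\<not> F dvd polX l"
proof
  assume "F dvd polX l"
  then obtain t where t: "polX l = F * t" by (rule dvdE)
  then have "polX l dvd F \<or> polX l dvd t"
    using prime_elem_polX[of l] by (metis dvd_refl prime_elem_dvd_multD)
  then obtain t' where "t = polX l * t'" using assms(2) by (auto elim: dvdE)
  then have "polX l * 1 = polX l * (F * t')" using t by (metis mult.left_commute mult_1_right)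
  then have "1 = F * t'" by (subst (asm) mult_left_cancel) auto
  then have "F dvd 1" by (rule dvdI)
  then show False using assms(1) by (simp add: prime_elem_def)
qed

lemma prime_elem_not_dvd_xmon:
  fixes F :: "'n::{finite,linorder} pol"
  assumes "prime_elem F" "\<And>l. \<not> polX l dvd F"
  shows "\<not> F dvd xmon m"
proof
  assume "F dvd xmon m"
  with cop_xmon[OF assms(2), of m] have "F dvd 1" by (intro not_unit_if_cop)
  then show False using assms(1) by (simp add: prime_elem_def)
qed

section \<open>Primality under mutation\<close>

text \<open>The substitution \<open>X\<^sub>i \<leftarrow> g/X\<^sub>i\<close> is an involution up to powers of \<open>g\<close> and \<open>X\<^sub>i\<close>, so it carries the
  divisibility of polynomials by \<open>F\<close> over to divisibility by \<open>P\<close>.\<close>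

lemma prime_elem_exchange:
  fixes F P g c :: "'n::{finite,linorder} pol"
  assumes F: "prime_elem F" "\<not> polX i dvd F" "\<not> F dvd c"
    and inv: "\<not> involves g i" "\<not> involves c i" and "g \<noteq> 0"
    and id: "\<And>z. z i \<noteq> 0 \<Longrightarrow> z i ^ M * ev (z(i := ev z g / z i)) F = ev z c * ev z P"
    and P: "cop P g" "\<not> polX i dvd P"
  shows "prime_elem P"
proof -
  define w where "w = ratX(i := emb g / ratX i)"
  have wi: "ratX i * w i = emb g" by (simp add: w_def)
  have wi0: "w i \<noteq> 0" using \<open>g \<noteq> 0\<close> by (simp add: w_def)
  have wg: "ev w g = emb g" and wc: "ev w c = emb c"
    using inv by (simp_all add: w_def ev_upd)
  have ww: "w(i := emb g / w i) = ratX" using \<open>g \<noteq> 0\<close> by (simp add: w_def fun_eq_iff)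
  \<comment> \<open>The identity is used at two points: at \<open>ratX\<close>, and at
    \<open>w\<close>, from which the substitution leads back to \<open>ratX\<close>.\<close>
  have eq1: "ratX i ^ M * ev w F = emb c * emb P" using id[of ratX] by (simp add: w_def)
  have eq2: "w i ^ M * emb F = emb c * ev w P" using id[of w] wi0 by (simp add: wg wc ww)
  \<comment> \<open>\<open>red q q' N\<close> says that q' is the image of q with denominator X_i^N
    cleared, read in both directions of the involution.\<close>
  define red where "red = (\<lambda>q q' N. emb q' = ratX i ^ N * ev w q \<and> ev w q' = w i ^ N * emb q)"
  have red: "\<exists>q' N. red q q' N" for q
  proof -
    obtain N q' where q': "\<And>z. z i \<noteq> 0 \<Longrightarrow> ev z q' = z i ^ N * ev (z(i := ev z g / z i)) q"
      using clear_denominator by blast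
    show ?thesis unfolding red_def
      using q'[of ratX] q'[of w] wi0 by (intro exI[of _ q'] exI[of _ N]) (simp add: wg ww, simp add: w_def)
  qed
  have F_X: "\<not> F dvd polX i ^ k" for k
    using prime_elem_not_dvd_polX[OF F(1,2)] F(1) prime_elem_dvd_power by blast
  have dvd_F: "F dvd q'" if Pq: "P dvd q" and q': "red q q' N" for q q' N
  proof -
    obtain k where k: "q = P * k" using Pq by (rule dvdE)
    obtain k' K where k': "red k k' K" using red by blast
    \<comment> \<open>Substituting in q = P k and clearing denominators gives F g^M k' X_i^N = c q'
      X_i^(M + K), where X_i w_i = g. As F divides neither c nor X_i, it divides q'.\<close>
    have "emb (F * (g ^ M * k' * polX i ^ N)) = ratX i ^ (M + K + N) * (w i ^ M * emb F) * ev w k"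
      using k' by (simp add: red_def wi[symmetric] power_mult_distrib power_add mult_ac)
    also have "\<dots> = emb (c * q' * polX i ^ (M + K))"
      unfolding eq2 using q' by (simp add: red_def k power_add mult_ac)
    finally have "F * (g ^ M * k' * polX i ^ N) = c * q' * polX i ^ (M + K)" by (simp only: emb_eq_iff)
    then have "F dvd c * q' * polX i ^ (M + K)" by (metis dvd_triv_left)
    then show ?thesis using F F_X by (meson prime_elem_dvd_multD)
  qed
  have dvd_P: "P dvd q" if Fq: "F dvd q'" and q': "red q q' N" for q q' N
  proof -
    obtain d where d: "q' = F * d" using Fq by (rule dvdE)
    obtain d' D where d': "red d d' D" using red by blast
    \<comment> \<open>The converse: q' = F d gives q g^N X_i^(M + D) = P c d' X_i^N, and the factors
      beside q are coprime to P in the sense of \<open>cop\<close>.\<close>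
    have "emb (q * (g ^ N * polX i ^ (M + D))) = ratX i ^ (M + D + N) * ev w q'"
      using q' by (simp add: red_def wi[symmetric] power_mult_distrib power_add mult_ac)
    also have "\<dots> = (ratX i ^ M * ev w F) * (ratX i ^ (N + D) * ev w d)"
      by (simp add: d power_add mult_ac)
    also have "\<dots> = emb (P * (c * d' * polX i ^ N))"
      unfolding eq1 using d' by (simp add: red_def power_add mult_ac)
    finally have "q * (g ^ N * polX i ^ (M + D)) = P * (c * d' * polX i ^ N)" by (simp only: emb_eq_iff)
    then have "P dvd q * (g ^ N * polX i ^ (M + D))" by (metis dvd_triv_left)
    moreover have "cop P (g ^ N * polX i ^ (M + D))"
      by (intro cop_mult cop_power cop_prime_elem P prime_elem_polX)
    ultimately show ?thesis by (rule copD[rotated])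
  qed
  show ?thesis
  proof (rule prime_elemI)
    show "P \<noteq> 0"
    proof
      assume "P = 0"
      then have "ev w F = 0" using eq1 by simp
      then obtain F' N where "red F F' N" "F' = 0"
        using red[of F] by (auto simp: red_def)
      then show False using wi0 F(1) by (simp add: red_def)
    qed
    show "\<not> P dvd 1"
    proof
      assume "P dvd 1"
      then have "F dvd 1" by (rule dvd_F[of _ _ 0]) (simp add: red_def)
      then show False using F(1) by (simp add: prime_elem_def)
    qed
    fix a b assume ab: "P dvd a * b"
    obtain a' N b' N' where a: "red a a' N" and b: "red b b' N'" using red by blast
    have "red (a * b) (a' * b') (N + N')" using a b by (simp add: red_def power_add mult_ac)
    then have "F dvd a' * b'" by (rule dvd_F[OF ab])
    then show "P dvd a \<or> P dvd b" using F(1) dvd_P[OF _ a] dvd_P[OF _ b] prime_elem_dvd_multD by blast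
  qed
qed

section \<open>Rescaling the variables by units\<close>

text \<open>When all w_l are units this is an automorphism, with inverse given by the inverse units.
  It records what a rescaling of the cluster variables does to a polynomial.\<close>

definition tw :: "('n::{finite,linorder} \<Rightarrow> 'n coef) \<Rightarrow> 'n pol \<Rightarrow> 'n pol"
  where "tw w = Ev polA (\<lambda>l. pconst (w l) * polX l)"

lemma tw_simps [simp]:
  "tw w 0 = 0" "tw w 1 = 1" "tw w (p + q) = tw w p + tw w q" "tw w (p * q) = tw w p * tw w q"
  "tw w (pconst c) = pconst c" "tw w (polX l) = pconst (w l) * polX l"
  by (simp_all add: tw_def)

lemma ev_tw: "ev z (tw w p) = ev (\<lambda>l. embc (w l) * z l) p"
  by (simp add: tw_def ev_Ev)

lemma emb_tw: "emb (tw w p) = ev (\<lambda>l. embc (w l) * ratX l) p"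
  using ev_tw[of ratX] by simp

lemma tw_1 [simp]: "tw (\<lambda>_. 1) p = p"
  by (simp add: tw_def pconst_simps)

lemma tw_tw: "tw w (tw v p) = tw (\<lambda>l. v l * w l) p"
  unfolding tw_def Ev_Ev by (simp add: pconst_simps mult_ac)

lemma tw_upd: "\<not> involves p i \<Longrightarrow> tw (w(i := u)) p = tw w p"
  unfolding tw_def by (rule Ev_cong_involves) auto

lemma unit_inverse_fun:
  assumes "\<And>l. w l dvd (1 :: 'n coef)"
  obtains v where "\<And>l. v l dvd (1 :: 'n coef)" "\<And>l. w l * v l = 1" "\<And>l. v l * w l = 1"
proof -
  have "\<exists>v. 1 = w l * v" for l using assms[of l] unfolding dvd_def .
  then obtain v where v: "\<And>l. 1 = w l * v l" by metis
  have v': "1 = v l * w l" for l unfolding v[of l] by (rule mult.commute)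
  show ?thesis by (rule that[of v]) (rule dvdI[OF v'] v[symmetric] v'[symmetric])+
qed

text \<open>One direction holds for any w; applied to the inverse rescaling it yields the
  other.\<close>

lemma tw_dvd_iff:
  assumes "\<And>l. w l dvd 1"
  shows "tw w p dvd tw w q \<longleftrightarrow> p dvd q"
proof -
  obtain v where v: "\<And>l. v l dvd 1" "\<And>l. w l * v l = 1" "\<And>l. v l * w l = 1"
    using unit_inverse_fun[where w = w, OF assms] by blast
  have *: "tw w p dvd tw w q" if pq: "p dvd q" for w p q
  proof -
    obtain k where "q = p * k" using pq by (rule dvdE)
    then have "tw w q = tw w p * tw w k" by simp
    then show ?thesis by (rule dvdI)
  qed
  show ?thesis using *[of p q w] *[of "tw w p" "tw w q" v] by (auto simp only: tw_tw v tw_1)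
qed

lemma unit_mult_dvd_iff':
  fixes p q :: "'a::comm_semiring_1"
  assumes "u dvd 1"
  shows "u * p dvd q \<longleftrightarrow> p dvd q"
proof -
  obtain v where v: "1 = u * v" using assms by (rule dvdE)
  have "p dvd q \<Longrightarrow> u * p dvd q"
  proof -
    assume "p dvd q"
    then obtain k where "q = p * k" by (rule dvdE)
    then have "q = (u * p) * (v * k)" using v by (metis mult.assoc mult.left_commute mult_1_left)
    then show "u * p dvd q" by (rule dvdI)
  qed
  then show ?thesis by (auto intro: dvd_mult_right)
qed

lemma polX_dvd_tw_iff:
  assumes "\<And>l. w l dvd 1"
  shows "polX l dvd tw w p \<longleftrightarrow> polX l dvd p"
  using tw_dvd_iff[where w = w, OF assms, of "polX l" p] unit_mult_dvd_iff'[OF pconst_dvd_1[OF assms[of l]]]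
  by simp

lemma prime_elem_tw:
  assumes w: "\<And>l. w l dvd 1" and p: "prime_elem p"
  shows "prime_elem (tw w p)"
proof -
  obtain v where "\<And>l. v l dvd 1" and v: "\<And>l. w l * v l = 1" "\<And>l. v l * w l = 1"
    using unit_inverse_fun[where w = w, OF w] by blast
  have vw: "tw w (tw v q) = q" for q by (simp add: tw_tw v)
  have dvd: "tw w p dvd q \<longleftrightarrow> p dvd tw v q" for q using tw_dvd_iff[where w = w, OF w, of p "tw v q"] by (simp add: vw)
  show ?thesis
  proof (rule prime_elemI)
    show "tw w p \<noteq> 0"
    proof
      assume "tw w p = 0"
      then have "tw v (tw w p) = 0" by simp
      then show False using p by (simp add: tw_tw v)
    qed
  qed (use p in \<open>auto simp: dvd prime_elem_def\<close>)
qed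

lemma involves_tw: "\<not> involves p i \<Longrightarrow> \<not> involves (tw w p) i"
  unfolding tw_def by (rule involves_Ev) (metis involves_mult involves_pconst involves_polX)

lemma involves_unit_tw_iff:
  assumes w: "\<And>l. w l dvd 1" and u: "u dvd 1"
  shows "involves (pconst u * tw w p) i \<longleftrightarrow> involves p i"
proof
  obtain v where "\<And>l. v l dvd 1" and v: "\<And>l. w l * v l = 1" "\<And>l. v l * w l = 1"
    using unit_inverse_fun[where w = w, OF w] by blast
  obtain u' where u': "1 = u * u'" using u by (rule dvdE)
  assume "involves p i"
  moreover have "p = pconst u' * tw v (pconst u * tw w p)"
    by (simp add: tw_tw v mult.assoc[symmetric] pconst_simps(4)[symmetric] mult.commute[of u'] u'[symmetric])
      (simp add: pconst_simps)
  ultimately show "involves (pconst u * tw w p) i"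
    by (metis involves_mult involves_pconst involves_tw)
next
  assume "involves (pconst u * tw w p) i"
  then show "involves p i" by (metis involves_mult involves_pconst involves_tw)
qed

section \<open>The exponents of \<open>\<hat>F\<^sub>i\<close>\<close>

text \<open>Suppose a_j < b_j. Under X_j := F_j/X the quotient of the two monomials contributes
  F_j^(b_j - a_j) and otherwise only a Laurent monomial, so the candidate with exponents b is
  divisible by F_j, which its condition at j forbids.\<close>

lemma hat_exponents_unique:
  fixes F :: "'n::{finite,linorder} \<Rightarrow> 'n pol"
  assumes a: "hat_exponents F i a" and b: "hat_exponents F i b" and F: "\<And>j. F j \<noteq> 0"
  shows "a = b"
proof -
  have *: "\<not> a j < b j" if a: "hat_exponents F i a" and b: "hat_exponents F i b" and "j \<noteq> i" for a b j
  proof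
    assume ab: "a j < b j"
    define z where "z = ratX(j := emb (F j) / ratX j)"
    define d where "d = (\<lambda>l. b l - a l)"
    \<comment> \<open>At \<open>j\<close> the sign flips because X_j is in the denominator of
      \<open>z j\<close>; at \<open>i\<close> the exponent is 0 because the product omits that
      index.\<close>
    define e where "e = (\<lambda>l. if l = i then 0 else if l = j then - d j else d l)"
    obtain n where n: "d j = int (Suc n)" using ab unfolding d_def
      by (metis diff_gt_0_iff_gt gr0_implies_Suc zero_less_imp_eq_int of_nat_0_less_iff)
    have z0: "z l \<noteq> 0" for l by (simp add: z_def F)
    have "(\<Prod>l\<in>UNIV - {i}. z l powi d l) =
        (\<Prod>l\<in>UNIV - {i}. (if l = j then emb (F j) powi d j else 1) * ratX l powi e l)"
      by (intro prod.cong refl)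
        (auto simp: z_def e_def power_int_minus power_int_divide_distrib divide_simps)
    also have "\<dots> = emb (F j) powi d j * (\<Prod>l\<in>UNIV - {i}. ratX l powi e l)"
      using \<open>j \<noteq> i\<close> by (simp add: prod.distrib)
    also have "(\<Prod>l\<in>UNIV - {i}. ratX l powi e l) = lmonom e"
      unfolding lmonom_def by (subst prod.remove[of UNIV i]) (auto simp: e_def)
    also have "emb (F j) powi d j = emb (F j) * emb (F j ^ n)"
      unfolding n power_int_of_nat by simp
    finally have pd: "(\<Prod>l\<in>UNIV - {i}. z l powi d l) = emb (F j) * emb (F j ^ n) * lmonom e" .
    have "hat_at F i b z = hat_at F i a z * (\<Prod>l\<in>UNIV - {i}. z l powi d l)"
      unfolding hat_at_def d_def by (simp add: power_int_diff z0 prod_dividef)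
    also have "\<dots> = emb (F j) * (hat_at F i a z * emb (F j ^ n) * lmonom e)"
      unfolding pd by (simp add: mult_ac)
    finally have eq: "hat_at F i b z = emb (F j) * (hat_at F i a z * emb (F j ^ n) * lmonom e)" .
    have "hat_at F i a z \<in> laurent" using a \<open>j \<noteq> i\<close> by (auto simp: hat_exponents_def z_def Let_def)
    then obtain e' p where "hat_at F i a z = lmonom e' * emb p" by (auto simp: laurent_def)
    then have eq': "hat_at F i a z * emb (F j ^ n) * lmonom e = lmonom (\<lambda>l. e' l + e l) * emb (p * F j ^ n)"
      by (simp add: lmonom_mult[symmetric] mult_ac)
    have "laurent_dvd (emb (F j)) (hat_at F i b z)"
      unfolding laurent_dvd_def eq eq' by (rule bexI[OF refl laurent_lmonom_mult_emb])
    then show False using b \<open>j \<noteq> i\<close> by (auto simp: hat_exponents_def z_def Let_def)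
  qed
  show ?thesis
  proof
    fix j show "a j = b j"
      using *[OF a b, of j] *[OF b a, of j] a b by (cases "j = i") (auto simp: hat_exponents_def)
  qed
qed

lemma hat_at_0 [simp]: "hat_at F i (\<lambda>_. 0) z = ev z (F i)"
  by (simp add: hat_at_def)

text \<open>Substituting F/X_j in X_j a + b gives (F a + X_j b)/X_j. This is Laurent, and F divides
  it only if F divides b. Hence exponent 0 is correct at j.\<close>

lemma hat_condition_linear:
  fixes F a b :: "'n::{finite,linorder} pol"
  assumes F: "prime_elem F" "\<And>l. \<not> polX l dvd F" and "\<not> involves a j" "\<not> involves b j" "\<not> F dvd b"
  defines "f \<equiv> ev (ratX(j := emb F / ratX j)) (polX j * a + b)"
  shows "f \<in> laurent" "\<not> laurent_dvd (emb F) f"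
proof -
  have "lmonom (\<lambda>l. int (if l = j then 1 else 0)) = (ratX j :: 'n ratfun)"
    unfolding lmonom_of_nat xmon_def by (simp add: if_distrib[of "\<lambda>k. _ ^ k"] cong: if_cong)
  then have X: "lmonom (\<lambda>l. - int (if l = j then 1 else 0)) * (ratX j :: 'n ratfun) = 1"
    using lmonom_minus[of "\<lambda>l. int (if l = j then 1 else 0)"] by (simp add: mult.commute)
  have "f = emb F / ratX j * emb a + emb b" using assms by (simp add: f_def ev_upd)
  also have "\<dots> = (lmonom (\<lambda>l. - int (if l = j then 1 else 0)) * ratX j) * (emb F / ratX j * emb a + emb b)"
    unfolding X by simp
  also have "\<dots> = lmonom (\<lambda>l. - int (if l = j then 1 else 0)) * emb (F * a + polX j * b)"
    by (simp add: field_simps)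
  finally have f: "f = lmonom (\<lambda>l. - int (if l = j then 1 else 0)) * emb (F * a + polX j * b)" .
  show "f \<in> laurent" unfolding f by (rule laurent_lmonom_mult_emb)
  show "\<not> laurent_dvd (emb F) f"
  proof
    assume "laurent_dvd (emb F) f"
    then obtain m where "F dvd (F * a + polX j * b) * xmon m"
      unfolding f laurent_dvd_lmonom laurent_dvd_emb_iff by blast
    then have "F dvd F * a + polX j * b"
      using F prime_elem_not_dvd_xmon prime_elem_dvd_multD by blast
    then have "F dvd polX j * b" by (metis dvd_add_right_iff dvd_triv_left)
    then show False using F assms prime_elem_not_dvd_polX prime_elem_dvd_multD by blast
  qed
qed

section \<open>The new exchange polynomials\<close>

text \<open>Existence: dividing out c once suffices, as any further common factor would contain a
  prime of \<open>Q\<close>, and none of these divides B. Uniqueness: whatever is divided out, in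
  any order, divides a monomial times a power of the product of \<open>Q\<close>. B is coprime to
  that and P is coprime to c, so P and B divide each other.\<close>

lemma new_exchange_iff:
  fixes F :: "'n::{finite,linorder} \<Rightarrow> 'n pol" and B c P :: "'n pol"
  assumes g: "ev (ratX(j := 0)) (F i) = embc u0 * emb (xmon m0 * prod_list Q)" "u0 dvd 1"
    and G: "ev (ratX(i := ev (ratX(j := 0)) (F i) / ratX i)) (F j) = embc u1 * lmonom e1 * emb (c * B)"
      "u1 dvd 1" "e1 j = 0"
    and Q: "\<And>q. q \<in> set Q \<Longrightarrow> prime_elem q" "\<And>q l. q \<in> set Q \<Longrightarrow> \<not> polX l dvd q"
      "\<And>q. q \<in> set Q \<Longrightarrow> \<not> involves q i \<and> \<not> involves q j"
    and B: "\<And>q. q \<in> set Q \<Longrightarrow> \<not> q dvd B" "\<And>l. \<not> polX l dvd B"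
    and c: "c = 1 \<or> c \<in> set Q"
  shows "new_exchange F i (\<lambda>_. 0) j P \<longleftrightarrow> (\<exists>u. u dvd 1 \<and> P = pconst u * B)"
proof -
  define g' where "g' = ev (ratX(j := 0)) (F i)"
  define G' where "G' = ev (ratX(i := g' / ratX i)) (F j)"
  let ?R = "\<lambda>h h'. \<exists>p. common_factor i j g' h p \<and> h' = h / emb p"
  have G': "G' = embc u1 * (lmonom e1 * emb (c * B))"
    using G(1) by (simp add: G'_def g'_def mult.assoc)
  have g_dvd: "laurent_dvd (emb p) g' \<longleftrightarrow> (\<exists>m. p dvd xmon m0 * prod_list Q * xmon m)" for p
    unfolding g'_def g(1) laurent_dvd_unit[OF g(2)] laurent_dvd_emb_iff ..
  have Q_dvd: "q dvd prod_list Q" if "q \<in> set Q" for q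
    using split_list[OF that] by (auto intro: dvd_mult dvd_mult2)
  have Q_xmon: "\<not> q dvd xmon m" if "q \<in> set Q" for q m
    by (rule prime_elem_not_dvd_xmon) (use Q that in blast)+
  have Q_factor: "common_factor i j g' h q" if "q \<in> set Q" "laurent_dvd (emb q) h" for q h
  proof -
    have "\<not> laurent_dvd (emb q) (emb 1)" unfolding laurent_dvd_emb_iff using Q_xmon[OF that(1)] by simp
    moreover have "laurent_dvd (emb q) g'" unfolding g_dvd using Q_dvd[OF that(1)] by (blast intro: dvd_mult dvd_mult2)
    ultimately show ?thesis using that Q(3) by (simp add: common_factor_def)
  qed
  have unit_dvd: "q dvd pconst u * B \<longleftrightarrow> q dvd B" if "u dvd 1" for q u
    using copD[OF cop_unit[OF pconst_dvd_1[OF that]], of q B] by (auto simp: mult.commute)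
  have ne: "new_exchange F i (\<lambda>_. 0) j P \<longleftrightarrow> (\<exists>H e u. ?R\<^sup>*\<^sup>* G' H \<and> (\<nexists>p. common_factor i j g' H p) \<and> e j = 0 \<and>
      u dvd 1 \<and> emb P = embc u * lmonom e * H \<and> (\<forall>l. \<not> polX l dvd P))"
    by (simp add: new_exchange_def factors_divided_out_def Let_def g'_def G'_def)
  show ?thesis
  proof
    assume "\<exists>u. u dvd 1 \<and> P = pconst u * B"
    then obtain u where u: "u dvd 1" "P = pconst u * B" by blast
    define H where "H = embc u1 * (lmonom e1 * emb B)"
    have "?R\<^sup>*\<^sup>* G' H"
    proof (cases "c = 1")
      case True
      then show ?thesis by (simp add: G' H_def)
    next
      case False
      then have cQ: "c \<in> set Q" using c by simp
      have "laurent_dvd (emb c) G'"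
        unfolding G' laurent_dvd_unit[OF G(2)] laurent_dvd_lmonom laurent_dvd_emb_iff
        by (intro exI[of _ "\<lambda>_. 0"]) simp
      then have "common_factor i j g' G' c" by (rule Q_factor[OF cQ])
      moreover have "H = G' / emb c" using Q(1)[OF cQ] by (simp add: G' H_def)
      ultimately show ?thesis by (intro r_into_rtranclp) blast
    qed
    moreover have "\<not> common_factor i j g' H p" for p
    proof
      assume p: "common_factor i j g' H p"
      obtain m where m: "p dvd xmon m0 * prod_list Q * xmon m" using p by (auto simp: common_factor_def g_dvd)
      \<comment> \<open>A divisor of g that no prime of \<open>Q\<close> divides would divide a
        monomial and thus be a unit of the Laurent ring, which \<open>common_factor\<close>
        excludes.\<close>
      have "\<exists>q\<in>set Q. q dvd p"
      proof (rule ccontr)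
        assume "\<not> (\<exists>q\<in>set Q. q dvd p)"
        then have "cop p (prod_list Q)" by (intro cop_prod_list cop_prime_elem Q(1)) auto
        moreover have "p dvd (1 * xmon (\<lambda>j. m0 j + m j)) * prod_list Q"
        proof -
          have eq: "xmon m0 * prod_list Q * xmon m = (1 * xmon (\<lambda>j. m0 j + m j)) * prod_list Q"
            unfolding xmon_add[symmetric] by (simp add: mult_ac)
          show ?thesis using m unfolding eq .
        qed
        ultimately have "p dvd 1 * xmon (\<lambda>j. m0 j + m j)" by (rule copD)
        then have "laurent_dvd (emb p) (emb 1)" unfolding laurent_dvd_emb_iff
          by (intro exI[of _ "\<lambda>j. m0 j + m j"])
        then show False using p by (simp add: common_factor_def)
      qed
      then obtain q where q: "q \<in> set Q" "q dvd p" by blast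
      have "laurent_dvd (emb p) H" using p by (simp add: common_factor_def)
      then obtain m where "p dvd B * xmon m"
        unfolding H_def laurent_dvd_unit[OF G(2)] laurent_dvd_lmonom laurent_dvd_emb_iff by blast
      then have "q dvd B * xmon m" using q(2) dvd_trans by blast
      then show False using Q(1) B(1) Q_xmon q(1) prime_elem_dvd_multD by blast
    qed
    moreover obtain v1 where v1: "v1 dvd 1" "embc u1 * embc v1 = 1" "u1 * v1 = 1"
      by (rule embc_unit_inverse[OF G(2)])
    have "emb P = embc (u * v1) * lmonom (\<lambda>l. - e1 l) * H"
    proof -
      have "embc (u * v1) * lmonom (\<lambda>l. - e1 l) * H =
        embc u * (embc u1 * embc v1) * (lmonom e1 * lmonom (\<lambda>l. - e1 l)) * emb B"
        by (simp only: H_def embc_hom mult_ac)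
      also have "\<dots> = emb P" unfolding v1(2) lmonom_minus by (simp add: u)
      finally show ?thesis by simp
    qed
    moreover have "u * v1 dvd 1" using u v1 by (metis mult_1_left mult_dvd_mono)
    moreover have "\<forall>l. \<not> polX l dvd P" unfolding u(2) unit_dvd[OF u(1)] using B(2) by blast
    moreover have "(\<lambda>l. - e1 l) j = 0" using G(3) by simp
    ultimately show "new_exchange F i (\<lambda>_. 0) j P" unfolding ne
      by (intro exI[of _ H] exI[of _ "\<lambda>l. - e1 l"] exI[of _ "u * v1"] conjI) simp_all
  next
    assume "new_exchange F i (\<lambda>_. 0) j P"
    then obtain H e u where chain: "?R\<^sup>*\<^sup>* G' H" and max: "\<And>p. \<not> common_factor i j g' H p" and u: "u dvd 1"
      and P': "emb P = embc u * lmonom e * H" and PX: "\<And>l. \<not> polX l dvd P"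
      unfolding ne by blast
    have P: "emb P = embc u * (lmonom e * H)" unfolding P' by (rule mult.assoc)
    \<comment> \<open>The individual factors of an arbitrary chain are unknown, but each divides g
      up to a monomial, and this bounds their product r.\<close>
    have "\<exists>r N m. G' = H * emb r \<and> r dvd xmon m * prod_list Q ^ N" using chain
    proof (induction rule: rtranclp_induct)
      case base
      show ?case by (intro exI[of _ 1]) simp
    next
      case (step h h')
      then obtain p where p: "common_factor i j g' h p" "h' = h / emb p" by blast
      obtain r N m where r: "G' = h * emb r" "r dvd xmon m * prod_list Q ^ N" using step by blast
      obtain m' where m': "p dvd xmon m0 * prod_list Q * xmon m'" using p by (auto simp: common_factor_def g_dvd)
      have "prod_list Q \<noteq> 0" using Q(1)[of 0] by (auto simp: prod_list_zero_iff)
      then have "p \<noteq> 0" using m' by auto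
      then have "G' = h' * emb (r * p)" using r p by simp
      moreover have "r * p dvd xmon (\<lambda>l. m l + m0 l + m' l) * prod_list Q ^ Suc N"
        using mult_dvd_mono[OF r(2) m'] by (simp add: xmon_add[where m = "\<lambda>l. m l + m0 l", symmetric] xmon_add[of m m0, symmetric] mult_ac)
      ultimately show ?case by blast
    qed
    then obtain r N m where r: "G' = H * emb r" "r dvd xmon m * prod_list Q ^ N" by blast
    \<comment> \<open>Such a prime would still be a common factor of g and \<open>H\<close>,
      although \<open>H\<close> admits none.\<close>
    have PQ: "\<not> q dvd P" if q: "q \<in> set Q" for q
    proof
      assume "q dvd P"
      then have "q dvd P * xmon (\<lambda>_. 0)" by simp
      then have "laurent_dvd (emb q) (emb P)" unfolding laurent_dvd_emb_iff by blast
      then have "laurent_dvd (emb q) H" unfolding P laurent_dvd_unit[OF u] laurent_dvd_lmonom .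
      then show False using Q_factor[OF q] max by blast
    qed
    define e2 where "e2 = (\<lambda>l. e l + e1 l)"
    let ?m = "xmon (\<lambda>l. nat (- e2 l))" and ?m' = "xmon (\<lambda>l. nat (e2 l))"
    have "emb (P * r) = embc u * lmonom e * G'" unfolding r(1) by (simp add: P)
    also have "\<dots> = embc (u * u1) * lmonom e2 * emb (c * B)"
      unfolding G' e2_def lmonom_mult[symmetric] embc_hom by (simp add: mult_ac)
    finally have "emb (P * r * ?m) = emb (B * (pconst (u * u1) * ?m' * c))"
      unfolding lmonom_eq by (simp add: field_simps)
    then have eq: "P * r * ?m = B * (pconst (u * u1) * ?m' * c)" by (simp only: emb_eq_iff)
    have "u * u1 dvd 1" using u G(2) by (metis mult_1_left mult_dvd_mono)
    moreover have "cop P c" using c PQ cop_prime_elem Q(1) by auto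
    ultimately have "cop P (pconst (u * u1) * ?m' * c)"
      using PX by (intro cop_mult cop_xmon cop_unit[OF pconst_dvd_1])
    moreover have "P dvd B * (pconst (u * u1) * ?m' * c)" unfolding eq[symmetric] by simp
    ultimately have PB: "P dvd B" by (rule copD)
    obtain s where s: "xmon m * prod_list Q ^ N = r * s" using r(2) by (rule dvdE)
    have "B dvd P * r * ?m * s" unfolding eq by (simp add: mult.assoc)
    also have "P * r * ?m * s = P * ((xmon m * prod_list Q ^ N) * ?m)" unfolding s by (simp add: mult_ac)
    finally have "B dvd P * ((xmon m * prod_list Q ^ N) * ?m)" .
    moreover have "cop B ((xmon m * prod_list Q ^ N) * ?m)"
      by (intro cop_mult cop_xmon cop_power cop_prod_list cop_prime_elem Q(1) B) auto
    ultimately have BP: "B dvd P" by (rule copD[rotated])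
    have "B \<noteq> 0" using B(2) by auto
    then show "\<exists>u. u dvd 1 \<and> P = pconst u * B" using associatesE[OF PB BP] by blast
  qed
qed

section \<open>The polynomials of an activation sequence\<close>

lemma Ypol_0 [simp]: "Ypol s 0 = 1"
  by (simp add: Ypol_def)

lemma Ypol_pos: "0 < r \<Longrightarrow> Ypol s r = polX (entry s r)"
  by (simp add: Ypol_def)

section \<open>Indices of an activation sequence and the variables occurring\<close>

lemma entry_eq_iff:
  "distinct s \<Longrightarrow> i \<in> {1..length s} \<Longrightarrow> j \<in> {1..length s} \<Longrightarrow> entry s i = entry s j \<longleftrightarrow> i = j"
  by (auto simp: nth_eq_iff_index_eq)

lemma entry_in_set: "i \<in> {1..length s} \<Longrightarrow> entry s i \<in> set s"
  by auto

lemma entryE: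
  assumes "l \<in> set s"
  obtains i where "i \<in> {1..length s}" "l = entry s i"
proof -
  obtain k where "k < length s" "l = s ! k" using assms by (auto simp: in_set_conv_nth)
  then show ?thesis by (intro that[of "Suc k"]) auto
qed

lemma prod_entry: "(\<Prod>r = 1..length s. f (entry s r)) = prod_list (map f s)"
proof -
  have "(\<Prod>r = 1..length s. f (entry s r)) = (\<Prod>r<length s. f (s ! r))"
    by (rule prod.reindex_bij_witness[of _ Suc "\<lambda>r. r - 1"]) auto
  then show ?thesis by (simp add: prod.list_conv_set_nth lessThan_atLeast0)
qed

lemma involves_Ypol:
  assumes "distinct s" "t \<in> {1..length s}" "r \<le> length s" "r \<noteq> t"
  shows "\<not> involves (Ypol s r) (entry s t)"
  using assms entry_eq_iff[of s t r] by (cases "r = 0") (auto simp: Ypol_pos)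

lemma involves_Xprod: "l \<in> set s \<Longrightarrow> \<not> involves (\<Prod>\<rho>\<in>- set s. polX \<rho> :: 'n::{finite,linorder} pol) l"
  by (rule involves_prod) auto

lemma involves_Aprod: "\<not> involves (\<Prod>r\<in>R. polA (f r) :: 'n::{finite,linorder} pol) l"
  by (rule involves_prod) auto

lemma involves_Cpol:
  fixes s :: "'n::{finite,linorder} list"
  assumes "distinct s" "t \<in> {1..length s}" "t < i + 2"
  shows "\<not> involves (Cpol s i) (entry s t)"
  unfolding Cpol_def by (intro involves_prod involves_power involves_Ypol) (use assms in auto)

text \<open>The earliest created variable in P_{s_i} is that of index i - 1, and the factors P_{s_r}
  with r > i only reach back to r - 1. Therefore the product in E_{s_i}, which starts at r = i + 2,
  is free of the variable of index i.\<close>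

lemma involves_Ppol:
  fixes s :: "'n::{finite,linorder} list"
  assumes "distinct s" "i \<in> {1..length s}" "t \<in> {1..length s}" "t < i - 1"
  shows "\<not> involves (Ppol s i) (entry s t)"
  using assms
proof (induction s i rule: Ppol.induct)
  case (1 s i)
  show ?case
  proof (cases "length s \<le> i")
    case True
    then have "Ppol s i = (\<Prod>r = 1..i - 1. polA (entry s r)) * (\<Prod>\<rho>\<in>- set s. polX \<rho>) + polA (entry s i) * Ypol s (i - 1)"
      by (subst Ppol.simps) simp
    then show ?thesis
      by (simp only:) (intro involves_add involves_mult involves_Xprod involves_Aprod involves_Ypol entry_in_set
          involves_pconst; use 1(2-) in auto)
  next
    case False
    have "\<not> involves (\<Prod>r = i + 1..length s. Ppol s r) (entry s t)"
      by (intro involves_prod 1(1)[OF False]) (use 1(2-) in auto)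
    moreover have "Ppol s i = (\<Prod>r = 1..i - 1. polA (entry s r)) * (\<Prod>\<rho>\<in>- set s. polX \<rho>) * (\<Prod>r = i + 1..length s. Ppol s r)
          + polA (entry s i) * Ypol s (i - 1) * Ypol s (i + 1) * Cpol s i"
      using False by (subst Ppol.simps) simp
    ultimately show ?thesis
      by (simp only:) (intro involves_add involves_mult involves_Xprod involves_Aprod involves_Ypol entry_in_set
          involves_pconst involves_Cpol; use 1(2-) False in auto)
  qed
qed

lemma Epol_notin:
  "l \<notin> set s \<Longrightarrow> Epol s l = (\<Prod>r = 1..length s. polA (entry s r)) * (\<Prod>\<rho>\<in>- set s - {l}. polX \<rho>)
     + polA l * Ypol s (length s)"
  by (simp add: Epol_def)

lemma not_involves_Epol:
  fixes s :: "'n::{finite,linorder} list"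
  assumes "distinct s"
  shows "\<not> involves (Epol s l) l"
proof (cases "l \<in> set s")
  case True
  then obtain i where i: "i \<in> {1..length s}" "l = entry s i" by (rule entryE)
  show ?thesis
  proof (cases "i = length s")
    case True
    then have "Epol s l = Ppol s i" unfolding i(2) Epol_entry[OF assms i(1)] Epol_in_def by simp
    also have "\<dots> = (\<Prod>r = 1..i - 1. polA (entry s r)) * (\<Prod>\<rho>\<in>- set s. polX \<rho>) + polA (entry s i) * Ypol s (i - 1)"
      using True by (subst Ppol.simps) simp
    finally show ?thesis unfolding i(2)
      by (simp only:) (intro involves_add involves_mult involves_Xprod involves_Aprod involves_Ypol entry_in_set
          involves_pconst; use i assms in auto)
  next
    case False
    then show ?thesis unfolding i(2) Epol_entry[OF assms i(1)] Epol_in_def if_not_P[OF False]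
      by (intro involves_add involves_mult involves_power involves_prod[of "{i + 2..length s}"] involves_Ppol
          involves_Xprod involves_Aprod involves_Ypol involves_Cpol; use i assms in auto)
  qed
next
  case False
  have "\<not> involves (\<Prod>\<rho>\<in>- set s - {l}. polX \<rho> :: 'n pol) l" by (rule involves_prod) auto
  moreover have "\<not> involves (Ypol s (length s)) l"
  proof (cases "s = []")
    case False
    then have "entry s (length s) \<in> set s" by (intro entry_in_set) (cases s, auto)
    then show ?thesis using False \<open>l \<notin> set s\<close> by (auto simp: Ypol_pos)
  qed simp
  ultimately show ?thesis unfolding Epol_notin[OF False]
    by (intro involves_add involves_mult involves_Aprod) auto
qed

text \<open>Of the created variables only the last one enters E_l for unmutated l. Setting an
  earlier one to 0 therefore leaves E_l unchanged.\<close>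

lemma not_involves_Epol_other:
  fixes s :: "'n::{finite,linorder} list"
  assumes "distinct s" "i \<in> {1..length s}" "i \<noteq> length s" "l \<notin> set s"
  shows "\<not> involves (Epol s l) (entry s i)"
proof -
  have "entry s i \<in> set s" using assms by (intro entry_in_set)
  then have "\<not> involves (\<Prod>\<rho>\<in>- set s - {l}. polX \<rho> :: 'n pol) (entry s i)"
    by (intro involves_prod) auto
  then show ?thesis unfolding Epol_notin[OF assms(4)] using assms
    by (intro involves_add involves_mult involves_Aprod involves_Ypol) auto
qed

subsection \<open>Integer points\<close>

lemma Ev_Ypol: "Ev \<alpha> z (Ypol s r) = (if r = 0 then 1 else z (entry s r))"
  by (simp add: Ypol_def)

lemma Ev_Cpol: "Ev \<alpha> z (Cpol s i) = (\<Prod>r = i + 2..length s. Ev \<alpha> z (Ypol s r) ^ (2 ^ (r - i - 1)))"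
  by (simp add: Cpol_def)

lemma Ypol_point:
  fixes z :: "'n::{finite,linorder} \<Rightarrow> int"
  assumes "\<And>l. l \<in> set s \<Longrightarrow> P (z l)" "P 1" "r \<le> length s"
  shows "P (Ev \<alpha> z (Ypol s r))"
proof (cases "r = 0")
  case False
  then have "entry s r \<in> set s" using assms(3) by (intro entry_in_set) auto
  then have "P (z (entry s r))" by (rule assms(1))
  then show ?thesis using False by (simp add: Ev_Ypol)
qed (simp add: assms(2))

lemma Cpol_point_nonneg:
  fixes z :: "'n::{finite,linorder} \<Rightarrow> int"
  assumes "\<And>l. 0 \<le> z l"
  shows "0 \<le> Ev \<alpha> z (Cpol s i)"
  unfolding Ev_Cpol by (intro prod_nonneg zero_le_power) (simp add: Ev_Ypol assms)

lemma Cpol_point_ge_1: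
  fixes z :: "'n::{finite,linorder} \<Rightarrow> int"
  assumes "\<And>l. l \<in> set s \<Longrightarrow> 1 \<le> z l"
  shows "1 \<le> Ev \<alpha> z (Cpol s i)"
  unfolding Ev_Cpol by (intro prod_ge_1 one_le_power Ypol_point[where P = "\<lambda>x. 1 \<le> x"]) (use assms in auto)

text \<open>Neither summand is ever negative. Positive unmutated variables make the first at least
  1, positive created variables the second. Setting a single variable to 0 always preserves one of
  these alternatives.\<close>

lemma Ppol_point:
  fixes z :: "'n::{finite,linorder} \<Rightarrow> int"
  assumes z: "\<And>l. 0 \<le> z l" "(\<forall>l\<in>-set s. 1 \<le> z l) \<or> (\<forall>l\<in>set s. 1 \<le> z l)"
  shows "i \<in> {1..length s} \<Longrightarrow> 1 \<le> Ev (\<lambda>_. 1) z (Ppol s i)"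
  using z
proof (induction s i rule: Ppol.induct)
  case (1 s i)
  let ?X = "\<Prod>\<rho>\<in>-set s. z \<rho>"
  have X0: "0 \<le> ?X" using 1(3) by (intro prod_nonneg) auto
  have X1: "1 \<le> ?X" if "\<forall>l\<in>-set s. 1 \<le> z l" using that by (intro prod_ge_1) auto
  have Y0: "0 \<le> Ev (\<lambda>_. 1) z (Ypol s r)" for r using 1(3) by (simp add: Ev_Ypol)
  have Y1: "1 \<le> Ev (\<lambda>_. 1) z (Ypol s r)" if "\<forall>l\<in>set s. 1 \<le> z l" "r \<le> length s" for r
    using that by (intro Ypol_point[where P = "\<lambda>x. 1 \<le> x"]) auto
  show ?case
  proof (cases "length s \<le> i")
    case True
    then have "Ev (\<lambda>_. 1) z (Ppol s i) = ?X + Ev (\<lambda>_. 1) z (Ypol s (i - 1))"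
      by (subst Ppol.simps) simp
    then show ?thesis using X0 X1 Y0[of "i - 1"] Y1[of "i - 1"] 1(2,4) by fastforce
  next
    case False
    let ?P = "\<Prod>r = i + 1..length s. Ev (\<lambda>_. 1) z (Ppol s r)"
    let ?Y = "Ev (\<lambda>_. 1) z (Ypol s (i - 1)) * Ev (\<lambda>_. 1) z (Ypol s (i + 1)) * Ev (\<lambda>_. 1) z (Cpol s i)"
    have P: "1 \<le> ?P" by (intro prod_ge_1 1(1)[OF False]) (use 1(2-) in auto)
    have "Ev (\<lambda>_. 1) z (Ppol s i) = ?X * ?P + ?Y"
      using False by (subst Ppol.simps) simp
    moreover have "0 \<le> ?X * ?P" "0 \<le> ?Y"
      using X0 P Y0 Cpol_point_nonneg[of z "\<lambda>_. 1" s i] 1(3) by auto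
    moreover have "1 \<le> ?X * ?P \<or> 1 \<le> ?Y"
      using 1(4)
    proof
      assume "\<forall>l\<in>-set s. 1 \<le> z l"
      then show ?thesis using mult_mono[OF X1 P] X0 by auto
    next
      assume *: "\<forall>l\<in>set s. 1 \<le> z l"
      have "1 * 1 * 1 \<le> ?Y"
        by (intro mult_mono Y1[OF *] Cpol_point_ge_1 mult_nonneg_nonneg Y0) (use * False 1(2) in auto)
      then show ?thesis by simp
    qed
    ultimately show ?thesis by linarith
  qed
qed

section \<open>Explicit forms according to the position of the index\<close>

lemma Ppol_last:
  "length s \<le> i \<Longrightarrow> Ppol s i = (\<Prod>r = 1..i - 1. polA (entry s r)) * (\<Prod>\<rho>\<in>- set s. polX \<rho>)
     + polA (entry s i) * Ypol s (i - 1)"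
  by (subst Ppol.simps) simp

lemma Ppol_inner:
  "i < length s \<Longrightarrow> Ppol s i =
     (\<Prod>r = 1..i - 1. polA (entry s r)) * (\<Prod>\<rho>\<in>- set s. polX \<rho>) * (\<Prod>r = i + 1..length s. Ppol s r)
       + polA (entry s i) * Ypol s (i - 1) * Ypol s (i + 1) * Cpol s i"
  by (subst Ppol.simps) simp

lemma Epol_last:
  assumes "distinct s" "s \<noteq> []"
  shows "Epol s (entry s (length s)) = (\<Prod>r = 1..length s - 1. polA (entry s r)) * (\<Prod>\<rho>\<in>- set s. polX \<rho>)
     + polA (entry s (length s)) * Ypol s (length s - 1)"
proof -
  have "length s \<in> {1..length s}" using assms(2) by (cases s) auto
  from Epol_entry[OF assms(1) this] show ?thesis by (simp add: Epol_in_def Ppol_last)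
qed

lemma Epol_inner:
  assumes "distinct s" "1 \<le> i" "i < length s"
  shows "Epol s (entry s i) =
    (\<Prod>r = 1..i - 1. polA (entry s r))\<^sup>2 * (\<Prod>\<rho>\<in>- set s. polX \<rho>)\<^sup>2 * (\<Prod>r = i + 2..length s. Ppol s r)\<^sup>2
          + Ypol s (i - 1) * Ypol s (i + 1) * Cpol s i"
  using Epol_entry[of s i] assms by (simp add: Epol_in_def)

lemma activation_cases [case_names notin last inner]:
  assumes "l \<notin> set s \<Longrightarrow> thesis"
    "s \<noteq> [] \<Longrightarrow> l = entry s (length s) \<Longrightarrow> thesis"
    "\<And>i. 1 \<le> i \<Longrightarrow> i < length s \<Longrightarrow> l = entry s i \<Longrightarrow> thesis"
  shows thesis
proof (cases "l \<in> set s")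
  case True
  then obtain i where i: "i \<in> {1..length s}" "l = entry s i" by (rule entryE)
  show ?thesis
  proof (cases "i = length s")
    case True
    with i assms(2) show ?thesis by (cases s) auto
  next
    case False
    with i assms(3)[of i] show ?thesis by auto
  qed
qed (use assms(1) in blast)

lemma Ypol_point_1:
  fixes z :: "'n::{finite,linorder} \<Rightarrow> int"
  shows "(\<And>l. l \<in> set s \<Longrightarrow> z l = 1) \<Longrightarrow> r \<le> length s \<Longrightarrow> Ev \<alpha> z (Ypol s r) = 1"
  by (rule Ypol_point[where P = "\<lambda>x. x = 1"]) auto

lemma Cpol_point_1:
  fixes z :: "'n::{finite,linorder} \<Rightarrow> int"
  shows "(\<And>l. l \<in> set s \<Longrightarrow> z l = 1) \<Longrightarrow> Ev \<alpha> z (Cpol s i) = 1"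
  unfolding Ev_Cpol by (intro prod.neutral ballI) (simp add: Ypol_point_1)

text \<open>Put X_l = 0 and everything else 1. If l has been mutated, the first summand stays
  positive for mutated j other than the last and for unmutated j; if not, the second summand does.
  \<open>Ppol_point\<close> covers the last index.\<close>

lemma polX_not_dvd_Epol:
  fixes s :: "'n::{finite,linorder} list"
  assumes "distinct s"
  shows "\<not> polX l dvd Epol s j"
proof (rule not_dvd_if_Ev[where \<alpha> = "\<lambda>_. 1 :: int"])
  define z where "z = (\<lambda>_. 1 :: int)(l := 0)"
  show "Ev (\<lambda>_. 1 :: int) z (polX l) = 0" by (simp add: z_def)
  have z0: "0 \<le> z m" for m by (simp add: z_def)
  have z1: "(\<forall>m\<in>-set s. 1 \<le> z m) \<or> (\<forall>m\<in>set s. 1 \<le> z m)" by (auto simp: z_def)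
  have Y0: "0 \<le> Ev (\<lambda>_. 1) z (Ypol s r)" for r by (simp add: Ev_Ypol z0)
  have "1 \<le> Ev (\<lambda>_. 1) z (Epol s j)"
  proof (cases j s rule: activation_cases)
    case notin
    have "0 \<le> (\<Prod>\<rho>\<in>- set s - {j}. z \<rho>)" by (intro prod_nonneg) (simp add: z0)
    moreover have "1 \<le> (\<Prod>\<rho>\<in>- set s - {j}. z \<rho>)" if "l \<in> set s"
      by (intro prod_ge_1) (use that in \<open>auto simp: z_def\<close>)
    moreover have "Ev (\<lambda>_. 1) z (Ypol s (length s)) = 1" if "l \<notin> set s"
      by (rule Ypol_point_1) (use that in \<open>auto simp: z_def\<close>)
    ultimately show ?thesis using Y0[of "length s"] unfolding Epol_notin[OF notin] by (cases "l \<in> set s") auto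
  next
    case last
    have k: "length s \<in> {1..length s}" using last by (cases s) auto
    then have "Epol s j = Ppol s (length s)" unfolding last(2) Epol_entry[OF assms k] by (simp add: Epol_in_def)
    then show ?thesis using Ppol_point[OF z0 z1 k] by simp
  next
    case (inner i)
    let ?X = "\<Prod>\<rho>\<in>-set s. z \<rho>" and ?P = "\<Prod>r = i + 2..length s. Ev (\<lambda>_. 1) z (Ppol s r)"
    let ?Y = "Ev (\<lambda>_. 1) z (Ypol s (i - 1)) * Ev (\<lambda>_. 1) z (Ypol s (i + 1)) * Ev (\<lambda>_. 1) z (Cpol s i)"
    have E: "Ev (\<lambda>_. 1) z (Epol s j) = ?X\<^sup>2 * ?P\<^sup>2 + ?Y"
      unfolding inner(3) Epol_inner[OF assms inner(1,2)] by simp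
    have Yn: "0 \<le> ?Y" using Y0 Cpol_point_nonneg[of z "\<lambda>_. 1" s i] z0 by simp
    show ?thesis
    proof (cases "l \<in> set s")
      case True
      have "?X = 1" by (intro prod.neutral) (use True in \<open>auto simp: z_def\<close>)
      moreover have "1 \<le> ?P" by (intro prod_ge_1 Ppol_point[OF z0 z1]) auto
      then have "1 \<le> ?P\<^sup>2" by (rule one_le_power)
      ultimately show ?thesis unfolding E using Yn by simp
    next
      case False
      then have z_s: "\<And>m. m \<in> set s \<Longrightarrow> z m = 1" by (auto simp: z_def)
      have "?Y = 1" using inner by (simp add: Ypol_point_1[OF z_s] Cpol_point_1[OF z_s])
      then show ?thesis unfolding E by simp
    qed
  qed
  then show "Ev (\<lambda>_. 1) z (Epol s j) \<noteq> 0" by simp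
qed

text \<open>X_\<sigma> kills the first summand and the second is 1. As the value at the all-one
  point is at least 2, E_j does depend on X_\<sigma>; the same gap later shows that E_j cannot
  divide E_\<sigma>.\<close>

lemma Epol_point_0:
  fixes s :: "'n::{finite,linorder} list"
  assumes "distinct s" "\<sigma> \<notin> set s" "j \<noteq> \<sigma>"
  shows "Ev (\<lambda>_. 1 :: int) ((\<lambda>_. 1)(\<sigma> := 0)) (Epol s j) = 1"
proof -
  define z where "z = (\<lambda>_. 1 :: int)(\<sigma> := 0)"
  have Y: "Ev (\<lambda>_. 1) z (Ypol s r) = 1" if "r \<le> length s" for r
    by (rule Ypol_point_1) (use that assms in \<open>auto simp: z_def\<close>)
  have C: "Ev (\<lambda>_. 1) z (Cpol s i) = 1" for i
    by (rule Cpol_point_1) (use assms in \<open>auto simp: z_def\<close>)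
  have X: "(\<Prod>\<rho>\<in>B. z \<rho>) = 0" if "\<sigma> \<in> B" for B
    by (rule prod_zero) (use that in \<open>auto simp: z_def intro!: bexI[of _ \<sigma>]\<close>)
  have "Ev (\<lambda>_. 1) z (Epol s j) = 1"
  proof (cases j s rule: activation_cases)
    case notin
    then show ?thesis using assms by (simp add: Epol_notin X Y)
  next
    case last
    show ?thesis unfolding last(2) Epol_last[OF assms(1) last(1)] using assms by (simp add: X Y)
  next
    case (inner i)
    then show ?thesis unfolding inner(3) Epol_inner[OF assms(1) inner(1,2)] using assms by (simp add: X Y C)
  qed
  then show ?thesis by (simp add: z_def)
qed

lemma Epol_point_1:
  fixes s :: "'n::{finite,linorder} list"
  assumes "distinct s"
  shows "2 \<le> Ev (\<lambda>_. 1 :: int) (\<lambda>_. 1) (Epol s j)"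
proof -
  have Y: "Ev (\<lambda>_. 1 :: int) (\<lambda>_. 1) (Ypol s r) = 1" if "r \<le> length s" for r
    by (rule Ypol_point_1) (use that in auto)
  have C: "Ev (\<lambda>_. 1 :: int) (\<lambda>_. 1) (Cpol s i) = 1" for i
    by (rule Cpol_point_1) auto
  show ?thesis
  proof (cases j s rule: activation_cases)
    case notin
    then show ?thesis using assms by (simp add: Epol_notin Y)
  next
    case last
    show ?thesis unfolding last(2) Epol_last[OF assms(1) last(1)] by (simp add: Y)
  next
    case (inner i)
    have "1 \<le> (\<Prod>r = i + 2..length s. Ev (\<lambda>_. 1 :: int) (\<lambda>_. 1) (Ppol s r))"
      by (intro prod_ge_1 Ppol_point) auto
    then have "1 \<le> (\<Prod>r = i + 2..length s. Ev (\<lambda>_. 1 :: int) (\<lambda>_. 1) (Ppol s r))\<^sup>2" by (rule one_le_power)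
    then show ?thesis using inner unfolding inner(3) Epol_inner[OF assms(1) inner(1,2)] by (simp add: Y C)
  qed
qed

lemma involves_Epol:
  fixes s :: "'n::{finite,linorder} list"
  assumes "distinct s" "\<sigma> \<notin> set s" "j \<noteq> \<sigma>"
  shows "involves (Epol s j) \<sigma>"
proof (rule ccontr)
  assume "\<not> involves (Epol s j) \<sigma>"
  from Ev_upd[OF this, of "\<lambda>_. 1 :: int" "\<lambda>_. 1" 0] show False
    using Epol_point_0[OF assms] Epol_point_1[OF assms(1), of j] by simp
qed

section \<open>Substitution along a mutation\<close>

lemma entry_snoc: "1 \<le> r \<Longrightarrow> r \<le> length s \<Longrightarrow> entry (s @ [\<sigma>]) r = entry s r"
  by (auto simp: nth_append)

lemma Aprod_snoc:
  "i \<le> length s \<Longrightarrow> (\<Prod>r = 1..i. polA (entry (s @ [\<sigma>]) r)) = (\<Prod>r = 1..i. polA (entry s r))"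
  by (intro prod.cong refl) (simp add: entry_snoc del: One_nat_def)

lemma Xprod_snoc:
  fixes f :: "'n::finite \<Rightarrow> 'a::comm_monoid_mult"
  assumes "\<sigma> \<notin> set s"
  shows "(\<Prod>\<rho>\<in>- set s. f \<rho>) = f \<sigma> * (\<Prod>\<rho>\<in>- set (s @ [\<sigma>]). f \<rho>)"
proof -
  have "- set s - {\<sigma>} = - set (s @ [\<sigma>])" by auto
  then show ?thesis using prod.remove[of "- set s" \<sigma> f] assms by simp
qed

lemma Ypol_snoc: "r \<le> length s \<Longrightarrow> Ypol (s @ [\<sigma>]) r = Ypol s r"
  by (auto simp: Ypol_def nth_append)

lemma Ypol_snoc_last: "Ypol (s @ [\<sigma>]) (Suc (length s)) = polX \<sigma>"
  by (simp add: Ypol_def)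

text \<open>The new index is r = k + 1 with k = \<open>length s\<close>, and its exponent 2^(r - i -
  1) = 2^(k - i) is the power of X_\<sigma> that clears the denominator of P_{s_i}.\<close>

lemma Cpol_snoc:
  assumes "i < length s"
  shows "Cpol (s @ [\<sigma>]) i = Cpol s i * polX \<sigma> ^ (2 ^ (length s - i))"
proof -
  have "{i + 2..length (s @ [\<sigma>])} = insert (Suc (length s)) {i + 2..length s}" using assms by auto
  then have "Cpol (s @ [\<sigma>]) i = Ypol (s @ [\<sigma>]) (Suc (length s)) ^ (2 ^ (Suc (length s) - i - 1)) *
      (\<Prod>r = i + 2..length s. Ypol (s @ [\<sigma>]) r ^ (2 ^ (r - i - 1)))"
    unfolding Cpol_def by simp
  also have "(\<Prod>r = i + 2..length s. Ypol (s @ [\<sigma>]) r ^ (2 ^ (r - i - 1))) = Cpol s i"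
    unfolding Cpol_def by (intro prod.cong refl) (simp add: Ypol_snoc)
  finally show ?thesis by (simp add: Ypol_snoc_last mult.commute)
qed

lemma Cpol_last [simp]: "length s \<le> i + 1 \<Longrightarrow> Cpol s i = 1"
  by (simp add: Cpol_def)

text \<open>The formula for an unmutated index over \<open>s\<close> is the formula for the last
  index over \<open>s @ [\<sigma>]\<close>. This matches the rule that F_\<sigma>, being free of
  X_\<sigma>, is kept by the mutation at \<sigma>.\<close>

lemma Epol_snoc_new:
  fixes s :: "'n::{finite,linorder} list"
  assumes "distinct s" "\<sigma> \<notin> set s"
  shows "Ppol (s @ [\<sigma>]) (Suc (length s)) = Epol s \<sigma>" "Epol (s @ [\<sigma>]) \<sigma> = Epol s \<sigma>"
proof -
  have X: "- set (s @ [\<sigma>]) = - set s - {\<sigma>}" by auto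
  show P: "Ppol (s @ [\<sigma>]) (Suc (length s)) = Epol s \<sigma>"
    using Aprod_snoc[of "length s" s \<sigma>] unfolding Epol_notin[OF assms(2)]
    by (subst Ppol_last) (simp_all only: X, simp_all add: Ypol_snoc)
  have "Epol (s @ [\<sigma>]) (entry (s @ [\<sigma>]) (Suc (length s))) = Epol_in (s @ [\<sigma>]) (Suc (length s))"
    by (rule Epol_entry) (use assms in auto)
  then show "Epol (s @ [\<sigma>]) \<sigma> = Epol s \<sigma>" by (simp add: Epol_in_def P)
qed

text \<open>The exponents add up: 2^(k - a) is 1 plus the sum of 2^(k - r) over a < r \<le> k. The
  extra 1 clears \<open>z' \<sigma>\<close>, leaving E_\<sigma>, which is the factor P of index k +
  1 in the longer sequence.\<close>

lemma Ppol_snoc_prod: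
  fixes z z' :: "'n::{finite,linorder} \<Rightarrow> 'n ratfun"
  assumes s: "distinct s" "\<sigma> \<notin> set s" and z: "z \<sigma> \<noteq> 0" "z' \<sigma> = ev z (Epol s \<sigma>) / z \<sigma>"
    and P: "\<And>r. r \<in> {a + 1..length s} \<Longrightarrow>
      z \<sigma> ^ (2 ^ (length s - r)) * ev z' (Ppol s r) = ev z (Ppol (s @ [\<sigma>]) r)" and a: "a \<le> length s"
  shows "z \<sigma> ^ (2 ^ (length s - a)) * (z' \<sigma> * (\<Prod>r = a + 1..length s. ev z' (Ppol s r)))
    = (\<Prod>r = a + 1..Suc (length s). ev z (Ppol (s @ [\<sigma>]) r))"
  using a P
proof (induction "length s - a" arbitrary: a)
  case 0
  then have "a = length s" by simp
  then show ?case using z by (simp add: Epol_snoc_new[OF s])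
next
  case (Suc d)
  then have d: "d = length s - Suc a" "Suc a \<le> length s" and la: "length s - a = Suc (length s - Suc a)" by auto
  let ?f = "\<lambda>r. ev z' (Ppol s r)" and ?f' = "\<lambda>r. ev z (Ppol (s @ [\<sigma>]) r)"
  have IH: "z \<sigma> ^ (2 ^ (length s - Suc a)) * (z' \<sigma> * prod ?f {Suc a + 1..length s}) = prod ?f' {Suc a + 1..Suc (length s)}"
    by (rule Suc(1)[OF d]) (use Suc(4) in auto)
  have f: "prod ?f {a + 1..length s} = ?f (Suc a) * prod ?f {Suc a + 1..length s}"
    using d(2) by (simp add: prod.atLeast_Suc_atMost)
  have f': "prod ?f' {a + 1..Suc (length s)} = ?f' (Suc a) * prod ?f' {Suc a + 1..Suc (length s)}"
    using d(2) by (simp add: prod.atLeast_Suc_atMost)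
  have P: "z \<sigma> ^ (2 ^ (length s - Suc a)) * ?f (Suc a) = ?f' (Suc a)"
    by (rule Suc(4)) (use d(2) in auto)
  have "z \<sigma> ^ (2 ^ (length s - a)) = z \<sigma> ^ (2 ^ (length s - Suc a)) * z \<sigma> ^ (2 ^ (length s - Suc a))"
    unfolding la by (simp add: power_add[symmetric] mult_2)
  then show ?case unfolding f f' IH[symmetric] P[symmetric] by (simp add: mult_ac)
qed

lemma involves_Ypol_notin:
  assumes "\<sigma> \<notin> set s" "r \<le> length s"
  shows "\<not> involves (Ypol s r) \<sigma>"
proof (cases "r = 0")
  case False
  then have "entry s r \<in> set s" using assms(2) by (intro entry_in_set) auto
  then have "\<sigma> \<noteq> entry s r" using assms(1) by metis
  then show ?thesis using False by (simp add: Ypol_pos)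
qed simp

lemma involves_Cpol_notin:
  fixes s :: "'n::{finite,linorder} list"
  assumes "\<sigma> \<notin> set s"
  shows "\<not> involves (Cpol s i) \<sigma>"
  unfolding Cpol_def by (intro involves_prod involves_power involves_Ypol_notin[OF assms]) auto

text \<open>The induction runs downwards in i, since P_{s_i} is built from later ones. In the first
  summand the power of X_\<sigma> is used up by the product; in the second it becomes the new factor
  of C, or Y_{k+1} when i = k.\<close>

lemma Ppol_snoc:
  fixes z :: "'n::{finite,linorder} \<Rightarrow> 'n ratfun"
  assumes s: "distinct s" "\<sigma> \<notin> set s" and z: "z \<sigma> \<noteq> 0"
  defines "z' \<equiv> z(\<sigma> := ev z (Epol s \<sigma>) / z \<sigma>)"
  shows "i \<in> {1..length s} \<Longrightarrow> z \<sigma> ^ (2 ^ (length s - i)) * ev z' (Ppol s i) = ev z (Ppol (s @ [\<sigma>]) i)"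
proof (induction "length s - i" arbitrary: i rule: less_induct)
  case less
  let ?k = "length s"
  have X: "(\<Prod>\<rho>\<in>- set (s @ [\<sigma>]). z' \<rho>) = (\<Prod>\<rho>\<in>- set (s @ [\<sigma>]). z \<rho>)"
    by (rule prod.cong) (auto simp: z'_def)
  have Y: "ev z' (Ypol s r) = ev z (Ypol (s @ [\<sigma>]) r)" if "r \<le> ?k" for r
    unfolding Ypol_snoc[OF that] z'_def by (rule ev_upd[OF involves_Ypol_notin[OF s(2) that]])
  have C: "ev z' (Cpol s i) = ev z (Cpol s i)"
    unfolding z'_def by (rule ev_upd[OF involves_Cpol_notin[OF s(2)]])
  have A: "(\<Prod>r = 1..i - 1. polA (entry (s @ [\<sigma>]) r)) = (\<Prod>r = 1..i - 1. polA (entry s r))"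
    using less(2) by (intro Aprod_snoc) auto
  have e: "entry (s @ [\<sigma>]) i = entry s i" using less(2) by (intro entry_snoc) auto
  have PP: "z \<sigma> ^ (2 ^ (?k - i)) * (z' \<sigma> * (\<Prod>r = i + 1..?k. ev z' (Ppol s r)))
    = (\<Prod>r = i + 1..Suc ?k. ev z (Ppol (s @ [\<sigma>]) r))"
  proof (rule Ppol_snoc_prod[OF s, of z, OF z])
    show "z' \<sigma> = ev z (Epol s \<sigma>) / z \<sigma>" by (simp add: z'_def)
    show "z \<sigma> ^ (2 ^ (?k - r)) * ev z' (Ppol s r) = ev z (Ppol (s @ [\<sigma>]) r)" if "r \<in> {i + 1..?k}" for r
      by (rule less(1)) (use that less(2) in auto)
    show "i \<le> ?k" using less(2) by simp
  qed
  have inner': "Ppol (s @ [\<sigma>]) i = (\<Prod>r = 1..i - 1. polA (entry s r)) * (\<Prod>\<rho>\<in>- set (s @ [\<sigma>]). polX \<rho>) *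
      (\<Prod>r = i + 1..Suc ?k. Ppol (s @ [\<sigma>]) r)
      + polA (entry s i) * Ypol (s @ [\<sigma>]) (i - 1) * Ypol (s @ [\<sigma>]) (i + 1) * Cpol (s @ [\<sigma>]) i"
    using less(2) A e by (subst Ppol_inner) simp_all
  define a where "a = (\<Prod>r = 1..i - 1. embc (mvar (entry s r)))"
  define x where "x = (\<Prod>\<rho>\<in>- set (s @ [\<sigma>]). z \<rho>)"
  define p' where "p' = (\<Prod>r = i + 1..Suc ?k. ev z (Ppol (s @ [\<sigma>]) r))"
  have R: "ev z (Ppol (s @ [\<sigma>]) i) = a * x * p' + embc (mvar (entry s i)) * ev z (Ypol (s @ [\<sigma>]) (i - 1)) *
      ev z (Ypol (s @ [\<sigma>]) (i + 1)) * ev z (Cpol (s @ [\<sigma>]) i)"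
    unfolding inner' a_def x_def p'_def by simp
  show ?case
  proof (cases "i = ?k")
    case True
    \<comment> \<open>Here the power is X_\<sigma>^1, and it supplies the factor Y_{k+1} that the
      last polynomial of the shorter sequence lacks.\<close>
    have "ev z' (Ppol s i) = a * (z' \<sigma> * x) + embc (mvar (entry s i)) * ev z (Ypol (s @ [\<sigma>]) (i - 1))"
      using Y[of "i - 1"] True unfolding Ppol_last[OF eq_refl[OF True[symmetric]]] a_def x_def X[symmetric]
      by (simp add: Xprod_snoc[OF s(2), of z'])
    then show ?thesis unfolding R using PP True
      by (simp add: p'_def Ypol_snoc_last algebra_simps)
  next
    case False
    define p where "p = (\<Prod>r = i + 1..?k. ev z' (Ppol s r))"
    have i: "i < ?k" using less(2) False by auto
    have "ev z' (Ppol s i) = a * (z' \<sigma> * x) * p + embc (mvar (entry s i)) * ev z (Ypol (s @ [\<sigma>]) (i - 1)) *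
        ev z (Ypol (s @ [\<sigma>]) (i + 1)) * ev z (Cpol s i)"
      using Y[of "i - 1"] Y[of "i + 1"] i unfolding Ppol_inner[OF i] a_def x_def p_def X[symmetric]
      by (simp add: Xprod_snoc[OF s(2), of z'] C)
    moreover have "ev z (Cpol (s @ [\<sigma>]) i) = ev z (Cpol s i) * z \<sigma> ^ (2 ^ (?k - i))"
      unfolding Cpol_snoc[OF i] by simp
    moreover have "z \<sigma> ^ (2 ^ (?k - i)) * (z' \<sigma> * p) = p'" using PP by (simp add: p_def p'_def)
    ultimately show ?thesis unfolding R by (simp add: algebra_simps)
  qed
qed

text \<open>One mutation at \<open>\<sigma>\<close> as seen from \<open>j\<close>: \<open>xmon m * prod_list Q\<close> is \<open>\<hat>F\<^sub>\<sigma>\<close> at \<open>X\<^sub>j = 0\<close>, factored into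
  primes, \<open>M\<close> is the degree of \<open>F\<^sub>j\<close> in \<open>X\<^sub>\<sigma>\<close>, and \<open>xmon mc * d\<close> is what is divided out.\<close>

definition exchange_data ::
    "'n::{finite,linorder} list \<Rightarrow> 'n \<Rightarrow> 'n \<Rightarrow> 'n pol list \<Rightarrow> ('n \<Rightarrow> nat) \<Rightarrow> ('n \<Rightarrow> nat) \<Rightarrow> 'n pol \<Rightarrow> nat \<Rightarrow> bool"
  where "exchange_data s \<sigma> j Q m mc d M \<longleftrightarrow>
    (\<forall>z. ev (z(j := 0)) (Epol s \<sigma>) = ev z (xmon m * prod_list Q)) \<and>
    (\<forall>z. z \<sigma> \<noteq> 0 \<longrightarrow> z \<sigma> ^ M * ev (z(\<sigma> := ev z (xmon m * prod_list Q) / z \<sigma>)) (Epol s j) =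
       ev z (xmon mc * d) * ev z (Epol (s @ [\<sigma>]) j)) \<and>
    m \<sigma> = 0 \<and> mc \<sigma> = 0 \<and> mc j = 0 \<and> (d = 1 \<or> d \<in> set Q) \<and> \<not> Epol s j dvd xmon mc * d \<and>
    (\<forall>q\<in>set Q. prime_elem q \<and> (\<forall>l. \<not> polX l dvd q) \<and> \<not> involves q \<sigma> \<and> \<not> involves q j \<and>
       \<not> q dvd Epol (s @ [\<sigma>]) j)"

section \<open>The exchange data in the three cases\<close>

lemma Ypol_xmon:
  fixes s :: "'n::{finite,linorder} list"
  shows "Ypol s r = xmon (\<lambda>l. if r \<noteq> 0 \<and> l = entry s r then 1 else 0)"
  by (cases "r = 0") (simp_all add: xmon_def Ypol_def if_distrib[of "\<lambda>k. _ ^ k"] cong: if_cong)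

lemma xmon_0 [simp]: "xmon (\<lambda>_. 0) = 1"
  by (simp add: xmon_def)

lemma Xprod_xmon: "(\<Prod>\<rho>\<in>B. polX \<rho>) = xmon (\<lambda>l. if l \<in> B then 1 else 0)"
proof -
  have "xmon (\<lambda>l. if l \<in> B then 1 else 0) = (\<Prod>l\<in>UNIV. if l \<in> B then polX l else 1)"
    unfolding xmon_def by (intro prod.cong) auto
  then show ?thesis by (simp add: prod.If_cases)
qed

lemma polX_not_dvd_polA: "\<not> polX l dvd (polA i :: 'n::{finite,linorder} pol)"
  by (rule not_dvd_if_Ev[where \<alpha> = "\<lambda>_. 1 :: int" and z = "(\<lambda>_. 1)(l := 0)"]) auto

lemma entry_last_in_set: "s \<noteq> [] \<Longrightarrow> entry s (length s) \<in> set s"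
  by (rule entry_in_set) (cases s, auto)

text \<open>The two summands are 1 and A_j at this point, so they cancel for A_j = -1. The zero
  refutes divisibility by E_j of anything that does not vanish there.\<close>

lemma Epol_point_minus_1:
  fixes s :: "'n::{finite,linorder} list"
  assumes "distinct s" "j \<notin> set s \<or> j = entry s (length s)"
  shows "Ev ((\<lambda>_. 1 :: int)(j := - 1)) (\<lambda>_. 1) (Epol s j) = 0"
proof -
  let ?\<alpha> = "(\<lambda>_. 1 :: int)(j := - 1)"
  have Y: "Ev ?\<alpha> (\<lambda>_. 1) (Ypol s r) = 1" for r by (simp add: Ev_Ypol)
  show ?thesis
  proof (cases "j \<in> set s")
    case True
    then have j: "j = entry s (length s)" "s \<noteq> []" using assms(2) by auto
    have "(\<Prod>r = 1..length s - 1. ?\<alpha> (entry s r)) = 1"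
    proof (intro prod.neutral ballI)
      fix r assume r: "r \<in> {1..length s - 1}"
      then have "r < length s" using j(2) by (cases s) auto
      then have "entry s r \<noteq> j" using entry_eq_iff[OF assms(1), of r "length s"] r j by auto
      then show "?\<alpha> (entry s r) = 1" by simp
    qed
    then show ?thesis unfolding Epol_last[OF assms(1) j(2), folded j(1)] by (simp add: Y)
  next
    case False
    have "(\<Prod>r = 1..length s. ?\<alpha> (entry s r)) = 1"
    proof (intro prod.neutral ballI)
      fix r assume r: "r \<in> {1..length s}"
      have "entry s r \<noteq> j" using entry_in_set[OF r] False by auto
      then show "?\<alpha> (entry s r) = 1" by simp
    qed
    then show ?thesis unfolding Epol_notin[OF False] by (simp add: Y)
  qed
qed

text \<open>The first summand receives Y_s from g = A_\<sigma> Y_s, and the second already contains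
  it. Hence only this monomial is split off: \<open>mc = m\<close> and \<open>d = 1\<close>.\<close>

lemma exchange_data_notin:
  fixes s :: "'n::{finite,linorder} list"
  assumes s: "distinct s" "\<sigma> \<notin> set s" and j: "j \<notin> set s" "j \<noteq> \<sigma>"
  defines "m \<equiv> \<lambda>l. if length s \<noteq> 0 \<and> l = entry s (length s) then 1 else 0"
  shows "exchange_data s \<sigma> j [polA \<sigma>] m m 1 1"
proof -
  have Y: "xmon m = Ypol s (length s)" unfolding Ypol_xmon m_def ..
  have m0: "m l = 0" if "l \<notin> set s" for l using that entry_last_in_set[of s] by (auto simp: m_def)
  have s': "- set (s @ [\<sigma>]) = - set s - {\<sigma>}" by auto
  have j': "j \<notin> set (s @ [\<sigma>])" using j by simp
  let ?A = "\<Prod>r = 1..length s. polA (entry s r) :: 'n pol"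
  have X: "(\<Prod>\<rho>\<in>- set s - {j}. f \<rho>) = f \<sigma> * (\<Prod>\<rho>\<in>- set (s @ [\<sigma>]) - {j}. f \<rho>)" for f :: "'n \<Rightarrow> 'n ratfun"
  proof -
    have "- set s - {j} - {\<sigma>} = - set (s @ [\<sigma>]) - {j}" by auto
    then show ?thesis using prod.remove[of "- set s - {j}" \<sigma> f] s j by simp
  qed
  have E': "Epol (s @ [\<sigma>]) j = ?A * polA \<sigma> * (\<Prod>\<rho>\<in>- set (s @ [\<sigma>]) - {j}. polX \<rho>) + polA j * polX \<sigma>"
    using Aprod_snoc[of "length s" s \<sigma>] unfolding Epol_notin[OF j'] by (simp add: Ypol_snoc_last nth_append)
  show ?thesis unfolding exchange_data_def
  proof (intro conjI allI impI ballI)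
    fix z :: "'n \<Rightarrow> 'n ratfun"
    have "ev (z(j := 0)) (Ypol s (length s)) = ev z (Ypol s (length s))"
      by (rule ev_upd[OF involves_Ypol_notin[OF j(1)]]) simp
    moreover have "(\<Prod>\<rho>\<in>- set s - {\<sigma>}. (z(j := 0)) \<rho>) = 0"
      by (rule prod_zero) (use j in \<open>auto intro!: bexI[of _ j]\<close>)
    ultimately show "ev (z(j := 0)) (Epol s \<sigma>) = ev z (xmon m * prod_list [polA \<sigma>])"
      unfolding Epol_notin[OF s(2)] Y by (simp add: mult.commute)
  next
    fix z :: "'n \<Rightarrow> 'n ratfun" assume z: "z \<sigma> \<noteq> 0"
    define v where "v = ev z (xmon m * prod_list [polA \<sigma>]) / z \<sigma>"
    have Yv: "ev (z(\<sigma> := v)) (Ypol s (length s)) = ev z (Ypol s (length s))"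
      by (rule ev_upd[OF involves_Ypol_notin[OF s(2)]]) simp
    have Xv: "(\<Prod>\<rho>\<in>- set (s @ [\<sigma>]) - {j}. (z(\<sigma> := v)) \<rho>) = (\<Prod>\<rho>\<in>- set (s @ [\<sigma>]) - {j}. z \<rho>)"
      by (rule prod.cong) auto
    have v: "z \<sigma> * v = embc (mvar \<sigma>) * ev z (Ypol s (length s))" using z by (simp add: v_def Y)
    have "ev (z(\<sigma> := v)) (Epol s j) = ev z ?A * (v * (\<Prod>\<rho>\<in>- set (s @ [\<sigma>]) - {j}. z \<rho>))
        + embc (mvar j) * ev z (Ypol s (length s))"
      unfolding Epol_notin[OF j(1)] by (simp only: ev_simps Yv X Xv) simp
    then have "z \<sigma> * ev (z(\<sigma> := v)) (Epol s j) = ev z ?A * (z \<sigma> * v) * (\<Prod>\<rho>\<in>- set (s @ [\<sigma>]) - {j}. z \<rho>)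
        + embc (mvar j) * ev z (Ypol s (length s)) * z \<sigma>"
      by (simp only: algebra_simps)
    also have "\<dots> = ev z (Ypol s (length s)) * ev z (Epol (s @ [\<sigma>]) j)"
      unfolding v E' by (simp only: ev_simps algebra_simps)
    finally show "z \<sigma> ^ 1 * ev (z(\<sigma> := ev z (xmon m * prod_list [polA \<sigma>]) / z \<sigma>)) (Epol s j) =
       ev z (xmon m * 1) * ev z (Epol (s @ [\<sigma>]) j)"
      unfolding v_def Y by simp
  next
    show "\<not> Epol s j dvd xmon m * 1"
      unfolding Y by (rule not_dvd_if_Ev[OF Epol_point_minus_1[OF s(1)]]) (use j in \<open>auto simp: Ev_Ypol\<close>)
  next
    fix q assume "q \<in> set [polA \<sigma> :: 'n pol]"
    then have q: "q = polA \<sigma>" by simp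
    show "prime_elem q" "\<not> polX l dvd q" "\<not> involves q \<sigma>" "\<not> involves q j" for l
      unfolding q by (auto simp: prime_elem_polA polX_not_dvd_polA)
    \<comment> \<open>At A_\<sigma> = 0 only the summand A_j X_\<sigma> survives, with value
      1.\<close>
    show "\<not> q dvd Epol (s @ [\<sigma>]) j" unfolding q E'
      by (rule not_dvd_if_Ev[where \<alpha> = "(\<lambda>_. 1 :: int)(\<sigma> := 0)" and z = "\<lambda>_. 1"]) (use j in auto)
  qed (use m0 s j in auto)
qed

text \<open>Substitution brings a second copy of the products of the A and of the X, together with
  A_j, into the first summand. The second summand contains A_j already, so A_j is divided out. What
  remains is the origin of the squares in E_{s_i}.\<close>

lemma exchange_data_last:
  fixes s :: "'n::{finite,linorder} list"
  assumes s: "distinct s" "\<sigma> \<notin> set s" "s \<noteq> []"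
  defines "j \<equiv> entry s (length s)"
  shows "exchange_data s \<sigma> j (map polA s) (\<lambda>l. if l \<in> - set (s @ [\<sigma>]) then 1 else 0) (\<lambda>_. 0) (polA j) 1"
proof -
  let ?k = "length s"
  have j: "j \<in> set s" using entry_last_in_set[OF s(3)] by (simp add: j_def)
  have k1: "1 \<le> ?k" using s(3) by (cases s) auto
  then have k: "?k \<noteq> 0" by linarith
  have s': "- set (s @ [\<sigma>]) = - set s - {\<sigma>}" by auto
  let ?A = "\<Prod>r = 1..?k - 1. polA (entry s r) :: 'n pol"
  let ?X = "\<Prod>\<rho>\<in>- set (s @ [\<sigma>]). polX \<rho> :: 'n pol"
  have A: "prod_list (map polA s) = ?A * polA j" "(\<Prod>r = 1..?k. polA (entry s r)) = ?A * polA j"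
  proof -
    have "{1..?k} = insert ?k {1..?k - 1}" "?k \<notin> {1..?k - 1}" using k1 by auto
    then show *: "(\<Prod>r = 1..?k. polA (entry s r)) = ?A * polA j" by (simp add: j_def mult.commute)
    show "prod_list (map polA s) = ?A * polA j" 
      using prod_entry[of "polA :: 'n \<Rightarrow> 'n pol" s] unfolding * by simp
  qed
  have Yj: "Ypol s ?k = polX j" using k by (simp add: Ypol_pos j_def)
  have E': "Epol (s @ [\<sigma>]) j = ?A\<^sup>2 * ?X\<^sup>2 + Ypol s (?k - 1) * polX \<sigma>"
  proof -
    have "j = entry (s @ [\<sigma>]) ?k" unfolding j_def by (rule entry_snoc[OF k1 order_refl, symmetric])
    moreover have "distinct (s @ [\<sigma>])" using s by auto
    moreover note k1
    ultimately show ?thesis using Epol_inner[of "s @ [\<sigma>]" ?k] Aprod_snoc[of "?k - 1" s \<sigma>]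
        Ypol_snoc[of "?k - 1" s \<sigma>] by (simp add: Ypol_snoc_last)
  qed
  show ?thesis unfolding exchange_data_def Xprod_xmon[symmetric]
  proof (intro conjI allI impI ballI)
    fix z :: "'n \<Rightarrow> 'n ratfun"
    have "(\<Prod>\<rho>\<in>- set s - {\<sigma>}. (z(j := 0)) \<rho>) = (\<Prod>\<rho>\<in>- set s - {\<sigma>}. z \<rho>)"
      by (rule prod.cong) (use j in auto)
    then show "ev (z(j := 0)) (Epol s \<sigma>) = ev z (?X * prod_list (map polA s))"
      unfolding Epol_notin[OF s(2)] A s' Yj by (simp add: mult_ac)
  next
    fix z :: "'n \<Rightarrow> 'n ratfun" assume z: "z \<sigma> \<noteq> 0"
    define v where "v = ev z (?X * prod_list (map polA s)) / z \<sigma>"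
    have Yv: "ev (z(\<sigma> := v)) (Ypol s (?k - 1)) = ev z (Ypol s (?k - 1))"
      by (rule ev_upd[OF involves_Ypol_notin[OF s(2)]]) simp
    have Xv: "(\<Prod>\<rho>\<in>- set (s @ [\<sigma>]). (z(\<sigma> := v)) \<rho>) = ev z ?X"
      unfolding ev_simps by (rule prod.cong) auto
    have v: "z \<sigma> * v = ev z ?A * embc (mvar j) * ev z ?X" using z unfolding v_def A(1) by simp
    have "ev (z(\<sigma> := v)) (Epol s j) = ev z ?A * (v * ev z ?X) + embc (mvar j) * ev z (Ypol s (?k - 1))"
      unfolding j_def Epol_last[OF s(1,3)]
      by (simp only: ev_simps Yv Xprod_snoc[OF s(2), of "z(\<sigma> := v)"] Xv) simp
    then have "z \<sigma> * ev (z(\<sigma> := v)) (Epol s j) = ev z ?A * ev z ?X * (z \<sigma> * v) + embc (mvar j) * ev z (Ypol s (?k - 1)) * z \<sigma>"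
      by (simp only: algebra_simps)
    also have "\<dots> = embc (mvar j) * ev z (Epol (s @ [\<sigma>]) j)"
      unfolding v E' by (simp only: ev_simps power2_eq_square algebra_simps)
    finally show "z \<sigma> ^ 1 * ev (z(\<sigma> := ev z (?X * prod_list (map polA s)) / z \<sigma>)) (Epol s j) =
       ev z (xmon (\<lambda>_. 0) * polA j) * ev z (Epol (s @ [\<sigma>]) j)"
      unfolding v_def[symmetric] by simp
  next
    show "polA j = 1 \<or> polA j \<in> set (map polA s)" using j by simp
    show "\<not> Epol s j dvd xmon (\<lambda>_. 0) * polA j"
      by (rule not_dvd_if_Ev[OF Epol_point_minus_1[OF s(1)]]) (auto simp: j_def)
  next
    fix q :: "'n pol" assume "q \<in> set (map polA s)"
    then obtain a where q: "q = polA a" by auto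
    show "prime_elem q" "\<not> polX l dvd q" "\<not> involves q \<sigma>" "\<not> involves q j" for l
      unfolding q by (auto simp: prime_elem_polA polX_not_dvd_polA)
    let ?\<alpha> = "(\<lambda>_. 1 :: int)(a := 0)"
    \<comment> \<open>Whichever A_a is set to 0, the value is a square plus 1.\<close>
    have "Ev ?\<alpha> (\<lambda>_. 1) (Epol (s @ [\<sigma>]) j) = (\<Prod>r = 1..?k - 1. ?\<alpha> (entry s r))\<^sup>2 + 1"
      unfolding E' by (simp add: Ev_Ypol)
    then have "Ev ?\<alpha> (\<lambda>_. 1) (Epol (s @ [\<sigma>]) j) \<noteq> 0"
      using zero_le_power2[of "\<Prod>r = 1..?k - 1. ?\<alpha> (entry s r)"] by linarith
    then show "\<not> q dvd Epol (s @ [\<sigma>]) j" unfolding q by (rule not_dvd_if_Ev[rotated]) simp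
  qed auto
qed

text \<open>The degree is 2^(k - i) because the first summand is a square whose root has degree 1
  plus the sum of 2^(k - r) over i + 2 \<le> r \<le> k, that is 2^(k - i - 1). Primality of
  E_\<sigma> is a hypothesis because the induction that proves it uses this lemma.\<close>

lemma exchange_data_inner:
  fixes s :: "'n::{finite,linorder} list"
  assumes s: "distinct s" "\<sigma> \<notin> set s" and i: "1 \<le> i" "i < length s"
    and prime: "prime_elem (Epol s \<sigma>)" "\<not> Epol s (entry s i) dvd 1"
  shows "exchange_data s \<sigma> (entry s i) [Epol s \<sigma>] (\<lambda>_. 0) (\<lambda>_. 0) 1 (2 ^ (length s - i))"
proof -
  let ?k = "length s" and ?j = "entry s i"
  have i': "i \<in> {1..?k}" using i by simp
  let ?A = "\<Prod>r = 1..i - 1. polA (entry s r) :: 'n pol"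
  let ?X = "\<Prod>\<rho>\<in>- set (s @ [\<sigma>]). polX \<rho> :: 'n pol"
  let ?P' = "\<Prod>r = i + 2..Suc ?k. Ppol (s @ [\<sigma>]) r"
  have E': "Epol (s @ [\<sigma>]) ?j = ?A\<^sup>2 * ?X\<^sup>2 * ?P'\<^sup>2
      + Ypol s (i - 1) * Ypol s (i + 1) * (Cpol s i * polX \<sigma> ^ (2 ^ (?k - i)))"
  proof -
    have "?j = entry (s @ [\<sigma>]) i" by (rule entry_snoc[symmetric]) (use i in auto)
    moreover have "distinct (s @ [\<sigma>])" "i < length (s @ [\<sigma>])" using s i by auto
    ultimately show ?thesis using Epol_inner[of "s @ [\<sigma>]" i] Aprod_snoc[of "i - 1" s \<sigma>]
        Ypol_snoc[of "i - 1" s \<sigma>] Ypol_snoc[of "i + 1" s \<sigma>] Cpol_snoc[OF i(2), of \<sigma>] i by simp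
  qed
  have free: "\<not> involves (Epol s \<sigma>) ?j" by (rule not_involves_Epol_other) (use s i in auto)
  show ?thesis unfolding exchange_data_def
  proof (intro conjI allI impI ballI)
    fix z :: "'n \<Rightarrow> 'n ratfun"
    show "ev (z(?j := 0)) (Epol s \<sigma>) = ev z (xmon (\<lambda>_. 0) * prod_list [Epol s \<sigma>])"
      using ev_upd[OF free, of z 0] by simp
  next
    fix z :: "'n \<Rightarrow> 'n ratfun" assume z: "z \<sigma> \<noteq> 0"
    define z' where "z' = z(\<sigma> := ev z (Epol s \<sigma>) / z \<sigma>)"
    have z'\<sigma>: "z' \<sigma> = ev z (Epol s \<sigma>) / z \<sigma>" by (simp add: z'_def)
    have Yv: "ev z' (Ypol s r) = ev z (Ypol s r)" if "r \<le> ?k" for r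
      unfolding z'_def by (rule ev_upd[OF involves_Ypol_notin[OF s(2) that]])
    have Cv: "ev z' (Cpol s i) = ev z (Cpol s i)"
      unfolding z'_def by (rule ev_upd[OF involves_Cpol_notin[OF s(2)]])
    have Xv: "(\<Prod>\<rho>\<in>- set (s @ [\<sigma>]). z' \<rho>) = ev z ?X"
      unfolding ev_simps by (rule prod.cong) (auto simp: z'_def)
    define p where "p = (\<Prod>r = i + 2..?k. ev z' (Ppol s r))"
    have PP: "z \<sigma> ^ (2 ^ (?k - (i + 1))) * (z' \<sigma> * p) = ev z ?P'"
      unfolding ev_simps p_def
    proof -
      have "z \<sigma> ^ (2 ^ (?k - r)) * ev z' (Ppol s r) = ev z (Ppol (s @ [\<sigma>]) r)" if "r \<in> {i + 1 + 1..?k}" for r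
        unfolding z'_def by (rule Ppol_snoc[OF s, of z, OF z]) (use that in auto)
      from Ppol_snoc_prod[OF s, of z z', OF z z'\<sigma> this] i
      show "z \<sigma> ^ (2 ^ (?k - (i + 1))) * (z' \<sigma> * (\<Prod>r = i + 2..?k. ev z' (Ppol s r))) =
          (\<Prod>r = i + 2..Suc ?k. ev z (Ppol (s @ [\<sigma>]) r))" by simp
    qed
    have "?k - i = Suc (?k - (i + 1))" using i by simp
    then have zz: "z \<sigma> ^ (2 ^ (?k - i)) = (z \<sigma> ^ (2 ^ (?k - (i + 1))))\<^sup>2"
      by (simp add: power_mult[symmetric] mult.commute)
    have "ev z' (Epol s ?j) = (ev z ?A)\<^sup>2 * (z' \<sigma> * ev z ?X)\<^sup>2 * p\<^sup>2
        + ev z (Ypol s (i - 1)) * ev z (Ypol s (i + 1)) * ev z (Cpol s i)"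
      unfolding Epol_inner[OF s(1) i] p_def using i
      by (simp only: ev_simps Yv Cv Xprod_snoc[OF s(2), of z'] Xv)
    then have "z \<sigma> ^ (2 ^ (?k - i)) * ev z' (Epol s ?j) =
        (ev z ?A)\<^sup>2 * (ev z ?X)\<^sup>2 * (z \<sigma> ^ (2 ^ (?k - (i + 1))) * (z' \<sigma> * p))\<^sup>2
        + ev z (Ypol s (i - 1)) * ev z (Ypol s (i + 1)) * (ev z (Cpol s i) * z \<sigma> ^ (2 ^ (?k - i)))"
      unfolding zz by (simp only: power_mult_distrib algebra_simps)
    also have "\<dots> = ev z (Epol (s @ [\<sigma>]) ?j)"
      unfolding PP E' by (simp only: ev_simps)
    finally show "z \<sigma> ^ (2 ^ (?k - i)) * ev (z(\<sigma> := ev z (xmon (\<lambda>_. 0) * prod_list [Epol s \<sigma>]) / z \<sigma>)) (Epol s ?j) =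
        ev z (xmon (\<lambda>_. 0) * 1) * ev z (Epol (s @ [\<sigma>]) ?j)"
      by (simp add: z'_def)
  next
    fix q assume "q \<in> set [Epol s \<sigma>]"
    then have q: "q = Epol s \<sigma>" by simp
    show "prime_elem q" "\<not> polX l dvd q" "\<not> involves q \<sigma>" "\<not> involves q ?j" for l
      unfolding q using prime polX_not_dvd_Epol[OF s(1)] not_involves_Epol[OF s(1)] free by auto
    \<comment> \<open>At this zero of E_\<sigma> the product \<open>?P'\<close> vanishes through its
      last factor, which is E_\<sigma>, and the other summand is 1.\<close>
    let ?\<alpha> = "(\<lambda>_. 1 :: int)(\<sigma> := - 1)"
    have 0: "Ev ?\<alpha> (\<lambda>_. 1) (Epol s \<sigma>) = 0" by (rule Epol_point_minus_1) (use s in auto)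
    have "Ev ?\<alpha> (\<lambda>_. 1) ?P' = 0" unfolding Ev_prod
      by (rule prod_zero) (use i 0 in \<open>auto intro!: bexI[of _ "Suc ?k"] simp: Epol_snoc_new[OF s]\<close>)
    moreover have "Ev ?\<alpha> (\<lambda>_. 1) (Cpol s i) = 1" by (rule Cpol_point_1) auto
    ultimately have "Ev ?\<alpha> (\<lambda>_. 1) (Epol (s @ [\<sigma>]) ?j) = 1" unfolding E' by (simp only: Ev_simps Ev_power) (simp add: Ev_Ypol)
    then show "\<not> q dvd Epol (s @ [\<sigma>]) ?j" unfolding q by (intro not_dvd_if_Ev[OF 0]) simp
  qed (use prime in auto)
qed

lemma exchange_data_exists:
  fixes s :: "'n::{finite,linorder} list"
  assumes s: "distinct s" "\<sigma> \<notin> set s" and j: "j \<noteq> \<sigma>" and prime: "\<And>l. prime_elem (Epol s l)"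
  shows "\<exists>Q m mc d M. exchange_data s \<sigma> j Q m mc d M"
proof (cases j s rule: activation_cases)
  case notin
  from exchange_data_notin[OF s notin j] show ?thesis by blast
next
  case last
  from exchange_data_last[OF s last(1)] show ?thesis unfolding last(2) by blast
next
  case (inner i)
  have "\<not> Epol s (entry s i) dvd 1" using prime[of "entry s i"] by (simp add: prime_elem_def)
  from exchange_data_inner[OF s inner(1,2) prime this] show ?thesis unfolding inner(3) by blast
qed

lemma exchange_data_D:
  assumes "exchange_data s \<sigma> j Q m mc d M"
  shows "ev (z(j := 0)) (Epol s \<sigma>) = ev z (xmon m * prod_list Q)"
    "z \<sigma> \<noteq> 0 \<Longrightarrow> z \<sigma> ^ M * ev (z(\<sigma> := ev z (xmon m * prod_list Q) / z \<sigma>)) (Epol s j) =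
       ev z (xmon mc * d) * ev z (Epol (s @ [\<sigma>]) j)"
    "m \<sigma> = 0" "mc \<sigma> = 0" "mc j = 0" "d = 1 \<or> d \<in> set Q" "\<not> Epol s j dvd xmon mc * d"
    "q \<in> set Q \<Longrightarrow> prime_elem q" "q \<in> set Q \<Longrightarrow> \<not> polX l dvd q" "q \<in> set Q \<Longrightarrow> \<not> involves q \<sigma>"
    "q \<in> set Q \<Longrightarrow> \<not> involves q j" "q \<in> set Q \<Longrightarrow> \<not> q dvd Epol (s @ [\<sigma>]) j"
proof -
  note D = assms[unfolded exchange_data_def]
  show "ev (z(j := 0)) (Epol s \<sigma>) = ev z (xmon m * prod_list Q)"
    using D[THEN conjunct1] by (rule spec)
  show "z \<sigma> \<noteq> 0 \<Longrightarrow> z \<sigma> ^ M * ev (z(\<sigma> := ev z (xmon m * prod_list Q) / z \<sigma>)) (Epol s j) =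
       ev z (xmon mc * d) * ev z (Epol (s @ [\<sigma>]) j)"
    using D[THEN conjunct2, THEN conjunct1, THEN spec, of z] by (rule mp)
  note D' = D[THEN conjunct2, THEN conjunct2]
  show "m \<sigma> = 0" "mc \<sigma> = 0" "mc j = 0" "d = 1 \<or> d \<in> set Q" "\<not> Epol s j dvd xmon mc * d"
    using D' by blast+
  show "q \<in> set Q \<Longrightarrow> prime_elem q" "q \<in> set Q \<Longrightarrow> \<not> polX l dvd q" "q \<in> set Q \<Longrightarrow> \<not> involves q \<sigma>"
    "q \<in> set Q \<Longrightarrow> \<not> involves q j" "q \<in> set Q \<Longrightarrow> \<not> q dvd Epol (s @ [\<sigma>]) j"
    using D' by blast+
qed

lemma involves_xmon: "m i = 0 \<Longrightarrow> \<not> involves (xmon m) i"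
  unfolding xmon_def
proof (intro involves_prod)
  fix l assume "m i = 0"
  then show "\<not> involves (polX l ^ m l :: 'a pol) i" by (cases "l = i") (auto simp: involves_power)
qed

lemma involves_prod_list:
  fixes Q :: "'n pol list"
  shows "(\<And>q. q \<in> set Q \<Longrightarrow> \<not> involves q i) \<Longrightarrow> \<not> involves (prod_list Q) i"
  by (induction Q) (auto simp: involves_mult)

lemma prime_elem_Epol_snoc:
  fixes s :: "'n::{finite,linorder} list"
  assumes s: "distinct s" "\<sigma> \<notin> set s" and prime: "\<And>l. prime_elem (Epol s l)"
  shows "prime_elem (Epol (s @ [\<sigma>]) j)"
proof (cases "j = \<sigma>")
  case True
  then show ?thesis using prime Epol_snoc_new[OF s] by simp
next
  case False
  then obtain Q m mc d M where D: "exchange_data s \<sigma> j Q m mc d M"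
    using exchange_data_exists[OF s _ prime] by blast
  note D = exchange_data_D[OF D]
  have s': "distinct (s @ [\<sigma>])" using s by simp
  show ?thesis
  proof (rule prime_elem_exchange[where g = "xmon m * prod_list Q" and c = "xmon mc * d" and i = \<sigma> and M = M])
    show "prime_elem (Epol s j)" by (rule prime)
    show "\<not> polX \<sigma> dvd Epol s j" "\<not> polX \<sigma> dvd Epol (s @ [\<sigma>]) j"
      by (rule polX_not_dvd_Epol, fact)+
    show "\<not> Epol s j dvd xmon mc * d" by (rule D)
    show "\<not> involves (xmon m * prod_list Q) \<sigma>"
      by (intro involves_mult involves_xmon involves_prod_list D)
    show "\<not> involves (xmon mc * d) \<sigma>"
      using D(6) D(10) by (intro involves_mult involves_xmon D(4)) auto
    have "0 \<notin> set Q" using D(8)[of 0] by auto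
    then show "xmon m * prod_list Q \<noteq> 0" by (simp add: prod_list_zero_iff)
    show "cop (Epol (s @ [\<sigma>]) j) (xmon m * prod_list Q)"
      by (intro cop_mult cop_xmon cop_prod_list cop_prime_elem D polX_not_dvd_Epol s')
  qed (rule D(2))
qed

text \<open>Modulo A_l + \<Prod>X_\<rho> the indeterminate A_l is eliminated, which leaves a
  polynomial ring.\<close>

lemma prime_elem_Epol_Nil: "prime_elem (Epol [] l :: 'n::{finite,linorder} pol)"
proof -
  have E: "Epol [] l = polA l + (\<Prod>\<rho>\<in>- {l}. polX \<rho>) \<and> (Epol [] l :: 'n pol) \<noteq> 0"
    using polX_not_dvd_Epol[of "[]" l l] by (auto simp: Epol_notin Compl_eq_Diff_UNIV)
  show ?thesis
    by (rule prime_elem_if_evaluation[where \<alpha> = "polA(l := - (\<Prod>\<rho>\<in>- {l}. polX \<rho>))" and z = polX])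
      (use E in auto)
qed

lemma prime_elem_Epol: "distinct s \<Longrightarrow> prime_elem (Epol s l)"
  by (induction s arbitrary: l rule: rev_induct) (simp_all add: prime_elem_Epol_Nil prime_elem_Epol_snoc)

text \<open>This is the form that \<open>hat_condition_linear\<close> needs to make all exponents 0.
  For an index mutated before the last one, E_\<sigma> is free of X_j, so a = 0 and b =
  E_\<sigma>.\<close>

lemma Epol_linear:
  fixes s :: "'n::{finite,linorder} list"
  assumes s: "distinct s" "\<sigma> \<notin> set s" and "j \<noteq> \<sigma>"
  shows "\<exists>a b. Epol s \<sigma> = polX j * a + b \<and> \<not> involves a j \<and> \<not> involves b j \<and> \<not> Epol s j dvd b"
proof (cases j s rule: activation_cases)
  case notin
  let ?a = "(\<Prod>r = 1..length s. polA (entry s r)) * (\<Prod>\<rho>\<in>- set s - {\<sigma>, j}. polX \<rho>) :: 'n pol"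
  let ?b = "polA \<sigma> * Ypol s (length s) :: 'n pol"
  have "- set s - {\<sigma>} - {j} = - set s - {\<sigma>, j}" by auto
  then have "(\<Prod>\<rho>\<in>- set s - {\<sigma>}. polX \<rho> :: 'n pol) = polX j * (\<Prod>\<rho>\<in>- set s - {\<sigma>, j}. polX \<rho>)"
    using prod.remove[of "- set s - {\<sigma>}" j "polX :: 'n \<Rightarrow> 'n pol"] notin \<open>j \<noteq> \<sigma>\<close> by simp
  then have "Epol s \<sigma> = polX j * ?a + ?b" unfolding Epol_notin[OF s(2)] by (simp add: mult_ac)
  moreover have "\<not> involves ?a j" by (intro involves_mult involves_Aprod involves_prod) auto
  moreover have "\<not> involves ?b j" by (intro involves_mult involves_Ypol_notin notin) auto
  moreover have "\<not> Epol s j dvd ?b"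
    by (rule not_dvd_if_Ev[OF Epol_point_minus_1[OF s(1)]]) (use notin \<open>j \<noteq> \<sigma>\<close> in \<open>auto simp: Ev_Ypol\<close>)
  ultimately show ?thesis by blast
next
  case last
  let ?b = "(\<Prod>r = 1..length s. polA (entry s r)) * (\<Prod>\<rho>\<in>- set s - {\<sigma>}. polX \<rho>) :: 'n pol"
  have j: "j \<in> set s" using entry_last_in_set[OF last(1)] last(2) by simp
  have "Ypol s (length s) = polX j" using last by (simp add: Ypol_pos)
  then have "Epol s \<sigma> = polX j * polA \<sigma> + ?b" unfolding Epol_notin[OF s(2)] by (simp add: mult_ac)
  moreover have "\<not> involves (polA \<sigma> :: 'n pol) j" by simp
  moreover have "\<not> involves ?b j" by (intro involves_mult involves_Aprod involves_prod) (use j in auto)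
  moreover have "\<not> Epol s j dvd ?b"
    by (rule not_dvd_if_Ev[OF Epol_point_minus_1[OF s(1)]]) (use last in auto)
  ultimately show ?thesis by blast
next
  case (inner i)
  \<comment> \<open>Both are prime, so the cofactor would be a unit. At X_\<sigma> = 0 its value
    would equal that of E_\<sigma>, at least 2, since E_j has value 1 there; but units take unit
    values in Z.\<close>
  have "\<not> Epol s j dvd Epol s \<sigma>"
  proof
    assume "Epol s j dvd Epol s \<sigma>"
    then obtain u where u: "Epol s \<sigma> = Epol s j * u" by (rule dvdE)
    have "Epol s j dvd 1 \<or> u dvd 1"
      using irreducibleD[OF prime_elem_irreducible[OF prime_elem_Epol[OF s(1)]] u] .
    then have "u dvd 1" using prime_elem_Epol[OF s(1), of j] by (auto simp: prime_elem_def)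
    let ?z = "(\<lambda>_. 1 :: int)(\<sigma> := 0)"
    have "Ev (\<lambda>_. 1) ?z (Epol s \<sigma>) = Ev (\<lambda>_. 1) ?z u"
      using Epol_point_0[OF s \<open>j \<noteq> \<sigma>\<close>] unfolding u by simp
    moreover have "2 \<le> Ev (\<lambda>_. 1) ?z (Epol s \<sigma>)"
      unfolding Ev_upd[OF not_involves_Epol[OF s(1)]] by (rule Epol_point_1[OF s(1)])
    moreover have "Ev (\<lambda>_. 1) ?z u dvd 1" by (rule Ev_unit) fact
    ultimately show False by auto
  qed
  moreover have "\<not> involves (Epol s \<sigma>) j" unfolding inner(3)
    by (rule not_involves_Epol_other) (use s inner in auto)
  ultimately show ?thesis by (intro exI[of _ 0] exI[of _ "Epol s \<sigma>"]) simp
qed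

section \<open>One mutation\<close>

lemma prime_elem_unit_mult:
  fixes p :: "'a::idom"
  assumes "u dvd 1" "prime_elem p"
  shows "prime_elem (u * p)"
  using assms by (auto simp: prime_elem_def unit_mult_dvd_iff')

lemma unit_dvd_mult_iff:
  fixes p :: "'a::comm_semiring_1"
  assumes "u dvd 1"
  shows "p dvd u * q \<longleftrightarrow> p dvd q"
  using copD[OF cop_unit[OF assms], of p q] by (auto simp: mult.commute)

text \<open>\<eta> holds the units left open by the choice of exchange polynomials; w_l turns the
  cluster variable of the seed into that of the reference seed.\<close>

definition rescaled ::
    "('n::{finite,linorder} \<Rightarrow> 'n coef) \<Rightarrow> ('n \<Rightarrow> 'n coef) \<Rightarrow> 'n list \<Rightarrow> 'n \<Rightarrow> 'n pol"
  where "rescaled \<eta> w s l = pconst (\<eta> l) * tw w (Epol s l)"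

lemma rescaled_1: "rescaled (\<lambda>_. 1) (\<lambda>_. 1) s = Epol s"
  by (simp add: rescaled_def fun_eq_iff pconst_simps)

lemma ev_rescaled: "ev z (rescaled \<eta> w s l) = embc (\<eta> l) * ev (\<lambda>l. embc (w l) * z l) (Epol s l)"
  by (simp add: rescaled_def ev_tw)

lemma hat_exponents_rescaled_iff:
  fixes s :: "'n::{finite,linorder} list"
  assumes s: "distinct s" "\<sigma> \<notin> set s" and \<eta>: "\<And>l. \<eta> l dvd 1" and w: "\<And>l. w l dvd 1"
  shows "hat_exponents (rescaled \<eta> w s) \<sigma> a \<longleftrightarrow> a = (\<lambda>_. 0)"
proof -
  let ?F = "rescaled \<eta> w s"
  have prime: "prime_elem (?F l)" for l
    unfolding rescaled_def
    by (intro prime_elem_unit_mult pconst_dvd_1 prime_elem_tw prime_elem_Epol \<eta> w s)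
  have X: "\<not> polX i dvd ?F l" for i l
    unfolding rescaled_def unit_dvd_mult_iff[OF pconst_dvd_1[OF \<eta>]] polX_dvd_tw_iff[where w = w, OF w]
    by (rule polX_not_dvd_Epol[OF s(1)])
  have "hat_exponents ?F \<sigma> (\<lambda>_. 0)"
    unfolding hat_exponents_def Let_def hat_at_0
  proof (intro conjI allI impI)
    fix j assume "j \<noteq> \<sigma>"
    then obtain a b where ab: "Epol s \<sigma> = polX j * a + b" "\<not> involves a j" "\<not> involves b j" "\<not> Epol s j dvd b"
      using Epol_linear[OF s] by blast
    have F: "?F \<sigma> = polX j * (pconst (\<eta> \<sigma> * w j) * tw w a) + pconst (\<eta> \<sigma>) * tw w b"
      by (simp add: rescaled_def ab(1) pconst_simps algebra_simps)
    have "\<not> ?F j dvd pconst (\<eta> \<sigma>) * tw w b"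
      unfolding rescaled_def unit_dvd_mult_iff[OF pconst_dvd_1[OF \<eta>]] unit_mult_dvd_iff'[OF pconst_dvd_1[OF \<eta>]]
        tw_dvd_iff[where w = w, OF w] by (rule ab(4))
    moreover have "\<not> involves (pconst (\<eta> \<sigma> * w j) * tw w a) j" "\<not> involves (pconst (\<eta> \<sigma>) * tw w b) j"
      by (intro involves_mult involves_tw ab involves_pconst)+
    ultimately show "ev (ratX(j := emb (?F j) / ratX j)) (?F \<sigma>) \<in> laurent"
      "\<not> laurent_dvd (emb (?F j)) (ev (ratX(j := emb (?F j) / ratX j)) (?F \<sigma>))"
      using hat_condition_linear[OF prime X] unfolding F by blast+
  qed simp_all
  moreover have "?F l \<noteq> 0" for l using prime[of l] by auto
  ultimately show ?thesis using hat_exponents_unique by blast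
qed

lemma tw_xmon: "tw w (xmon m) = pconst (\<Prod>l\<in>UNIV. w l ^ m l) * xmon m"
proof -
  have p: "pconst (\<Prod>l\<in>B. f l) = (\<Prod>l\<in>B. pconst (f l))" for f :: "'a \<Rightarrow> 'a coef" and B
    by (induction B rule: infinite_finite_induct) (auto simp: pconst_simps)
  have q: "pconst (a ^ k) = pconst a ^ k" for a :: "'a coef" and k
    by (induction k) (auto simp: pconst_simps)
  have "tw w (xmon m) = (\<Prod>l\<in>UNIV. (pconst (w l) * polX l) ^ m l)" by (simp add: tw_def xmon_def)
  then show ?thesis by (simp add: xmon_def p q power_mult_distrib prod.distrib)
qed

lemma tw_prod_list: "tw w (prod_list Q) = prod_list (map (tw w) Q)"
  by (induction Q) auto

lemma unit_prod_power:
  fixes w :: "'b \<Rightarrow> 'a::comm_semiring_1"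
  assumes "\<And>l. w l dvd 1"
  shows "(\<Prod>l\<in>B. w l ^ m l) dvd 1"
  using prod_dvd_prod[of B "\<lambda>l. w l ^ m l" "\<lambda>l. 1 ^ m l"] dvd_power_same[OF assms] by simp

lemma unit_mult: "a dvd 1 \<Longrightarrow> b dvd 1 \<Longrightarrow> a * b dvd (1 :: 'a::comm_semiring_1)"
  using mult_dvd_mono[of a 1 b 1] by simp

lemma lmonom_quotient:
  "lmonom (\<lambda>l. int (m l) - int (k l)) = emb (xmon m) / emb (xmon k)"
proof -
  have "lmonom (\<lambda>l. int (m l) - int (k l)) * lmonom (\<lambda>l. int (k l)) = lmonom (\<lambda>l. int (m l))"
    by (simp add: lmonom_mult)
  then show ?thesis unfolding lmonom_of_nat by (simp add: field_simps)
qed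

text \<open>The new variable at \<sigma> is w_\<sigma> \<eta>_\<sigma> times the reference one, so
  the unit v that corrects it is the inverse of this product. The other entries of w
  persist.\<close>

lemma new_exchange_rescaled_iff:
  fixes s :: "'n::{finite,linorder} list"
  assumes s: "distinct s" "\<sigma> \<notin> set s" and \<eta>: "\<And>l. \<eta> l dvd 1" and w: "\<And>l. w l dvd 1"
    and v: "w \<sigma> * \<eta> \<sigma> * v = 1" and "j \<noteq> \<sigma>"
  shows "new_exchange (rescaled \<eta> w s) \<sigma> (\<lambda>_. 0) j P \<longleftrightarrow>
    (\<exists>u. u dvd 1 \<and> P = pconst u * tw (w(\<sigma> := v)) (Epol (s @ [\<sigma>]) j))"
proof -
  let ?F = "rescaled \<eta> w s" and ?E' = "Epol (s @ [\<sigma>]) j"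
  obtain Q m mc d M where D: "exchange_data s \<sigma> j Q m mc d M"
    using exchange_data_exists[OF s \<open>j \<noteq> \<sigma>\<close> prime_elem_Epol[OF s(1)]] by blast
  note D = exchange_data_D[OF D]
  define w' where "w' = w(\<sigma> := v)"
  have "v dvd 1" using v by (metis dvd_triv_right)
  then have w': "w' l dvd 1" for l using w by (simp add: w'_def)
  define W where "W = (\<lambda>l. embc (w l) * ratX l)"
  define Z where "Z = (\<lambda>l. embc (w' l) * ratX l)"
  define g where "g = xmon m * prod_list Q"
  have g: "\<not> involves g \<sigma>" unfolding g_def by (intro involves_mult involves_xmon involves_prod_list D)
  define g' where "g' = ev (ratX(j := 0)) (?F \<sigma>)"
  have tw: "tw w' p = tw w p" if "\<not> involves p \<sigma>" for p unfolding w'_def by (rule tw_upd[OF that])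
  have "(\<lambda>l. embc (w l) * (ratX(j := 0)) l) = W(j := 0)" by (auto simp: W_def)
  then have g'W: "g' = embc (\<eta> \<sigma>) * ev W g" unfolding g'_def ev_rescaled g_def D(1)[symmetric] by simp
  have gZ: "ev W g = emb (tw w' g)" unfolding tw[OF g] emb_tw W_def ..
  define um where "um = (\<Prod>l\<in>UNIV. w' l ^ m l)"
  have g'eq: "g' = embc (\<eta> \<sigma> * um) * emb (xmon m * prod_list (map (tw w') Q))"
    unfolding g'W gZ by (simp add: g_def um_def tw_xmon tw_prod_list pconst_simps mult_ac)
  have vinv: "embc (w \<sigma>) * embc (\<eta> \<sigma>) * embc v = 1"
    using arg_cong[OF v, of embc] by (simp only: embc_hom)
  have v0: "embc v \<noteq> 0"
  proof
    assume 0: "embc v = 0"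
    show False using vinv unfolding 0 by simp
  qed
  have Z\<sigma>: "Z \<sigma> = embc v * ratX \<sigma>" by (simp add: Z_def w'_def)
  then have Z0: "Z \<sigma> \<noteq> 0" using v0 by simp
  have ZW: "ev Z g = ev W g" unfolding gZ emb_tw Z_def ..
  \<comment> \<open>The rescaled mutation at \<open>ratX\<close> is the reference mutation at the
    point \<open>Z\<close>. This uses that the identities in \<open>exchange_data\<close> hold at
    every admissible point.\<close>
  have pt: "(\<lambda>l. embc (w l) * (ratX(\<sigma> := g' / ratX \<sigma>)) l) = Z(\<sigma> := ev Z g / Z \<sigma>)"
  proof
    fix l
    have "embc (w \<sigma>) * g' * embc v = ev W g" unfolding g'W using vinv by (simp add: mult_ac)
    then have "embc (w \<sigma>) * g' = ev W g / embc v" using v0 by (simp add: nonzero_eq_divide_eq)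
    then show "embc (w l) * (ratX(\<sigma> := g' / ratX \<sigma>)) l = (Z(\<sigma> := ev Z g / Z \<sigma>)) l"
      unfolding ZW Z\<sigma> by (cases "l = \<sigma>") (simp_all add: Z_def w'_def)
  qed
  let ?k = "\<lambda>l. if l = \<sigma> then M else 0"
  have k: "xmon ?k = polX \<sigma> ^ M" unfolding xmon_def
    by (simp add: if_distrib[of "\<lambda>k. _ ^ k"] cong: if_cong)
  define umc where "umc = (\<Prod>l\<in>UNIV. w' l ^ mc l)"
  \<comment> \<open>The factors come from the polynomial at j, from the monomial
    \<open>xmon mc\<close> after rescaling, and from moving v^M to the other side.\<close>
  define u1 where "u1 = \<eta> j * umc * (w \<sigma> * \<eta> \<sigma>) ^ M"
  define e1 where "e1 = (\<lambda>l. int (mc l) - int (?k l))"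
  have um: "um dvd 1" and umc: "umc dvd 1" unfolding um_def umc_def by (rule unit_prod_power[OF w'])+
  have powu: "a ^ k dvd 1" if "a dvd 1" for a :: "'n coef" and k
    using dvd_power_same[OF that, of k] by simp
  have u1: "u1 dvd 1" unfolding u1_def by (intro unit_mult \<eta> umc powu w)
  have "Z \<sigma> ^ M * ev (Z(\<sigma> := ev Z g / Z \<sigma>)) (Epol s j) = ev Z (xmon mc * d) * ev Z ?E'"
    unfolding g_def by (rule D(2)[of Z, OF Z0])
  also have "\<dots> = emb (tw w' (xmon mc * d)) * emb (tw w' ?E')" unfolding emb_tw Z_def ..
  also have "\<dots> = embc umc * emb (xmon mc) * emb (tw w' d * tw w' ?E')"
    by (simp add: tw_xmon umc_def mult_ac)
  finally have Zev: "embc v ^ M * ratX \<sigma> ^ M * ev (Z(\<sigma> := ev Z g / Z \<sigma>)) (Epol s j) =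
      embc umc * emb (xmon mc) * emb (tw w' d * tw w' ?E')"
    unfolding Z\<sigma> power_mult_distrib .
  have vM: "(embc (w \<sigma>) * embc (\<eta> \<sigma>)) ^ M * embc v ^ M = 1"
    unfolding power_mult_distrib[symmetric] vinv by simp
  have powc: "embc (a ^ k) = embc a ^ k" for a :: "'n coef" and k
    by (induction k) (simp_all only: power_0 power_Suc embc_hom)
  have G: "ev (ratX(\<sigma> := g' / ratX \<sigma>)) (?F j) = embc u1 * lmonom e1 * emb (tw w' d * tw w' ?E')"
  proof -
    let ?ev = "ev (Z(\<sigma> := ev Z g / Z \<sigma>)) (Epol s j)" and ?wM = "(embc (w \<sigma>) * embc (\<eta> \<sigma>)) ^ M"
    have "ratX \<sigma> ^ M * ?ev = (?wM * embc v ^ M) * (ratX \<sigma> ^ M * ?ev)" unfolding vM by simp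
    also have "\<dots> = ?wM * (embc v ^ M * ratX \<sigma> ^ M * ?ev)" by (simp only: mult_ac)
    also have "\<dots> = ?wM * (embc umc * emb (xmon mc) * emb (tw w' d * tw w' ?E'))" unfolding Zev ..
    finally have "?ev = ?wM * (embc umc * emb (xmon mc) * emb (tw w' d * tw w' ?E')) / ratX \<sigma> ^ M"
      by (simp add: nonzero_eq_divide_eq mult.commute)
    then show ?thesis
      unfolding ev_rescaled pt u1_def e1_def lmonom_quotient k emb_power embc_hom powc
      by (simp only: times_divide_eq_left times_divide_eq_right mult_ac)
  qed
  show ?thesis unfolding w'_def[symmetric]
  proof (rule new_exchange_iff[where Q = "map (tw w') Q" and ?m0.0 = m and c = "tw w' d" and ?e1.0 = e1
        and ?u0.0 = "\<eta> \<sigma> * um" and ?u1.0 = u1])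
    show "ev (ratX(j := 0)) (?F \<sigma>) = embc (\<eta> \<sigma> * um) * emb (xmon m * prod_list (map (tw w') Q))"
      using g'eq unfolding g'_def .
    show "\<eta> \<sigma> * um dvd 1" by (intro unit_mult \<eta> um)
    show "ev (ratX(\<sigma> := ev (ratX(j := 0)) (?F \<sigma>) / ratX \<sigma>)) (?F j) = embc u1 * lmonom e1 * emb (tw w' d * tw w' ?E')"
      using G unfolding g'_def .
    show "u1 dvd 1" by (rule u1)
    show "e1 j = 0" using D(5) \<open>j \<noteq> \<sigma>\<close> by (simp add: e1_def)
    show "\<not> polX l dvd tw w' ?E'" for l
      unfolding polX_dvd_tw_iff[where w = w', OF w'] by (rule polX_not_dvd_Epol) (use s in simp)
    show "tw w' d = 1 \<or> tw w' d \<in> set (map (tw w') Q)" using D(6) by auto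
    fix q assume "q \<in> set (map (tw w') Q)"
    then obtain p where p: "p \<in> set Q" "q = tw w' p" by auto
    show "prime_elem q" unfolding p(2) by (rule prime_elem_tw[OF w' D(8)[OF p(1)]])
    show "\<not> polX l dvd q" for l
      unfolding p(2) polX_dvd_tw_iff[where w = w', OF w'] by (rule D(9)[OF p(1)])
    show "\<not> involves q \<sigma> \<and> \<not> involves q j"
      unfolding p(2) by (intro conjI involves_tw D(10,11) p(1))
    show "\<not> q dvd tw w' ?E'"
      unfolding p(2) tw_dvd_iff[where w = w', OF w'] by (rule D(12)[OF p(1)])
  qed
qed

section \<open>Activation sequences\<close>

lemma mutations_snoc: "mutations (s @ [i]) S T \<longleftrightarrow> (\<exists>S'. mutations s S S' \<and> mutation i S' T)"
  by (induction s arbitrary: S) (auto simp del: split_paired_Ex)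

lemma is_seed_Epol:
  fixes s :: "'n::{finite,linorder} list"
  assumes "distinct s" "poly_basis Y"
  shows "is_seed (Y, Epol s)"
  using assms by (simp add: is_seed_def generating_transcendence_basis_if_poly_basis prime_elem_irreducible
      prime_elem_Epol polX_not_dvd_Epol not_involves_Epol)

lemma tau_eq: "tau = (ratX, Epol [])"
  by (auto simp: tau_def Epol_notin Compl_eq_Diff_UNIV add.commute)

text \<open>One reference cluster Y serves both claims: it realizes \<open>Epol s\<close>, and every
  other outcome is measured against it, so that the units of a further mutation can be
  compared.\<close>

lemma activation_mutations:
  fixes s :: "'n::{finite,linorder} list"
  assumes "distinct s"
  shows "\<exists>Y. poly_basis Y \<and> mutations s tau (Y, Epol s) \<and>
    (\<forall>T. mutations s tau T \<longrightarrow> (\<exists>\<eta> w. (\<forall>l. \<eta> l dvd 1) \<and> (\<forall>l. w l dvd 1) \<and>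
       exch T = rescaled \<eta> w s \<and> (\<forall>l. embc (w l) * cluster T l = Y l)))"
  using assms
proof (induction s rule: rev_induct)
  case Nil
  have "exch tau = rescaled (\<lambda>_. 1) (\<lambda>_. 1) []" "embc 1 * cluster tau l = ratX l" for l :: 'n
    by (simp_all only: tau_eq rescaled_1 snd_conv fst_conv embc_hom mult_1_left)
  then have "\<exists>\<eta> w. (\<forall>l. \<eta> l dvd 1) \<and> (\<forall>l. w l dvd 1) \<and>
       exch tau = rescaled \<eta> w [] \<and> (\<forall>l :: 'n. embc (w l) * cluster tau l = ratX l)"
    by (intro exI[of _ "\<lambda>_. 1"] conjI allI dvd_refl)
  then show ?case
    by (intro exI[of _ ratX]) (simp add: poly_basis_ratX tau_eq)
next
  case (snoc \<sigma> s)
  then have s: "distinct s" "\<sigma> \<notin> set s" and s': "distinct (s @ [\<sigma>])" by auto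
  obtain Y where Y: "poly_basis Y" "mutations s tau (Y, Epol s)"
    and T: "\<And>T. mutations s tau T \<Longrightarrow> \<exists>\<eta> w. (\<forall>l. \<eta> l dvd 1) \<and> (\<forall>l. w l dvd 1) \<and>
       exch T = rescaled \<eta> w s \<and> (\<forall>l. embc (w l) * cluster T l = Y l)"
    using snoc.IH[OF s(1)] by blast
  define Y' where "Y' = Y(\<sigma> := ev Y (Epol s \<sigma>) / Y \<sigma>)"
  have "Epol s \<sigma> \<noteq> 0" using prime_elem_Epol[OF s(1), of \<sigma>] by auto
  then have Y': "poly_basis Y'" unfolding Y'_def by (intro poly_basis_exchange Y not_involves_Epol s)
  have inv: "involves (Epol s j) \<sigma> \<longleftrightarrow> j \<noteq> \<sigma>" for j
    using involves_Epol[OF s, of j] not_involves_Epol[OF s(1), of \<sigma>] by auto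
  note new = Epol_snoc_new(2)[OF s]
  have "mutation \<sigma> (Y, Epol s) (Y', Epol (s @ [\<sigma>]))"
    unfolding mutation_def fst_conv snd_conv
  proof (intro conjI exI[of _ "\<lambda>_. 0"] allI)
    show "is_seed (Y, Epol s)" "is_seed (Y', Epol (s @ [\<sigma>]))"
      by (rule is_seed_Epol, fact, fact)+
    show "hat_exponents (Epol s) \<sigma> (\<lambda>_. 0)"
      using hat_exponents_rescaled_iff[OF s, of "\<lambda>_. 1" "\<lambda>_. 1"] by (simp add: rescaled_1)
    show "Y' = Y(\<sigma> := hat_at (Epol s) \<sigma> (\<lambda>_. 0) Y / Y \<sigma>)" by (simp add: Y'_def)
    fix j
    have "new_exchange (Epol s) \<sigma> (\<lambda>_. 0) j (Epol (s @ [\<sigma>]) j)" if "j \<noteq> \<sigma>"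
      using new_exchange_rescaled_iff[OF s, of "\<lambda>_. 1" "\<lambda>_. 1" 1 j] that
      by (auto simp: rescaled_1 fun_upd_def pconst_simps intro!: exI[of _ 1])
    then show "if involves (Epol s j) \<sigma> then new_exchange (Epol s) \<sigma> (\<lambda>_. 0) j (Epol (s @ [\<sigma>]) j)
      else Epol (s @ [\<sigma>]) j = Epol s j"
      unfolding inv using new by auto
  qed
  then have "mutations (s @ [\<sigma>]) tau (Y', Epol (s @ [\<sigma>]))"
    unfolding mutations_snoc using Y(2) by blast
  moreover have "\<exists>\<eta> w. (\<forall>l. \<eta> l dvd 1) \<and> (\<forall>l. w l dvd 1) \<and>
      exch T' = rescaled \<eta> w (s @ [\<sigma>]) \<and> (\<forall>l. embc (w l) * cluster T' l = Y' l)"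
    if T': "mutations (s @ [\<sigma>]) tau T'" for T'
  proof -
    obtain S where S: "mutations s tau S" "mutation \<sigma> S T'" using T' unfolding mutations_snoc by blast
    obtain \<eta> w where \<eta>: "\<And>l. \<eta> l dvd 1" and w: "\<And>l. w l dvd 1" and F: "exch S = rescaled \<eta> w s"
      and cl: "\<And>l. embc (w l) * cluster S l = Y l"
      using T[OF S(1)] by blast
    obtain a where a: "hat_exponents (rescaled \<eta> w s) \<sigma> a"
      and cl': "cluster T' = (cluster S)(\<sigma> := hat_at (rescaled \<eta> w s) \<sigma> a (cluster S) / cluster S \<sigma>)"
      and ex: "\<And>j. if involves (rescaled \<eta> w s j) \<sigma> then new_exchange (rescaled \<eta> w s) \<sigma> a j (exch T' j)
             else exch T' j = rescaled \<eta> w s j"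
      using S(2) unfolding mutation_def F by blast
    have a0: "a = (\<lambda>_. 0)" using a unfolding hat_exponents_rescaled_iff[OF s, of \<eta> w, OF \<eta> w] .
    have "w \<sigma> * \<eta> \<sigma> dvd 1" by (intro unit_mult \<eta> w)
    then obtain v where v: "v dvd 1" "w \<sigma> * \<eta> \<sigma> * v = 1" using embc_unit_inverse by metis
    define w' where "w' = w(\<sigma> := v)"
    have w': "w' l dvd 1" for l using w v by (simp add: w'_def)
    have inv': "involves (rescaled \<eta> w s j) \<sigma> \<longleftrightarrow> j \<noteq> \<sigma>" for j
      unfolding rescaled_def involves_unit_tw_iff[where w = w, OF w \<eta>] by (rule inv)
    have "\<exists>u. u dvd 1 \<and> exch T' j = pconst u * tw w' (Epol (s @ [\<sigma>]) j)" for j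
    proof (cases "j = \<sigma>")
      case True
      \<comment> \<open>The families \<open>w'\<close> and \<open>w\<close> differ only at \<sigma>,
        a variable that E_\<sigma> does not involve.\<close>
      have "tw w' (Epol s \<sigma>) = tw w (Epol s \<sigma>)"
        unfolding w'_def by (rule tw_upd) (rule not_involves_Epol[OF s(1)])
      moreover have "exch T' \<sigma> = rescaled \<eta> w s \<sigma>" using ex[of \<sigma>] by (simp add: inv')
      ultimately have "exch T' \<sigma> = pconst (\<eta> \<sigma>) * tw w' (Epol (s @ [\<sigma>]) \<sigma>)" by (simp only: rescaled_def new)
      then show ?thesis using \<eta> unfolding True by blast
    next
      case False
      then have "new_exchange (rescaled \<eta> w s) \<sigma> (\<lambda>_. 0) j (exch T' j)" using ex[of j] by (simp add: inv' a0)
      then show ?thesis unfolding new_exchange_rescaled_iff[OF s, of \<eta> w, OF \<eta> w v(2) False] w'_def .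
    qed
    then obtain \<eta>' where \<eta>': "\<And>j. \<eta>' j dvd 1" "\<And>j. exch T' j = pconst (\<eta>' j) * tw w' (Epol (s @ [\<sigma>]) j)"
      by metis
    have "embc (w' l) * cluster T' l = Y' l" for l
    proof (cases "l = \<sigma>")
      case True
      have vinv: "embc (w \<sigma>) * embc (\<eta> \<sigma>) * embc v = 1"
        using arg_cong[OF v(2), of embc] by (simp only: embc_hom)
      have "Y \<sigma> \<noteq> 0" by (rule poly_basis_nonzero[OF Y(1)])
      then have "cluster S \<sigma> \<noteq> 0" using cl[of \<sigma>] by auto
      have "(\<lambda>l. embc (w l) * cluster S l) = Y" using cl by (rule ext)
      then have h: "hat_at (rescaled \<eta> w s) \<sigma> a (cluster S) = embc (\<eta> \<sigma>) * ev Y (Epol s \<sigma>)"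
        unfolding a0 hat_at_0 ev_rescaled by simp
      have "embc v * (embc (\<eta> \<sigma>) * ev Y (Epol s \<sigma>) / cluster S \<sigma>) * (embc (w \<sigma>) * cluster S \<sigma>)
          = (embc (w \<sigma>) * embc (\<eta> \<sigma>) * embc v) * ev Y (Epol s \<sigma>)"
        using \<open>cluster S \<sigma> \<noteq> 0\<close> by simp
      then have "embc v * (embc (\<eta> \<sigma>) * ev Y (Epol s \<sigma>) / cluster S \<sigma>) * Y \<sigma> = ev Y (Epol s \<sigma>)"
        unfolding cl vinv by simp
      then have "embc v * (embc (\<eta> \<sigma>) * ev Y (Epol s \<sigma>) / cluster S \<sigma>) = ev Y (Epol s \<sigma>) / Y \<sigma>"
        by (rule iffD2[OF nonzero_eq_divide_eq[OF \<open>Y \<sigma> \<noteq> 0\<close>]])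
      then show ?thesis unfolding True cl' h Y'_def w'_def by (simp only: fun_upd_same)
    next
      case False
      then show ?thesis using cl[of l] by (simp add: cl' w'_def Y'_def)
    qed
    moreover have "exch T' = rescaled \<eta>' w' (s @ [\<sigma>])" using \<eta>'(2) by (simp add: rescaled_def fun_eq_iff)
    ultimately show ?thesis using \<eta>'(1) w' by blast
  qed
  ultimately show ?case using Y' by blast
qed

lemma embc_unit_quotient:
  assumes "u dvd 1" "v dvd 1" "embc u * x = y" "embc v * x' = y"
  shows "\<exists>t. t dvd 1 \<and> x' = embc t * x"
proof -
  obtain v' where v': "v' dvd 1" "embc v * embc v' = 1" "v * v' = 1" by (rule embc_unit_inverse[OF assms(2)])
  have "x' = (embc v * embc v') * x'" unfolding v'(2) by simp
  also have "\<dots> = embc v' * (embc v * x')" by (simp only: mult_ac)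
  also have "\<dots> = embc (v' * u) * x" unfolding assms(4) assms(3)[symmetric] embc_hom by (simp only: mult_ac)
  finally show ?thesis using unit_mult[OF v'(1) assms(1)] by blast
qed

text \<open>As mutation is a relation, the claim is that E is one outcome and that all outcomes
  agree up to units; the first conjunct keeps the second from being vacuous. Two outcomes are
  compared through the reference seed.\<close>

theorem theorem4p2:
  fixes s :: "'n::{finite,linorder} list"
  assumes "distinct s"
  shows "(\<exists>T. mutations s (tau :: 'n seed) T \<and> (\<forall>l. exch T l = Epol s l)) \<and>
         (\<forall>T T'. mutations s (tau :: 'n seed) T \<and> mutations s (tau :: 'n seed) T' \<longrightarrow> seed_equiv T T')"
proof -
  obtain Y where Y: "mutations s tau (Y, Epol s)"
    and T: "\<And>T. mutations s tau T \<Longrightarrow> \<exists>\<eta> w. (\<forall>l. \<eta> l dvd 1) \<and> (\<forall>l. w l dvd 1) \<and>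
       exch T = rescaled \<eta> w s \<and> (\<forall>l. embc (w l) * cluster T l = Y l)"
    using activation_mutations[OF assms] by blast
  have units: "(\<exists>u. u dvd 1 \<and> embc u * cluster T i = Y i) \<and>
      (\<exists>u. u dvd 1 \<and> embc u * ev (cluster T) (exch T i) = ev Y (Epol s i))"
    if mT: "mutations s tau T" for T i
  proof -
    obtain \<eta> w where \<eta>: "\<And>l. \<eta> l dvd 1" and w: "\<And>l. w l dvd 1" and F: "exch T = rescaled \<eta> w s"
      and cl: "\<And>l. embc (w l) * cluster T l = Y l"
      using T[OF mT] by blast
    obtain \<eta>' where \<eta>': "\<eta>' dvd 1" "embc (\<eta> i) * embc \<eta>' = 1" "\<eta> i * \<eta>' = 1"
      by (rule embc_unit_inverse[OF \<eta>])
    have "(\<lambda>l. embc (w l) * cluster T l) = Y" using cl by (rule ext)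
    then have "embc \<eta>' * ev (cluster T) (exch T i) = (embc (\<eta> i) * embc \<eta>') * ev Y (Epol s i)"
      unfolding F ev_rescaled by (simp add: mult_ac)
    then show ?thesis using \<eta>' w cl by auto
  qed
  have "seed_equiv T T'" if "mutations s tau T" "mutations s tau T'" for T T'
    unfolding seed_equiv_def
  proof (intro allI conjI)
    fix i
    show "\<exists>u. u dvd 1 \<and> cluster T' i = embc u * cluster T i"
      using units[OF that(1), of i] units[OF that(2), of i] embc_unit_quotient by blast
    show "\<exists>u. u dvd 1 \<and> ev (cluster T') (exch T' i) = embc u * ev (cluster T) (exch T i)"
      using units[OF that(1), of i] units[OF that(2), of i] embc_unit_quotient by blast
  qed
  moreover have "\<exists>T. mutations s tau T \<and> (\<forall>l. exch T l = Epol s l)"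
    using Y by (intro exI[of _ "(Y, Epol s)"]) simp
  ultimately show ?thesis by blast
qed

end
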